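(* Consider the noisy distributed integral controlled system on $\mathbb{Z}_L^d$ ($N=L^d$) $$\begin{bmatrix}\dot z\\ \dot x\\ \dot v\end{bmatrix}=\begin{bmatrix}A&0&-c_oI\\ 0&0&I\\ I&F&G\end{bmatrix}\begin{bmatrix}z\\ x\\ v\end{bmatrix}+\begin{bmatrix}0&-c_o\varepsilon I\\ 0&0\\ I&0\end{bmatrix}\bar w,$$ where $\bar w$ is a vector of uncorrelated white noise, $c_o>0$ is a fixed gain, and $F,G,A$ are fixed feedback operators satisfying the assumptions of relative position measurements, locality, reflection symmetry and coordinate decoupling. Let $\beta=\max\{\|f\|_\infty,\|g\|_\infty\}$. Then the per-site variance $V_N$ scales asymptotically in $N$ as follows, up to constants independent of the network size $N$, the algorithm parameter $\beta$ and the relative noise intensity $\varepsilon$. Local error: $$V_N\sim\frac1\beta+\frac{\varepsilon^2}{\beta}\begin{cases}N&d=1\\ \log N&d=2\\ 1&d\ge3.\end{cases}$$ Global error: $$V_N\sim\frac1\beta+\frac{\varepsilon^2}{\beta}\begin{cases}N^3&d=1\\ N&d=2\\ N^{1/3}&d=3\\ \log N&d=4\\ 1&d\ge5.\end{cases}$$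
   Context: Network: $\mathbb{Z}_L^d$ is the $d$-dimensional discrete torus with $N=L^d$ nodes. At each node $k$ there are states $x_k$ (position), $v_k$ (velocity) and a controller integral state $z_k$. They arise from $\dot x=v$, $\dot v=Fx+Gv+u+w$, with control $u=z$, $\dot z=-c_ov^m+Az$, and noisy measurement $v^m=v+\eta$, where $w$ and $\eta$ are uncorrelated white noises and $\varepsilon$ is the intensity of $\eta$ relative to $w$, entering through the input matrix in the claim. Feedback operators are convolutions: $(Fx)_k=\sum_{l\in\mathbb{Z}_L^d}f_{k-l}x_l$ with function array $f=\{f_k\}$, and similarly $G$ with $g$ and $A$ with $a$. Assumptions. Relative position measurements: $\sum_kf_k=0$, and $A$ is subject to the same requirement $\sum_ka_k=0$. $G$ may contain absolute feedback, with gain $g_o>0$. Locality: $f_k=g_k=a_k=0$ for $|k|>q$, with $q$ independent of $L$. Reflection symmetry: $f_k=f_{-k}$, $g_k=g_{-k}$, $a_k=a_{-k}$. Coordinate decoupling: the feedback in each of the $d$ coordinate directions is decoupled from the components in the other coordinates, and the array elements of all feedback operators are isotropic. Fourier symbols: $\hat f(\theta)=\sum_{k\in\mathbb{Z}^d}f_ke^{-i\theta\cdot k}$ for $\theta\in[-\pi,\pi]^d$ (arrays extended by zero to $\mathbb{Z}^d$), similarly $\hat g,\hat a$. Thus $\hat f(\theta)=-\sum_kf_k(1-\cos(\theta\cdot k))$, $\hat a(\theta)=-\sum_ka_k(1-\cos(\theta\cdot k))$ and $\hat g(\theta)=-g_o-\sum_kg_k(1-\cos(\theta\cdot k))$. Admissible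 operators satisfy, for $\theta\in[-\pi,\pi]^d$, $\hat f(\theta)\sim-\|f\|_\infty|\theta|^2$, $\hat a(\theta)\sim-\|a\|_\infty|\theta|^2$, $\hat g(\theta)\sim-g_o$ (i.e. equal in sign and order up to positive constant factors independent of $\theta$). The diagonalized system matrices are Hurwitz for all $\theta\ne0$. Outputs. Global error: $y_k=x_k-\frac1N\sum_{l}x_l$. Local error: $y_k=x_k-x_{k-1}$ (deviation from nearest neighbour), whose Fourier symbol enters via $\hat l(\theta)$, $\hat l(\theta)=2(1-\cos\theta)$ for $d=1$ and $\hat l(\theta)\sim|\theta|^2$ in general. Per-site variance: $V_N=\lim_{t\to\infty}\mathbb{E}\{y_k^T(t)y_k(t)\}$, independent of $k$. It equals $\frac1N\sum_{\theta=2\pi n/L,\ n\in\mathbb{Z}_L^d\setminus\{0\}}\mathrm{tr}(\hat{\mathcal B}^*(\theta)\hat P(\theta)\hat{\mathcal B}(\theta))$, where $\hat{\mathcal A},\hat{\mathcal B},\hat{\mathcal C}$ are the Fourier symbols of the state-space matrices and $\hat P$ solves $\hat{\mathcal A}^*\hat P+\hat P\hat{\mathcal A}=-\hat{\mathcal C}^*\hat{\mathcal C}$. Scaling notation: $u(N)\sim v(N)$ means $\underline c\,v(N)\le u(N)\le\bar c\,v(N)$ with constants $\underline c,\bar c>0$ independent of $N$; it holds asymptotically if valid for all $N\ge\bar N$ for some $\bar N$.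
   Formalization: The constants are independent of β only over operators with β at most a given bound and with the norms of f and g comparable within a given factor; without this, independence of β fails (for ε=0 the local error variance decays like 1/β² as β grows). *)

theory Defs
  imports "HOL-Probability.Probability"
begin

(* The dimension d is CARD('d).  A feedback operator is given by a scalar array on Z^d.  Scalar
   array elements acting on R^d-valued node states express coordinate decoupling and isotropy:
   every array element is a multiple of the d x d identity. *)

type_synonym 'd array = "int^'d \<Rightarrow> real"

section \<open>The discrete torus and convolution operators\<close>

definition torus :: "nat \<Rightarrow> (int^'d::finite) set" where
  "torus L = {k. \<forall>i. 0 \<le> k $ i \<and> k $ i < int L}"

definition tmod :: "nat \<Rightarrow> int^'d::finite \<Rightarrow> int^'d" where
  "tmod L k = (\<chi> i. k $ i mod int L)"

(* The representative modulo L whose coordinates are of minimal absolute value.  For L > 2 q the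
   arrays below, which are supported in the cube of radius q, embed into the torus in this way
   without overlap. *)
definition centred :: "nat \<Rightarrow> int^'d::finite \<Rightarrow> int^'d" where
  "centred L k = (\<chi> i. (k $ i + int (L div 2)) mod int L - int (L div 2))"

definition conv :: "nat \<Rightarrow> 'd::finite array \<Rightarrow> (int^'d \<Rightarrow> real^'d) \<Rightarrow> int^'d \<Rightarrow> real^'d" where
  "conv L f u k = (\<Sum>l\<in>torus L. f (centred L (k - l)) *\<^sub>R u l)"

section \<open>Feedback arrays\<close>

definition local_array :: "nat \<Rightarrow> 'd::finite array \<Rightarrow> bool" where
  "local_array q f \<longleftrightarrow> (\<forall>k. (\<exists>i. \<bar>k $ i\<bar> > int q) \<longrightarrow> f k = 0)"

definition reflection_symmetric :: "'d::finite array \<Rightarrow> bool" where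
  "reflection_symmetric f \<longleftrightarrow> (\<forall>k. f (- k) = f k)"

(* Used only for arrays of finite support. *)
definition array_sum :: "'d::finite array \<Rightarrow> real" where
  "array_sum f = (\<Sum>k | f k \<noteq> 0. f k)"

definition relative_feedback :: "'d::finite array \<Rightarrow> bool" where
  "relative_feedback f \<longleftrightarrow> array_sum f = 0"

definition absolute_gain :: "'d::finite array \<Rightarrow> real" where
  "absolute_gain g = - array_sum g"

definition supnorm :: "'d::finite array \<Rightarrow> real" where
  "supnorm f = (SUP k. \<bar>f k\<bar>)"

definition symbol :: "'d::finite array \<Rightarrow> real^'d \<Rightarrow> complex" where
  "symbol f \<theta> = (\<Sum>k | f k \<noteq> 0.
     complex_of_real (f k) * exp (- \<i> * complex_of_real (\<Sum>i\<in>UNIV. \<theta> $ i * real_of_int (k $ i))))"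

definition freq_box :: "(real^'d) set" where
  "freq_box = {\<theta>. \<forall>i. - pi \<le> \<theta> $ i \<and> \<theta> $ i \<le> pi}"

(* "u ~ v" with explicit comparison factors 1/\<kappa> and \<kappa>. *)
definition same_order :: "real \<Rightarrow> real \<Rightarrow> real \<Rightarrow> bool" where
  "same_order \<kappa> u v \<longleftrightarrow> v / \<kappa> \<le> u \<and> u \<le> \<kappa> * v"

(* Symbols of reflection symmetric arrays are real, so nothing is lost by taking real parts. *)
definition admissible_feedback ::
    "nat \<Rightarrow> real \<Rightarrow> 'd::finite array \<Rightarrow> 'd array \<Rightarrow> 'd array \<Rightarrow> bool" where
  "admissible_feedback q \<kappa> f g a \<longleftrightarrow>
     local_array q f \<and> local_array q g \<and> local_array q a \<and>
     reflection_symmetric f \<and> reflection_symmetric g \<and> reflection_symmetric a \<and>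
     relative_feedback f \<and> relative_feedback a \<and> absolute_gain g > 0 \<and>
     (\<forall>\<theta>\<in>freq_box.
        same_order \<kappa> (- Re (symbol f \<theta>)) (supnorm f * (norm \<theta>)\<^sup>2) \<and>
        same_order \<kappa> (- Re (symbol a \<theta>)) (supnorm a * (norm \<theta>)\<^sup>2) \<and>
        same_order \<kappa> (- Re (symbol g \<theta>)) (absolute_gain g))"

definition algorithm_gain :: "'d::finite array \<Rightarrow> 'd array \<Rightarrow> real" where
  "algorithm_gain f g = max (supnorm f) (supnorm g)"

(* A class of operators over which scaling constants can be independent of the gain \<beta>: bounded
   gain, with the gains of F and G of the same order.  Any pair of nonzero operators lies in this
   class for some \<kappa> and b.  Neither condition can be dropped in an estimate uniform in \<beta>: with
   noise-free measurements the local-error variance decays like 1/\<beta>^2 as \<beta> grows, and the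
   contribution of measurement noise is governed by the gain of F alone if that is much smaller
   than the gain of G. *)
definition gain_class :: "real \<Rightarrow> real \<Rightarrow> 'd::finite array \<Rightarrow> 'd array \<Rightarrow> bool" where
  "gain_class \<kappa> b f g \<longleftrightarrow>
     algorithm_gain f g \<le> b \<and>
     algorithm_gain f g \<le> \<kappa> * supnorm f \<and> algorithm_gain f g \<le> \<kappa> * supnorm g"

definition hurwitz :: "complex^'n^'n \<Rightarrow> bool" where
  "hurwitz M \<longleftrightarrow> (\<forall>\<mu> u. u \<noteq> 0 \<and> M *v u = \<mu> *s u \<longrightarrow> Re \<mu> < 0)"

(* Acts on (z, x, v), for one spatial frequency and one coordinate direction. *)
definition symbol_matrix ::
    "real \<Rightarrow> 'd::finite array \<Rightarrow> 'd array \<Rightarrow> 'd array \<Rightarrow> real^'d \<Rightarrow> complex^3^3" where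
  "symbol_matrix c\<^sub>o f g a \<theta> = vector
     [vector [symbol a \<theta>, 0, - complex_of_real c\<^sub>o],
      vector [0, 0, 1],
      vector [1, symbol f \<theta>, symbol g \<theta>]]"

definition closed_loop_hurwitz ::
    "real \<Rightarrow> 'd::finite array \<Rightarrow> 'd array \<Rightarrow> 'd array \<Rightarrow> bool" where
  "closed_loop_hurwitz c\<^sub>o f g a \<longleftrightarrow>
     (\<forall>\<theta>\<in>freq_box. \<theta> \<noteq> 0 \<longrightarrow> hurwitz (symbol_matrix c\<^sub>o f g a \<theta>))"

section \<open>The noise-driven system\<close>

(* W i is the time integral of a unit-intensity white noise; noises with different indices are
   uncorrelated.  Only the second-order properties of white noise are required, so independent
   standard Brownian motions with continuous paths are a special case. *)
definition integrated_white_noise ::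
    "'w measure \<Rightarrow> 'i set \<Rightarrow> ('i \<Rightarrow> real \<Rightarrow> 'w \<Rightarrow> real) \<Rightarrow> bool" where
  "integrated_white_noise M I W \<longleftrightarrow>
     (\<forall>i\<in>I.
        (\<forall>\<omega>\<in>space M. W i 0 \<omega> = 0 \<and> continuous_on {0..} (\<lambda>t. W i t \<omega>)) \<and>
        (\<forall>t\<ge>0. W i t \<in> borel_measurable M \<and> integrable M (\<lambda>\<omega>. (W i t \<omega>)\<^sup>2) \<and>
               (LINT \<omega>|M. W i t \<omega>) = 0)) \<and>
     (\<forall>i\<in>I. \<forall>j\<in>I. \<forall>s\<ge>0. \<forall>t\<ge>0.
        (LINT \<omega>|M. W i s \<omega> * W j t \<omega>) = (if i = j then min s t else 0))"

datatype channel = Disturbance | Measurement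

type_synonym ('d, 'w) process = "int^'d \<Rightarrow> real \<Rightarrow> 'w \<Rightarrow> real^'d"

definition continuous_process ::
    "'w measure \<Rightarrow> nat \<Rightarrow> ('d::finite, 'w) process \<Rightarrow> bool" where
  "continuous_process M L u \<longleftrightarrow>
     (\<forall>k\<in>torus L.
        (\<forall>t\<ge>0. u k t \<in> borel_measurable M) \<and>
        integrable M (\<lambda>\<omega>. (norm (u k 0 \<omega>))\<^sup>2) \<and>
        (\<forall>\<omega>\<in>space M. continuous_on {0..} (\<lambda>t. u k t \<omega>)))"

(* The noise enters additively with constant coefficients, so the stochastic differential equation
   is understood pathwise in integrated form.  The initial state is an arbitrary square-integrable
   random vector. *)
definition noisy_integral_control ::
    "'w measure \<Rightarrow> nat \<Rightarrow> real \<Rightarrow> real \<Rightarrow> 'd::finite array \<Rightarrow> 'd array \<Rightarrow> 'd array \<Rightarrow>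
     (channel \<times> (int^'d) \<times> 'd \<Rightarrow> real \<Rightarrow> 'w \<Rightarrow> real) \<Rightarrow>
     ('d, 'w) process \<Rightarrow> ('d, 'w) process \<Rightarrow> ('d, 'w) process \<Rightarrow> bool" where
  "noisy_integral_control M L c\<^sub>o \<epsilon> f g a W z x v \<longleftrightarrow>
     prob_space M \<and>
     integrated_white_noise M (UNIV \<times> torus L \<times> UNIV) W \<and>
     continuous_process M L z \<and> continuous_process M L x \<and> continuous_process M L v \<and>
     (\<forall>k\<in>torus L. \<forall>t\<ge>0. \<forall>\<omega>\<in>space M.
        z k t \<omega> = z k 0 \<omega>
          + integral {0..t} (\<lambda>s. conv L a (\<lambda>l. z l s \<omega>) k - c\<^sub>o *\<^sub>R v k s \<omega>)
          - (c\<^sub>o * \<epsilon>) *\<^sub>R (\<chi> i. W (Measurement, k, i) t \<omega>) \<and>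
        x k t \<omega> = x k 0 \<omega> + integral {0..t} (\<lambda>s. v k s \<omega>) \<and>
        v k t \<omega> = v k 0 \<omega>
          + integral {0..t} (\<lambda>s. z k s \<omega> + conv L f (\<lambda>l. x l s \<omega>) k + conv L g (\<lambda>l. v l s \<omega>) k)
          + (\<chi> i. W (Disturbance, k, i) t \<omega>))"

section \<open>Performance outputs and per-site variance\<close>

definition global_error :: "nat \<Rightarrow> ('d::finite, 'w) process \<Rightarrow> ('d, 'w) process" where
  "global_error L x k t \<omega> =
     x k t \<omega> - (1 / real (L ^ CARD('d))) *\<^sub>R (\<Sum>l\<in>torus L. x l t \<omega>)"

(* The deviations from the preceding neighbour in each of the d lattice directions, stacked; the
   symbol of the inner product of this output with itself is the sum over i of
   2 (1 - cos \<theta>_i), which is of order |\<theta>|^2. *)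
definition local_error ::
    "nat \<Rightarrow> ('d::finite, 'w) process \<Rightarrow> int^'d \<Rightarrow> real \<Rightarrow> 'w \<Rightarrow> real^'d^'d" where
  "local_error L x k t \<omega> = (\<chi> i. x k t \<omega> - x (tmod L (k - axis i 1)) t \<omega>)"

definition has_per_site_variance ::
    "'w measure \<Rightarrow> nat \<Rightarrow> (int^'d::finite \<Rightarrow> real \<Rightarrow> 'w \<Rightarrow> 'b::euclidean_space) \<Rightarrow> real \<Rightarrow> bool" where
  "has_per_site_variance M L y V \<longleftrightarrow>
     (\<forall>k\<in>torus L.
        (\<forall>t\<ge>0. integrable M (\<lambda>\<omega>. y k t \<omega> \<bullet> y k t \<omega>)) \<and>
        ((\<lambda>t. LINT \<omega>|M. y k t \<omega> \<bullet> y k t \<omega>) \<longlongrightarrow> V) at_top)"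

definition local_scaling :: "nat \<Rightarrow> nat \<Rightarrow> real" where
  "local_scaling d N = (if d = 1 then real N else if d = 2 then ln (real N) else 1)"

definition global_scaling :: "nat \<Rightarrow> nat \<Rightarrow> real" where
  "global_scaling d N =
     (if d = 1 then real N ^ 3 else if d = 2 then real N else if d = 3 then real N powr (1/3)
      else if d = 4 then ln (real N) else 1)"

end

theory Submission
  imports Defs
begin

text \<open>The convolution operators commute, and because their arrays are reflection symmetric they are diagonalised
simultaneously by the real functions \<open>cos (\<theta> \<cdot> k) + sin (\<theta> \<cdot> k)\<close>.  For each torus frequency \<open>\<theta> \<noteq> 0\<close> and each coordinate this leaves a real
system of dimension three whose coefficients are the negated symbols \<open>\<alpha>\<close>, \<open>\<phi>\<close>, \<open>\<gamma>\<close> of \<open>A\<close>, \<open>F\<close>, \<open>G\<close>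
(\<open>cas_eigenfunction\<close>, \<open>mode_equations\<close>).

A mode is solved by pairing it with the adjoint solution, which is the impulse response of the position
(\<open>variation_of_constants\<close>).  The response decays, so the initial state is forgotten, and by the Ito isometry the
stationary variance of the mode is the square integral of the impulse response (\<open>white_noise_isometry\<close>,
\<open>second_moment_limit\<close>).  A Lyapunov equation evaluates that integral exactly
(\<open>adjoint_solution_energy\<close>).  Summation over the modes gives the per-site variances; they do not depend on the site
because the mode variances are even in the frequency (\<open>global_variance\<close>, \<open>local_variance\<close>).

Admissibility gives \<open>\<alpha> \<sim> |\<theta>|\<^sup>2\<close>, \<open>\<phi> \<sim> \<beta> |\<theta>|\<^sup>2\<close> and \<open>\<gamma> \<sim> \<beta>\<close>, where the last relation uses Fourier inversion for \<open>g\<close>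
(\<open>gain_bounds\<close>).  The explicit formula then shows that the variance of a mode is of the order of
\<open>1 / \<beta> + \<epsilon>\<^sup>2 / (\<beta> |\<theta>|^4)\<close> (\<open>mode_variance_bounds\<close>).  The relative feedback in the controller thus turns measurement noise into a
\<open>|\<theta>|^(-4)\<close> singularity, which the local error weakens to \<open>|\<theta>|^(-2)\<close>.  The averages of these powers over
the torus frequencies are lattice sums, which grow with \<open>N\<close> exactly as stated in each dimension
(\<open>frequency_sum_bounds\<close>).\<close>

section \<open>Lattice sums\<close>

text \<open>The reciprocal-power sums over the dual lattice are evaluated by decomposing it into shells of constant maximum
norm, on which the Euclidean norm is constant up to the factor \<open>sqrt d\<close>.\<close>

definition cube :: "nat \<Rightarrow> (int^'d::finite) set" where
  "cube R = {m. \<forall>i. \<bar>m $ i\<bar> \<le> int R}"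

definition sqnorm :: "int^'d::finite \<Rightarrow> real" where
  "sqnorm m = (\<Sum>i\<in>UNIV. (real_of_int (m $ i))\<^sup>2)"

lemma finite_card_vectors:
  fixes S :: "int set"
  assumes "finite S"
  defines "V \<equiv> {m :: int^'d::finite. \<forall>i. m $ i \<in> S}"
  shows "finite V" "card V = card S ^ CARD('d)"
proof -
  have V: "V = vec_lambda ` (UNIV \<rightarrow>\<^sub>E S)"
  proof (intro set_eqI iffI)
    fix m assume "m \<in> V"
    then show "m \<in> vec_lambda ` (UNIV \<rightarrow>\<^sub>E S)"
      by (intro image_eqI[where x = "vec_nth m"]) (auto simp: V_def PiE_def)
  qed (auto simp: V_def PiE_def Pi_def)
  have inj: "inj_on (vec_lambda :: ('d \<Rightarrow> int) \<Rightarrow> int^'d) A" for A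
    by (rule inj_onI) (metis UNIV_I vec_lambda_inject)
  show "finite V" unfolding V using assms(1) by (intro finite_imageI finite_PiE) auto
  show "card V = card S ^ CARD('d)"
    unfolding V card_image[OF inj] by (subst card_PiE) simp_all
qed

lemma finite_card_cube:
  "finite (cube R :: (int^'d::finite) set)" "card (cube R :: (int^'d) set) = (2 * R + 1) ^ CARD('d)"
proof -
  have "(cube R :: (int^'d) set) = {m. \<forall>i. m $ i \<in> {- int R..int R}}"
    unfolding cube_def abs_le_iff atLeastAtMost_iff by (intro Collect_cong all_cong1) linarith
  then show "finite (cube R :: (int^'d) set)" "card (cube R :: (int^'d) set) = (2 * R + 1) ^ CARD('d)"
    by (simp_all only: finite_card_vectors finite_atLeastAtMost_int)
       (simp add: nat_add_distrib nat_mult_distrib)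
qed

lemma power_Suc_diff_bounds:
  fixes x y :: real
  assumes "0 \<le> y" "y \<le> x"
  shows "(x - y) * x ^ n \<le> x ^ Suc n - y ^ Suc n"
    and "x ^ Suc n - y ^ Suc n \<le> (x - y) * (real (Suc n) * x ^ n)"
proof -
  have eq: "x ^ Suc n - y ^ Suc n = (x - y) * (\<Sum>p<Suc n. x ^ p * y ^ (n - p))"
    by (rule diff_power_eq_sum)
  have "x ^ n \<le> (\<Sum>p<Suc n. x ^ p * y ^ (n - p))"
    using assms by (simp add: sum_nonneg)
  then show "(x - y) * x ^ n \<le> x ^ Suc n - y ^ Suc n"
    unfolding eq using assms by (intro mult_left_mono) auto
  have "x ^ p * y ^ (n - p) \<le> x ^ n" if "p < Suc n" for p
  proof -
    have "x ^ p * y ^ (n - p) \<le> x ^ p * x ^ (n - p)"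
      using assms by (intro mult_left_mono power_mono) auto
    also have "\<dots> = x ^ n" using that by (simp flip: power_add)
    finally show ?thesis .
  qed
  then have "(\<Sum>p<Suc n. x ^ p * y ^ (n - p)) \<le> (\<Sum>p<Suc n. x ^ n)"
    by (intro sum_mono) auto
  then show "x ^ Suc n - y ^ Suc n \<le> (x - y) * (real (Suc n) * x ^ n)"
    unfolding eq using assms by (intro mult_left_mono) auto
qed

text \<open>A difference of two \<open>d\<close>-th powers: a shell of radius \<open>r\<close> is a \<open>(d - 1)\<close>-dimensional surface and has of the order
of \<open>r^(d - 1)\<close> points.\<close>

lemma card_shell_bounds:
  fixes r :: nat
  defines "S \<equiv> (cube (Suc r) - cube r :: (int^'d::finite) set)"
  shows "real (Suc r) ^ (CARD('d) - 1) \<le> real (card S)"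
    and "real (card S) \<le> 2 * real CARD('d) * 3 ^ (CARD('d) - 1) * real (Suc r) ^ (CARD('d) - 1)"
proof -
  obtain n where n: "CARD('d) = Suc n" using not0_implies_Suc[of "CARD('d)"] by auto
  have sub: "(cube r :: (int^'d) set) \<subseteq> cube (Suc r)" by (auto simp: cube_def intro: order_trans)
  let ?x = "2 * real (Suc r) + 1" and ?y = "2 * real (Suc r) - 1"
  have le: "(2 * r + 1) ^ Suc n \<le> (2 * Suc r + 1) ^ Suc n" by (rule power_mono) auto
  have "card S = (2 * Suc r + 1) ^ Suc n - (2 * r + 1) ^ Suc n"
    unfolding S_def using sub by (subst card_Diff_subset) (auto simp: finite_card_cube n)
  then have "real (card S) = real ((2 * Suc r + 1) ^ Suc n) - real ((2 * r + 1) ^ Suc n)"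
    using le by (simp add: of_nat_diff del: power_Suc)
  also have "\<dots> = ?x ^ Suc n - ?y ^ Suc n"
    by (simp only: of_nat_power) (simp add: algebra_simps del: power_Suc)
  finally have eq: "real (card S) = ?x ^ Suc n - ?y ^ Suc n" .
  have "real (Suc r) ^ n \<le> ?x ^ n" by (rule power_mono) auto
  also have "\<dots> \<le> (?x - ?y) * ?x ^ n" by simp
  also have "\<dots> \<le> ?x ^ Suc n - ?y ^ Suc n" by (rule power_Suc_diff_bounds) auto
  finally show "real (Suc r) ^ (CARD('d) - 1) \<le> real (card S)" by (simp add: eq n)
  have "real (card S) \<le> (?x - ?y) * (real (Suc n) * ?x ^ n)"
    unfolding eq by (rule power_Suc_diff_bounds) auto
  also have "\<dots> \<le> (?x - ?y) * (real (Suc n) * (3 * real (Suc r)) ^ n)"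
    by (intro mult_left_mono power_mono) auto
  finally show "real (card S) \<le> 2 * real CARD('d) * 3 ^ (CARD('d) - 1) * real (Suc r) ^ (CARD('d) - 1)"
    by (simp add: n power_mult_distrib mult_ac del: of_nat_Suc)
qed

lemma sqnorm_shell:
  fixes m :: "int^'d::finite"
  assumes m: "m \<in> cube (Suc r) - cube r"
  shows "(real (Suc r))\<^sup>2 \<le> sqnorm m" and "sqnorm m \<le> real CARD('d) * (real (Suc r))\<^sup>2"
proof -
  obtain i where "\<bar>m $ i\<bar> > int r" using m by (auto simp: cube_def not_le)
  then have "real (Suc r) \<le> \<bar>real_of_int (m $ i)\<bar>" by linarith
  then have "(real (Suc r))\<^sup>2 \<le> (real_of_int (m $ i))\<^sup>2" by (metis abs_le_square_iff abs_of_nat)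
  also have "\<dots> \<le> sqnorm m" unfolding sqnorm_def by (rule member_le_sum) auto
  finally show "(real (Suc r))\<^sup>2 \<le> sqnorm m" .
  have "(real_of_int (m $ i))\<^sup>2 \<le> (real (Suc r))\<^sup>2" for i
  proof -
    have "\<bar>m $ i\<bar> \<le> int (Suc r)" using m by (auto simp: cube_def)
    then have "\<bar>real_of_int (m $ i)\<bar> \<le> real (Suc r)" by linarith
    then show ?thesis by (metis abs_le_square_iff abs_of_nat)
  qed
  then have "sqnorm m \<le> (\<Sum>i\<in>(UNIV::'d set). (real (Suc r))\<^sup>2)"
    unfolding sqnorm_def by (intro sum_mono)
  then show "sqnorm m \<le> real CARD('d) * (real (Suc r))\<^sup>2" by simp
qed

text \<open>What remains of the \<open>d\<close>-dimensional sum of \<open>1 / |m|^(2 j)\<close> after summing over shells.  The three regimes below,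
\<open>d < 2 j\<close>, \<open>d = 2 j\<close> and \<open>d > 2 j\<close>, are the source of the dimension dependence of the theorem.\<close>

definition radial_sum :: "nat \<Rightarrow> nat \<Rightarrow> nat \<Rightarrow> real" where
  "radial_sum d j R = (\<Sum>r=1..R. real r ^ (d - 1) / real r ^ (2 * j))"

lemma cube_sum_bounds:
  fixes j R :: nat
  defines "S \<equiv> \<Sum>m\<in>cube R - {0 :: int^'d::finite}. 1 / sqnorm m ^ j"
  shows "radial_sum CARD('d) j R / real CARD('d) ^ j \<le> S"
    and "S \<le> 2 * real CARD('d) * 3 ^ (CARD('d) - 1) * radial_sum CARD('d) j R"
proof -
  let ?d = "CARD('d)"
  let ?S = "\<lambda>R. \<Sum>m\<in>cube R - {0 :: int^'d}. 1 / sqnorm m ^ j"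
  let ?C = "2 * real ?d * 3 ^ (?d - 1)"
  have "radial_sum ?d j R / real ?d ^ j \<le> ?S R \<and> ?S R \<le> ?C * radial_sum ?d j R"
  proof (induction R)
    case 0
    have e: "cube 0 - {0 :: int^'d} = {}" by (auto simp: cube_def vec_eq_iff)
    show ?case unfolding e by (simp add: radial_sum_def)
  next
    case (Suc R)
    let ?sh = "cube (Suc R) - cube R :: (int^'d) set"
    let ?s = "real (Suc R)"
    have "cube (Suc R) - {0 :: int^'d} = (cube R - {0}) \<union> ?sh"
      by (auto simp: cube_def intro: order_trans)
    then have split: "?S (Suc R) = ?S R + (\<Sum>m\<in>?sh. 1 / sqnorm m ^ j)"
      by (simp only:) (rule sum.union_disjoint, auto simp: finite_card_cube)
    have rad: "radial_sum ?d j (Suc R) = radial_sum ?d j R + ?s ^ (?d - 1) / ?s ^ (2 * j)"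
      by (simp add: radial_sum_def)
    have "(\<Sum>m\<in>?sh. 1 / sqnorm m ^ j) \<le> (\<Sum>m\<in>?sh. 1 / ?s ^ (2 * j))"
    proof (rule sum_mono)
      fix m assume "m \<in> ?sh"
      then have "(?s\<^sup>2) ^ j \<le> sqnorm m ^ j" by (intro power_mono sqnorm_shell) auto
      then show "1 / sqnorm m ^ j \<le> 1 / ?s ^ (2 * j)"
        unfolding power_mult by (intro divide_left_mono mult_pos_pos) (auto intro: less_le_trans[rotated])
    qed
    also have "\<dots> = real (card ?sh) * (1 / ?s ^ (2 * j))" by (simp only: sum_constant)
    also have "\<dots> \<le> ?C * ?s ^ (?d - 1) * (1 / ?s ^ (2 * j))"
      by (intro mult_right_mono card_shell_bounds) auto
    finally have up: "(\<Sum>m\<in>?sh. 1 / sqnorm m ^ j) \<le> ?C * (?s ^ (?d - 1) / ?s ^ (2 * j))"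
      by (simp only: times_divide_eq_right mult_1_right mult.assoc)
    have "(?s ^ (?d - 1) / ?s ^ (2 * j)) / real ?d ^ j = ?s ^ (?d - 1) * (1 / (real ?d * ?s\<^sup>2) ^ j)"
      unfolding power_mult power_mult_distrib
      by (simp only: divide_divide_eq_left times_divide_eq_right mult_1_right mult.commute)
    also have "\<dots> \<le> real (card ?sh) * (1 / (real ?d * ?s\<^sup>2) ^ j)"
      by (intro mult_right_mono card_shell_bounds) auto
    also have "\<dots> = (\<Sum>m\<in>?sh. 1 / (real ?d * ?s\<^sup>2) ^ j)" by (simp only: sum_constant)
    also have "\<dots> \<le> (\<Sum>m\<in>?sh. 1 / sqnorm m ^ j)"
    proof (rule sum_mono)
      fix m assume m: "m \<in> ?sh"
      have "0 < ?s\<^sup>2" by simp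
      then have p: "0 < sqnorm m" using sqnorm_shell(1)[OF m] by linarith
      have "sqnorm m ^ j \<le> (real ?d * ?s\<^sup>2) ^ j" using p m by (intro power_mono sqnorm_shell) auto
      then show "1 / (real ?d * ?s\<^sup>2) ^ j \<le> 1 / sqnorm m ^ j"
        using p by (intro divide_left_mono mult_pos_pos) auto
    qed
    finally have low: "(?s ^ (?d - 1) / ?s ^ (2 * j)) / real ?d ^ j \<le> (\<Sum>m\<in>?sh. 1 / sqnorm m ^ j)" .
    show ?case unfolding split rad add_divide_distrib distrib_left
      using Suc.IH low up by (simp only: add_mono)
  qed
  then show "radial_sum ?d j R / real ?d ^ j \<le> S" "S \<le> ?C * radial_sum ?d j R"
    by (simp_all add: S_def)
qed

lemma radial_sum_convergent:
  assumes "d < 2 * j" "0 < d" "R \<ge> 1"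
  shows "1 \<le> radial_sum d j R" "radial_sum d j R \<le> 2"
proof -
  have "(\<Sum>r=1..1. real r ^ (d - 1) / real r ^ (2 * j)) \<le> radial_sum d j R"
    unfolding radial_sum_def using assms by (intro sum_mono2) auto
  then show "1 \<le> radial_sum d j R" by simp
  have "radial_sum d j R \<le> (\<Sum>r=1..R. 1 / (real r)\<^sup>2)"
    unfolding radial_sum_def
  proof (rule sum_mono)
    fix r assume r: "r \<in> {1..R}"
    have "real r ^ (d - 1) * (real r)\<^sup>2 = real r ^ (d + 1)" using assms by (simp flip: power_add)
    also have "\<dots> \<le> real r ^ (2 * j)" using assms r by (intro power_increasing) auto
    finally show "real r ^ (d - 1) / real r ^ (2 * j) \<le> 1 / (real r)\<^sup>2"
      using r by (simp add: divide_simps)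
  qed
  also have "\<dots> \<le> 2 - 1 / real R" using assms(3)
  proof (induction R rule: dec_induct)
    case (step n)
    have "1 / (real (Suc n))\<^sup>2 \<le> 1 / (real n * real (Suc n))"
      using step by (intro divide_left_mono) (auto simp: power2_eq_square)
    also have "\<dots> = 1 / real n - 1 / real (Suc n)" using step by (simp add: field_simps)
    finally show ?case using step.IH by simp
  qed simp
  also have "\<dots> \<le> 2" by simp
  finally show "radial_sum d j R \<le> 2" .
qed

lemma radial_sum_log:
  assumes "d = 2 * j" "0 < d" "R \<ge> 1"
  shows "ln (real R + 1) \<le> radial_sum d j R" "radial_sum d j R \<le> 1 + ln (real R)"
proof -
  have e: "radial_sum d j R = harm R"
    unfolding radial_sum_def harm_def
  proof (rule sum.cong[OF refl])
    fix r assume r: "r \<in> {1..R}"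
    obtain k where k: "d = Suc k" using assms(2) by (cases d) auto
    have "real r ^ (2 * j) = real r ^ (d - 1) * real r"
      unfolding assms(1)[symmetric] k by simp
    then show "real r ^ (d - 1) / real r ^ (2 * j) = inverse (real r)"
      using r by (simp add: field_simps)
  qed
  show "ln (real R + 1) \<le> radial_sum d j R" unfolding e by (rule harm_ge_ln)
  show "radial_sum d j R \<le> 1 + ln (real R)"
    unfolding e using euler_mascheroni_sequence_decreasing[of 1 R] assms by (simp add: harm_expand)
qed

text \<open>The lower bound compares a sum of \<open>e\<close>-th powers with \<open>R^(e + 1) / (e + 1)\<close> increment by increment.\<close>

lemma radial_sum_divergent:
  assumes "d > 2 * j"
  shows "real R ^ (d - 2 * j) / real d \<le> radial_sum d j R" "radial_sum d j R \<le> real R ^ (d - 2 * j)"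
proof -
  define e where "e = d - 2 * j - 1"
  have de: "d - 2 * j = Suc e" "d - 1 = e + 2 * j" "Suc e \<le> d" using assms by (auto simp: e_def)
  have eq: "radial_sum d j R = (\<Sum>r=1..R. real r ^ e)" for R
    unfolding radial_sum_def de(2) power_add by (intro sum.cong refl) auto
  have "(\<Sum>r=1..R. real r ^ e) \<le> (\<Sum>r=1..R. real R ^ e)" by (intro sum_mono power_mono) auto
  then show "radial_sum d j R \<le> real R ^ (d - 2 * j)" by (simp add: eq de)
  have "real R ^ Suc e \<le> real (Suc e) * (\<Sum>r=1..R. real r ^ e)"
  proof (induction R)
    case (Suc R)
    have "real (Suc R) ^ Suc e - real R ^ Suc e \<le> (real (Suc R) - real R) * (real (Suc e) * real (Suc R) ^ e)"
      by (rule power_Suc_diff_bounds) auto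
    then show ?case using Suc.IH by (simp add: distrib_left del: power_Suc of_nat_Suc)
      (simp del: power_Suc)
  qed simp
  also have "\<dots> \<le> real d * (\<Sum>r=1..R. real r ^ e)"
    using de(3) by (intro mult_right_mono sum_nonneg) auto
  finally show "real R ^ (d - 2 * j) / real d \<le> radial_sum d j R"
    unfolding eq de(1) using de(3) by (simp add: divide_le_eq mult.commute del: power_Suc)
qed

text \<open>The growth in \<open>L\<close> of the average of \<open>1 / |\<theta>|^(2 j)\<close> over the nonzero torus frequencies, common to the local error
(\<open>j = 1\<close>) and the global error (\<open>j = 2\<close>).\<close>

definition lattice_scaling :: "nat \<Rightarrow> nat \<Rightarrow> nat \<Rightarrow> real" where
  "lattice_scaling d j L =
     (if d < 2 * j then real L ^ (2 * j - d) else if d = 2 * j then ln (real L) else 1)"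

text \<open>The radius \<open>R\<close> stands for that of either the largest cube contained in, or the smallest cube containing, a
centred period cell of side \<open>L\<close>; the hypotheses on \<open>R\<close> hold for both.\<close>

lemma radial_sum_scaling:
  assumes d: "0 < d" and L: "L \<ge> 4" and R: "real L / 4 \<le> real R" "real L / 2 \<le> real R + 1" "R \<le> L"
  shows "lattice_scaling d j L / (2 * real d * 4 ^ d) \<le> real L ^ (2 * j) / real L ^ d * radial_sum d j R" (is ?low)
    and "real L ^ (2 * j) / real L ^ d * radial_sum d j R \<le> 2 * lattice_scaling d j L" (is ?up)
proof -
  have R1: "R \<ge> 1" using R(1) L by (cases R) auto
  have L0: "0 < real L" using L by simp
  have dd: "1 \<le> 2 * real d * 4 ^ d"
  proof -
    have "1 \<le> (2 * real d)" "1 \<le> (4 :: real) ^ d" using d by simp_all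
    then show ?thesis using mult_mono[of 1 "2 * real d" 1 "4 ^ d"] by simp
  qed
  have shrink: "x / (2 * real d * 4 ^ d) \<le> y" if "x \<le> y" "0 \<le> y" for x y :: real
  proof -
    have "x \<le> y * (2 * real d * 4 ^ d)" using that dd mult_left_mono[of 1 "2 * real d * 4 ^ d" y] by simp
    then show ?thesis using dd by (simp add: divide_le_eq)
  qed
  consider "d < 2 * j" | "d = 2 * j" | "d > 2 * j" by linarith
  then have "?low \<and> ?up"
  proof cases
    case 1
    have f: "real L ^ (2 * j) / real L ^ d = real L ^ (2 * j - d)" using 1 L0 by (simp add: power_diff)
    note r = radial_sum_convergent[OF 1 d R1]
    have "real L ^ (2 * j - d) * 1 \<le> real L ^ (2 * j - d) * radial_sum d j R"
      using r by (intro mult_left_mono) auto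
    moreover have "real L ^ (2 * j - d) * radial_sum d j R \<le> real L ^ (2 * j - d) * 2"
      using r by (intro mult_left_mono) auto
    moreover have "0 \<le> real L ^ (2 * j - d) * radial_sum d j R" using r by simp
    ultimately show ?thesis unfolding f lattice_scaling_def using 1 by (auto intro!: shrink)
  next
    case 2
    have f: "real L ^ (2 * j) / real L ^ d = 1" using 2 L0 by simp
    note r = radial_sum_log[OF 2 d R1]
    have "sqrt (real L) \<le> real L / 2"
      using L by (intro real_le_lsqrt) (auto simp: power2_eq_square)
    then have "sqrt (real L) \<le> real R + 1" using R by simp
    then have "ln (sqrt (real L)) \<le> ln (real R + 1)" using L0 by (subst ln_le_cancel_iff) auto
    then have low: "ln (real L) / 2 \<le> radial_sum d j R" using r(1) L0 by (simp add: ln_sqrt)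
    have "exp 1 \<le> real L" by (rule order_trans[OF exp_le]) (use L in simp)
    then have lnL: "1 \<le> ln (real L)" using L0 by (simp add: ln_ge_iff)
    have "ln (real R) \<le> ln (real L)" using R R1 by (subst ln_le_cancel_iff) auto
    then have up: "radial_sum d j R \<le> 2 * ln (real L)" using r(2) lnL by simp
    have "2 * 1 \<le> 2 * (real d * 4 ^ d)"
    proof -
      have "1 \<le> real d" "1 \<le> (4 :: real) ^ d" using d by simp_all
      then show ?thesis using mult_mono[of 1 "real d" 1 "4 ^ d"] by simp
    qed
    then have "ln (real L) / (2 * real d * 4 ^ d) \<le> ln (real L) / 2"
      using lnL by (intro divide_left_mono) auto
    then show ?thesis unfolding f lattice_scaling_def using 2 low up by auto
  next
    case 3
    have f: "real L ^ (2 * j) / real L ^ d = 1 / real L ^ (d - 2 * j)" using 3 L0 by (simp add: power_diff)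
    note r = radial_sum_divergent[OF 3, of R]
    have "real R ^ (d - 2 * j) \<le> real L ^ (d - 2 * j)" using R by (intro power_mono) auto
    then have "radial_sum d j R \<le> real L ^ (d - 2 * j)" using r by simp
    then have up: "1 / real L ^ (d - 2 * j) * radial_sum d j R \<le> 1" using L0 by simp
    have "(real L / 4) ^ (d - 2 * j) \<le> real R ^ (d - 2 * j)" using R by (intro power_mono) auto
    then have "(real L / 4) ^ (d - 2 * j) / real d \<le> real R ^ (d - 2 * j) / real d"
      using d by (intro divide_right_mono) auto
    then have "(real L / 4) ^ (d - 2 * j) / real d \<le> radial_sum d j R" using r by simp
    then have "1 / real L ^ (d - 2 * j) * ((real L / 4) ^ (d - 2 * j) / real d)
        \<le> 1 / real L ^ (d - 2 * j) * radial_sum d j R" by (intro mult_left_mono) auto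
    moreover have "1 / real L ^ (d - 2 * j) * ((real L / 4) ^ (d - 2 * j) / real d) = 1 / (real d * 4 ^ (d - 2 * j))"
      using L0 by (simp add: power_divide)
    moreover have "1 / (2 * real d * 4 ^ d) \<le> 1 / (real d * 4 ^ (d - 2 * j))"
    proof (intro divide_left_mono)
      have "real d * 4 ^ (d - 2 * j) \<le> 2 * real d * 4 ^ d"
        by (intro mult_mono power_increasing) auto
      then show "real d * 4 ^ (d - 2 * j) \<le> 2 * real d * 4 ^ d" .
    qed (use d in auto)
    ultimately show ?thesis unfolding f lattice_scaling_def using 3 up by auto
  qed
  then show ?low ?up by auto
qed

lemma lattice_sum_bounds:
  fixes C :: "(int^'d::finite) set" and j :: nat
  assumes L: "L \<ge> 4" and C: "cube ((L - 1) div 2) \<subseteq> C" "C \<subseteq> cube (L div 2)"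
  defines "d \<equiv> CARD('d)"
  defines "S \<equiv> real L ^ (2 * j) / real L ^ d * (\<Sum>m\<in>C - {0}. 1 / sqnorm m ^ j)"
  shows "lattice_scaling d j L / (2 * real d * 4 ^ d * real d ^ j) \<le> S"
    and "S \<le> 4 * real d * 3 ^ (d - 1) * lattice_scaling d j L"
proof -
  have d0: "0 < d" by (simp add: d_def)
  let ?\<Sigma> = "\<lambda>C :: (int^'d) set. \<Sum>m\<in>C - {0}. 1 / sqnorm m ^ j"
  let ?f = "real L ^ (2 * j) / real L ^ d"
  have nn: "0 \<le> 1 / sqnorm m ^ j" for m :: "int^'d" by (simp add: sqnorm_def sum_nonneg)
  have fin: "finite C" using C(2) finite_card_cube(1) by (rule finite_subset)
  have s1: "?\<Sigma> (cube ((L - 1) div 2)) \<le> ?\<Sigma> C"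
    using C fin nn by (intro sum_mono2) auto
  have s2: "?\<Sigma> C \<le> ?\<Sigma> (cube (L div 2))"
    using C nn by (intro sum_mono2) (auto simp: finite_card_cube)
  have f0: "0 \<le> ?f" by simp
  have "L - 1 \<le> 2 * ((L - 1) div 2) + 1" by linarith
  then have r: "real L \<le> 2 * real ((L - 1) div 2) + 2" by linarith
  note low = radial_sum_scaling(1)[OF d0 L, of "(L - 1) div 2" j]
  note up = radial_sum_scaling(2)[OF d0 L, of "L div 2" j]
  have "lattice_scaling d j L / (2 * real d * 4 ^ d) \<le> ?f * radial_sum d j ((L - 1) div 2)"
    using r L by (intro low) (auto simp: field_simps)
  then have "lattice_scaling d j L / (2 * real d * 4 ^ d) / real d ^ j
      \<le> ?f * radial_sum d j ((L - 1) div 2) / real d ^ j"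
    by (rule divide_right_mono) simp
  also have "\<dots> = ?f * (radial_sum d j ((L - 1) div 2) / real d ^ j)" by simp
  also have "\<dots> \<le> ?f * ?\<Sigma> (cube ((L - 1) div 2))"
    unfolding d_def by (intro mult_left_mono cube_sum_bounds) simp
  also have "\<dots> \<le> S" unfolding S_def by (rule mult_left_mono[OF s1 f0])
  finally show "lattice_scaling d j L / (2 * real d * 4 ^ d * real d ^ j) \<le> S"
    by (simp add: mult.assoc)
  have r2: "real L / 4 \<le> real (L div 2)" "real L / 2 \<le> real (L div 2) + 1"
    using L by linarith+
  have "S \<le> ?f * ?\<Sigma> (cube (L div 2))" unfolding S_def by (rule mult_left_mono[OF s2 f0])
  also have "\<dots> \<le> ?f * (2 * real d * 3 ^ (d - 1) * radial_sum d j (L div 2))"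
    unfolding d_def by (intro mult_left_mono cube_sum_bounds) simp
  also have "\<dots> = 2 * real d * 3 ^ (d - 1) * (?f * radial_sum d j (L div 2))" by simp
  also have "\<dots> \<le> 2 * real d * 3 ^ (d - 1) * (2 * lattice_scaling d j L)"
    using r2 by (intro mult_left_mono up) auto
  finally show "S \<le> 4 * real d * 3 ^ (d - 1) * lattice_scaling d j L" by simp
qed

lemma lattice_scaling_local:
  assumes d: "0 < d" and L: "L \<ge> 4"
  shows "local_scaling d (L ^ d) / 2 \<le> lattice_scaling d 1 L" (is ?low)
    and "lattice_scaling d 1 L \<le> local_scaling d (L ^ d)" (is ?up)
proof -
  have ln0: "0 \<le> ln (real L)" using L by simp
  consider "d = 1" | "d = 2" | "d > 2" using d by linarith
  then have "?low \<and> ?up"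
  proof cases
    case 1 then show ?thesis by (simp add: local_scaling_def lattice_scaling_def)
  next
    case 2
    have "ln (real (L ^ 2)) = 2 * ln (real L)" using L by (simp add: ln_realpow)
    then show ?thesis using 2 ln0 by (simp add: local_scaling_def lattice_scaling_def)
  next
    case 3 then show ?thesis by (simp add: local_scaling_def lattice_scaling_def)
  qed
  then show ?low ?up by auto
qed

lemma lattice_scaling_global:
  assumes d: "0 < d" and L: "L \<ge> 4"
  shows "global_scaling d (L ^ d) / 4 \<le> lattice_scaling d 2 L" (is ?low)
    and "lattice_scaling d 2 L \<le> global_scaling d (L ^ d)" (is ?up)
proof -
  have ln0: "0 \<le> ln (real L)" using L by simp
  consider "d = 1" | "d = 2" | "d = 3" | "d = 4" | "d > 4" using d by linarith
  then have "?low \<and> ?up"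
  proof cases
    case 1 then show ?thesis by (simp add: global_scaling_def lattice_scaling_def)
  next
    case 2 then show ?thesis by (simp add: global_scaling_def lattice_scaling_def)
  next
    case 3
    have "real (L ^ 3) powr (1 / 3) = (real L powr 3) powr (1 / 3)" using L by simp
    also have "\<dots> = real L" using L unfolding powr_powr by simp
    finally show ?thesis using 3 by (simp add: global_scaling_def lattice_scaling_def)
  next
    case 4
    have "ln (real (L ^ 4)) = 4 * ln (real L)" using L by (simp add: ln_realpow)
    then show ?thesis using 4 ln0 by (simp add: global_scaling_def lattice_scaling_def)
  next
    case 5 then show ?thesis by (simp add: global_scaling_def lattice_scaling_def)
  qed
  then show ?low ?up by auto
qed

section \<open>Fourier analysis on the discrete torus\<close>

text \<open>The eigenfunctions used are not the complex exponentials but the Hartley functions \<open>cos + sin\<close>.  They are real and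
orthogonal, and reflection symmetry of a feedback array makes them eigenfunctions of its convolution
operator, so each mode is a real three-dimensional system driven by real white noise.\<close>

definition idot :: "int^'d::finite \<Rightarrow> int^'d \<Rightarrow> int" where
  "idot n k = (\<Sum>i\<in>UNIV. n $ i * k $ i)"

definition phase :: "nat \<Rightarrow> int^'d::finite \<Rightarrow> int^'d \<Rightarrow> real" where
  "phase L n k = 2 * pi * real_of_int (idot n k) / real L"

definition cas :: "nat \<Rightarrow> int^'d::finite \<Rightarrow> int^'d \<Rightarrow> real" where
  "cas L n k = cos (phase L n k) + sin (phase L n k)"

lemma phase_commute: "phase L n k = phase L k n"
  by (simp add: phase_def idot_def mult.commute)

lemma cas_commute: "cas L n k = cas L k n"
  by (simp add: cas_def phase_commute)

lemma phase_add: "phase L n (k + l) = phase L n k + phase L n l"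
  by (simp add: phase_def idot_def algebra_simps sum.distrib add_divide_distrib)

lemma phase_diff: "phase L n (k - l) = phase L n k - phase L n l"
  by (simp add: phase_def idot_def algebra_simps sum_subtractf diff_divide_distrib)

lemma phase_minus: "phase L n (- k) = - phase L n k"
  by (simp add: phase_def idot_def sum_negf)

lemma phase_zero [simp]: "phase L n 0 = 0" "phase L 0 n = 0"
  by (simp_all add: phase_def idot_def)

lemma phase_axis: "phase L n (axis i 1) = 2 * pi * real_of_int (n $ i) / real L"
proof -
  have "(\<Sum>j\<in>UNIV. n $ j * axis i 1 $ j) = (\<Sum>j\<in>UNIV. if j = i then n $ j else 0)"
    by (rule sum.cong) (auto simp: axis_def)
  then show ?thesis by (simp add: phase_def idot_def)
qed

lemma cos_sin_phase_cong:
  fixes k l :: "int^'d::finite"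
  assumes L: "L > 0" and "\<And>i. k $ i mod int L = l $ i mod int L"
  shows "cos (phase L n k) = cos (phase L n l)" "sin (phase L n k) = sin (phase L n l)"
proof -
  have "\<exists>z. k $ i = l $ i + int L * z" for i
    using assms(2)[of i] by (metis mod_eqE mult.commute)
  then obtain z where z: "\<And>i. k $ i = l $ i + int L * z i" by metis
  define s where "s = (\<Sum>i\<in>UNIV. n $ i * z i)"
  have "idot n k = idot n l + int L * s"
    by (simp add: idot_def s_def z algebra_simps sum.distrib sum_distrib_left)
  then have "phase L n k = phase L n l + 2 * pi * real_of_int s"
    using L by (simp add: phase_def field_simps)
  then show "cos (phase L n k) = cos (phase L n l)" "sin (phase L n k) = sin (phase L n l)"
    by (simp_all add: cos_add sin_add cos_int_2pin sin_int_2pin)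
qed

lemma cos_sin_phase_tmod:
  assumes "L > 0"
  shows "cos (phase L n (tmod L k)) = cos (phase L n k)" "sin (phase L n (tmod L k)) = sin (phase L n k)"
    "cos (phase L (tmod L n) k) = cos (phase L n k)" "sin (phase L (tmod L n) k) = sin (phase L n k)"
    "cas L n (tmod L k) = cas L n k"
  using cos_sin_phase_cong[OF assms, of "tmod L k" k n] cos_sin_phase_cong[OF assms, of "tmod L n" n k]
  by (simp_all add: tmod_def phase_commute cas_def)

lemma tmod_in_torus: "L > 0 \<Longrightarrow> tmod L k \<in> torus L"
  by (simp add: tmod_def torus_def)

lemma tmod_torus: "k \<in> torus L \<Longrightarrow> tmod L k = k"
  by (simp add: tmod_def torus_def vec_eq_iff)

lemma tmod_eqI: "(\<And>i. k $ i mod int L = l $ i mod int L) \<Longrightarrow> tmod L k = tmod L l"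
  by (simp add: tmod_def)

lemma tmod_tmod [simp]:
  "tmod L (tmod L k) = tmod L k" "tmod L (tmod L k + l) = tmod L (k + l)"
  "tmod L (tmod L k - l) = tmod L (k - l)" "tmod L (- tmod L k) = tmod L (- k)"
  by (auto intro!: tmod_eqI simp: tmod_def mod_simps)

lemma finite_card_torus:
  "finite (torus L :: (int^'d::finite) set)" "card (torus L :: (int^'d) set) = L ^ CARD('d)"
proof -
  have "(torus L :: (int^'d) set) = {m. \<forall>i. m $ i \<in> {0..<int L}}"
    unfolding torus_def atLeastLessThan_iff ..
  then show "finite (torus L :: (int^'d) set)" "card (torus L :: (int^'d) set) = L ^ CARD('d)"
    by (simp_all only: finite_card_vectors finite_atLeastLessThan_int) simp
qed

lemma sum_torus_shift:
  assumes L: "L > 0" and F: "\<And>k. F (tmod L k) = F k"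
  shows "(\<Sum>k\<in>torus L. F (k + l)) = (\<Sum>k\<in>torus L. F k)"
  by (rule sum.reindex_bij_witness[where j = "\<lambda>k. tmod L (k + l)" and i = "\<lambda>k. tmod L (k - l)"])
     (auto simp: F tmod_in_torus[OF L] tmod_torus)

lemma sum_torus_minus:
  assumes L: "L > 0" and F: "\<And>k. F (tmod L k) = F k"
  shows "(\<Sum>k\<in>torus L. F (- k)) = (\<Sum>k\<in>torus L. F k)"
  by (rule sum.reindex_bij_witness[where j = "\<lambda>k. tmod L (- k)" and i = "\<lambda>k. tmod L (- k)"])
     (auto simp: F tmod_in_torus[OF L] tmod_torus)

text \<open>Whatever depends evenly on the frequency is orthogonal to the sines.  This removes the sine parts of products of
Hartley functions, in particular the dependence of the variance on the site.\<close>

lemma sum_odd_torus: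
  fixes s :: "int^'d::finite \<Rightarrow> real"
  assumes L: "L > 0" and s: "\<And>n. s (tmod L n) = s n" "\<And>n. s (- n) = s n"
  shows "(\<Sum>n\<in>torus L. s n * sin (phase L n m)) = 0"
proof -
  let ?F = "\<lambda>n. s n * sin (phase L n m)"
  have "(\<Sum>n\<in>torus L. ?F n) = (\<Sum>n\<in>torus L. ?F (- n))"
    by (rule sum_torus_minus[OF L, symmetric]) (simp only: s cos_sin_phase_tmod[OF L])
  also have "\<dots> = - (\<Sum>n\<in>torus L. ?F n)"
    by (simp add: s phase_commute[of L _ m] phase_minus sum_negf)
  finally show ?thesis by simp
qed

text \<open>Shifting the summation variable by a unit vector multiplies the sum by a cosine that differs from 1 unless the
corresponding component of \<open>m\<close> is a multiple of \<open>L\<close>.\<close>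

lemma sum_cos_torus:
  fixes m :: "int^'d::finite"
  assumes L: "L > 0"
  shows "(\<Sum>n\<in>torus L. cos (phase L n m)) = (if tmod L m = 0 then real (L ^ CARD('d)) else 0)"
proof (cases "tmod L m = 0")
  case True
  have "cos (phase L n m) = 1" for n
    using cos_sin_phase_tmod(1)[OF L, of n m] True by simp
  then show ?thesis using True by (simp add: finite_card_torus)
next
  case False
  then obtain i where i: "m $ i mod int L \<noteq> 0" by (auto simp: tmod_def vec_eq_iff)
  let ?C = "\<Sum>n\<in>torus L. cos (phase L n m)" and ?S = "\<Sum>n\<in>torus L. sin (phase L n m)"
  let ?w = "phase L m (axis i 1)"
  have S: "?S = 0" using sum_odd_torus[OF L, of "\<lambda>_. 1"] by simp
  have "?C = (\<Sum>n\<in>torus L. cos (phase L (n + axis i 1) m))"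
    by (rule sum_torus_shift[OF L, symmetric]) (rule cos_sin_phase_tmod(3)[OF L])
  also have "\<dots> = cos ?w * ?C - sin ?w * ?S"
    by (simp add: phase_commute[of L _ m] phase_add cos_add sum_subtractf sum_distrib_left mult.commute)
  finally have "?C * (1 - cos ?w) = 0" using S by (simp add: algebra_simps)
  moreover have "cos ?w \<noteq> 1"
  proof
    assume "cos ?w = 1"
    then obtain z :: int where "?w = of_int z * 2 * pi" by (auto simp: cos_one_2pi_int)
    then have "2 * pi * (real_of_int (m $ i) - of_int z * real L) = 0"
      using L by (simp add: phase_axis field_simps)
    then have "real_of_int (m $ i) = real_of_int (z * int L)" by simp
    then have "m $ i = z * int L" by (simp only: of_int_eq_iff)
    then show False using i by simp
  qed
  ultimately show ?thesis using False by simp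
qed

lemma cas_mult: "cas L n k * cas L n l = cos (phase L n (k - l)) + sin (phase L n (k + l))"
  by (simp add: cas_def phase_add phase_diff cos_diff sin_add algebra_simps)

lemma tmod_diff_eq_0: "k \<in> torus L \<Longrightarrow> l \<in> torus L \<Longrightarrow> tmod L (k - l) = 0 \<longleftrightarrow> k = l"
proof
  assume k: "k \<in> torus L" and l: "l \<in> torus L" and e: "tmod L (k - l) = 0"
  show "k = l"
  proof (simp add: vec_eq_iff, rule allI)
    fix i
    have "(k $ i - l $ i) mod int L = 0" using e by (simp add: tmod_def vec_eq_iff)
    then have "k $ i mod int L = l $ i mod int L" by (metis mod_eq_dvd_iff dvd_eq_mod_eq_0)
    then show "k $ i = l $ i" using k l by (simp add: torus_def)
  qed
qed (simp add: tmod_def vec_eq_iff)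

lemma cas_orthogonal:
  fixes k l :: "int^'d::finite"
  assumes L: "L > 0" and k: "k \<in> torus L" and l: "l \<in> torus L"
  shows "(\<Sum>n\<in>torus L. cas L n k * cas L n l) = (if k = l then real (L ^ CARD('d)) else 0)"
  using sum_odd_torus[OF L, of "\<lambda>_. 1" "k + l"]
  by (simp add: cas_mult sum.distrib sum_cos_torus[OF L] tmod_diff_eq_0[OF k l])

lemma cas_inversion:
  fixes u :: "int^'d::finite \<Rightarrow> real"
  assumes L: "L > 0" and k: "k \<in> torus L"
  shows "u k = (\<Sum>n\<in>torus L. cas L n k * (\<Sum>l\<in>torus L. cas L n l * u l)) / real (L ^ CARD('d))"
proof -
  have "(\<Sum>n\<in>torus L. cas L n k * (\<Sum>l\<in>torus L. cas L n l * u l))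
      = (\<Sum>l\<in>torus L. (\<Sum>n\<in>torus L. cas L n k * cas L n l) * u l)"
    by (simp add: sum_distrib_left sum_distrib_right mult.assoc) (rule sum.swap)
  also have "\<dots> = (\<Sum>l\<in>torus L. if k = l then real (L ^ CARD('d)) * u l else 0)"
    by (rule sum.cong) (auto simp: cas_orthogonal[OF L k])
  also have "\<dots> = real (L ^ CARD('d)) * u k" using k by (simp add: finite_card_torus)
  finally show ?thesis using L by simp
qed

lemma centred_tmod [simp]: "centred L (tmod L k) = centred L k"
  by (simp add: centred_def tmod_def mod_simps)

lemma centred_mod: "centred L k $ i mod int L = k $ i mod int L"
  by (simp add: centred_def mod_simps)

lemma tmod_centred [simp]: "tmod L (centred L k) = tmod L k"
  by (rule tmod_eqI) (rule centred_mod)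

lemma centred_bounds:
  assumes "L > 0"
  shows "- int (L div 2) \<le> centred L k $ i" "centred L k $ i < int L - int (L div 2)"
  using assms by (simp_all add: centred_def)

lemma centred_id:
  assumes "\<And>i. - int (L div 2) \<le> k $ i" "\<And>i. k $ i < int L - int (L div 2)"
  shows "centred L k = k"
proof (simp add: vec_eq_iff, rule allI)
  fix i
  have "(k $ i + int (L div 2)) mod int L = k $ i + int (L div 2)"
    using assms[of i] by (intro mod_pos_pos_trivial) linarith+
  then show "centred L k $ i = k $ i" by (simp add: centred_def)
qed

lemma local_array_bound: "local_array q f \<Longrightarrow> f k \<noteq> 0 \<Longrightarrow> \<bar>k $ i\<bar> \<le> int q"
  unfolding local_array_def by (meson not_le)

lemma centred_support:
  assumes "local_array q f" "f k \<noteq> 0" "2 * q < L"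
  shows "centred L k = k"
proof (rule centred_id)
  fix i
  have "\<bar>k $ i\<bar> \<le> int q" using local_array_bound[OF assms(1,2)] .
  then show "- int (L div 2) \<le> k $ i" "k $ i < int L - int (L div 2)" using assms(3) by linarith+
qed

lemma finite_support:
  assumes "local_array q f"
  shows "finite {k. f k \<noteq> 0}"
proof (rule finite_subset[OF _ finite_imageI[OF finite_card_torus(1)]])
  show "{k. f k \<noteq> 0} \<subseteq> centred (2 * q + 1) ` torus (2 * q + 1)"
  proof
    fix k assume "k \<in> {k. f k \<noteq> 0}"
    then have "centred (2 * q + 1) (tmod (2 * q + 1) k) = k"
      using centred_support[OF assms, of k "2 * q + 1"] by simp
    then show "k \<in> centred (2 * q + 1) ` torus (2 * q + 1)"
      by (metis image_eqI tmod_in_torus zero_less_Suc Suc_eq_plus1)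
  qed
qed

text \<open>The real symbol of \<open>f\<close> as a function of the integer label of a frequency.  In contrast to the symbol at the
centred frequency, with which it agrees, it is visibly periodic and even in the label.\<close>

definition torus_symbol :: "nat \<Rightarrow> 'd::finite array \<Rightarrow> int^'d \<Rightarrow> real" where
  "torus_symbol L f n = (\<Sum>k | f k \<noteq> 0. f k * cos (phase L n k))"

text \<open>For \<open>L > 2 q\<close> the torus sees the array without wrap-around.\<close>

lemma sum_centred_support:
  fixes f G :: "int^'d::finite \<Rightarrow> real"
  assumes f: "local_array q f" and L: "2 * q < L"
  shows "(\<Sum>k\<in>torus L. f (centred L k) * G (centred L k)) = (\<Sum>k | f k \<noteq> 0. f k * G k)"
proof -
  have L0: "L > 0" using L by simp
  have "(\<Sum>k\<in>torus L. f (centred L k) * G (centred L k))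
      = (\<Sum>k | k \<in> torus L \<and> f (centred L k) \<noteq> 0. f (centred L k) * G (centred L k))"
    by (rule sum.mono_neutral_right) (auto simp: finite_card_torus)
  also have "\<dots> = (\<Sum>k | f k \<noteq> 0. f k * G k)"
    by (rule sum.reindex_bij_witness[where j = "centred L" and i = "tmod L"])
       (auto simp: tmod_torus tmod_in_torus[OF L0] centred_support[OF f _ L])
  finally show ?thesis .
qed

lemma sum_support_sin:
  assumes "reflection_symmetric f"
  shows "(\<Sum>k | f k \<noteq> 0. f k * sin (phase L n k)) = 0"
proof -
  have "(\<Sum>k | f k \<noteq> 0. f k * sin (phase L n k)) = (\<Sum>k | f k \<noteq> 0. - (f k * sin (phase L n k)))"
    by (rule sum.reindex_bij_witness[where i = uminus and j = uminus])
       (use assms in \<open>auto simp: reflection_symmetric_def phase_minus\<close>)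
  then show ?thesis by (simp add: sum_negf)
qed

text \<open>After a shift the kernel is evaluated at \<open>k + l\<close>, and the addition theorem splits it into \<open>cos\<close> and \<open>sin\<close>
of the phase of \<open>k\<close>; by reflection symmetry only the cosine part survives summation against the array.\<close>

lemma cas_eigenfunction:
  fixes f u :: "int^'d::finite \<Rightarrow> real"
  assumes f: "local_array q f" "reflection_symmetric f" and L: "2 * q < L"
  shows "(\<Sum>k\<in>torus L. cas L n k * (\<Sum>l\<in>torus L. f (centred L (k - l)) * u l))
    = torus_symbol L f n * (\<Sum>l\<in>torus L. cas L n l * u l)"
proof -
  have L0: "L > 0" using L by simp
  have inner: "(\<Sum>k\<in>torus L. cas L n k * f (centred L (k - l))) = torus_symbol L f n * cas L n l" for l
  proof -
    let ?F = "\<lambda>k. cas L n (k + l) * f (centred L k)"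
    have per: "?F (tmod L k) = ?F k" for k
      using cos_sin_phase_tmod(5)[OF L0, of n "tmod L k + l"] cos_sin_phase_tmod(5)[OF L0, of n "k + l"]
      by simp
    have "(\<Sum>k\<in>torus L. cas L n k * f (centred L (k - l))) = (\<Sum>k\<in>torus L. ?F (k + (- l)))"
      by simp
    also have "\<dots> = (\<Sum>k\<in>torus L. ?F k)" by (rule sum_torus_shift[where F = ?F, OF L0 per])
    also have "\<dots> = (\<Sum>k\<in>torus L. f (centred L k) * cas L n (centred L k + l))"
    proof (rule sum.cong[OF refl])
      fix k
      have "cas L n (tmod L (centred L k + l)) = cas L n (tmod L (k + l))"
        by (metis tmod_centred tmod_tmod(2))
      then show "?F k = f (centred L k) * cas L n (centred L k + l)"
        by (simp add: cos_sin_phase_tmod[OF L0])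
    qed
    also have "\<dots> = (\<Sum>k | f k \<noteq> 0. f k * cas L n (k + l))"
      by (rule sum_centred_support[OF f(1) L])
    also have "\<dots> = (\<Sum>k | f k \<noteq> 0. f k * cos (phase L n k) * cas L n l
        + f k * sin (phase L n k) * (cos (phase L n l) - sin (phase L n l)))"
      by (rule sum.cong) (simp_all add: cas_def phase_add cos_add sin_add algebra_simps)
    also have "\<dots> = torus_symbol L f n * cas L n l"
      using sum_support_sin[OF f(2)]
      by (simp add: sum.distrib torus_symbol_def flip: sum_distrib_right)
    finally show ?thesis .
  qed
  have "(\<Sum>k\<in>torus L. cas L n k * (\<Sum>l\<in>torus L. f (centred L (k - l)) * u l))
      = (\<Sum>l\<in>torus L. (\<Sum>k\<in>torus L. cas L n k * f (centred L (k - l))) * u l)"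
    by (simp add: sum_distrib_left sum_distrib_right mult.assoc) (rule sum.swap)
  also have "\<dots> = torus_symbol L f n * (\<Sum>l\<in>torus L. cas L n l * u l)"
    by (simp add: inner sum_distrib_left mult.assoc)
  finally show ?thesis .
qed

definition freq :: "nat \<Rightarrow> int^'d::finite \<Rightarrow> real^'d" where
  "freq L n = (\<chi> i. 2 * pi * real_of_int (centred L n $ i) / real L)"

lemma torus_symbol_eq:
  assumes L: "L > 0"
  shows "Re (symbol f (freq L n)) = torus_symbol L f n"
proof -
  have "(\<Sum>i\<in>UNIV. freq L n $ i * real_of_int (k $ i)) = phase L (centred L n) k" for k
    by (simp add: freq_def phase_def idot_def sum_divide_distrib sum_distrib_left mult_ac)
  moreover have "cos (phase L (centred L n) k) = cos (phase L n k)" for k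
    using cos_sin_phase_tmod(3)[OF L, of "centred L n" k] cos_sin_phase_tmod(3)[OF L, of n k] by simp
  ultimately show ?thesis
    by (simp add: symbol_def torus_symbol_def Re_exp)
qed

lemma torus_symbol_tmod: "L > 0 \<Longrightarrow> torus_symbol L f (tmod L n) = torus_symbol L f n"
  by (simp add: torus_symbol_def cos_sin_phase_tmod)

lemma torus_symbol_minus: "torus_symbol L f (- n) = torus_symbol L f n"
  by (simp add: torus_symbol_def phase_commute[of L _ k for k] phase_minus)

lemma abs_freq_le:
  assumes L: "L > 0"
  shows "\<bar>freq L n $ i\<bar> \<le> pi"
proof -
  have "\<bar>2 * real_of_int (centred L n $ i)\<bar> \<le> real L"
    using centred_bounds[OF L, of n i] by linarith
  then have "\<bar>2 * real_of_int (centred L n $ i) / real L\<bar> \<le> 1" using L by simp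
  then have "\<bar>pi * (2 * real_of_int (centred L n $ i) / real L)\<bar> \<le> pi * 1"
    unfolding abs_mult[of pi] by (intro mult_mono) auto
  then show ?thesis by (simp add: freq_def mult_ac)
qed

lemma freq_in_box: "L > 0 \<Longrightarrow> freq L n \<in> freq_box"
  using abs_freq_le[of L n] unfolding freq_box_def abs_le_iff by (auto simp: minus_le_iff)

lemma freq_eq_0_iff:
  assumes L: "L > 0" and n: "n \<in> torus L"
  shows "freq L n = 0 \<longleftrightarrow> n = 0"
proof
  assume "freq L n = 0"
  then have "centred L n = 0" using L by (simp add: freq_def vec_eq_iff)
  then have "tmod L n = tmod L 0" by (metis tmod_centred)
  then show "n = 0" using n by (simp add: tmod_torus) (simp add: tmod_def vec_eq_iff)
qed (use L in \<open>simp add: freq_def centred_def vec_eq_iff\<close>)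

text \<open>Fourier inversion on a torus on which the array does not overlap itself.  It bounds the gain of \<open>G\<close> by its
absolute gain, so that damping and stiffness are both of order \<open>\<beta>\<close>.\<close>

lemma array_bound_from_symbol:
  fixes g :: "int^'d::finite \<Rightarrow> real"
  assumes g: "local_array q g" "reflection_symmetric g" and L: "2 * q < L"
    and B: "\<And>n. n \<in> torus L \<Longrightarrow> \<bar>torus_symbol L g n\<bar> \<le> B"
  shows "\<bar>g k\<bar> \<le> B"
proof (cases "g k = 0")
  case True
  have L0: "L > 0" using L by simp
  have "0 \<le> B" using B[OF tmod_in_torus[OF L0, of 0]] abs_ge_zero order_trans by blast
  then show ?thesis using True by simp
next
  case False
  have L0: "L > 0" using L by simp
  let ?N = "real (L ^ CARD('d))"
  have N: "?N > 0" using L0 by simp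
  have gm: "g (- k) = g k" using g(2) by (simp add: reflection_symmetric_def)
  have eqv: "tmod L (j - l) = 0 \<longleftrightarrow> j = l" if "g j \<noteq> 0" "g l \<noteq> 0" for j l
  proof
    assume "tmod L (j - l) = 0"
    then have "tmod L ((j - l) + l) = tmod L (0 + l)" by (metis tmod_tmod(2))
    then have "centred L (tmod L j) = centred L (tmod L l)" by simp
    then show "j = l" using centred_support[OF g(1) _ L] that by simp
  qed (simp add: tmod_def vec_eq_iff)
  have halves: "x * (((if P then y else 0) + (if Q then y else 0)) / 2)
      = (if P then x * y / 2 else 0) + (if Q then x * y / 2 else 0)" for x y :: real and P Q
    by (simp add: field_simps)
  have "(\<Sum>n\<in>torus L. torus_symbol L g n * cos (phase L n k))
      = (\<Sum>j | g j \<noteq> 0. g j * (\<Sum>n\<in>torus L. cos (phase L n j) * cos (phase L n k)))"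
    unfolding torus_symbol_def by (simp add: sum_distrib_left sum_distrib_right mult.assoc) (rule sum.swap)
  also have "\<dots> = (\<Sum>j | g j \<noteq> 0. g j * (((if j = k then ?N else 0) + (if j = - k then ?N else 0)) / 2))"
  proof (rule sum.cong[OF refl])
    fix j assume j: "j \<in> {j. g j \<noteq> 0}"
    have "(\<Sum>n\<in>torus L. cos (phase L n j) * cos (phase L n k))
        = (\<Sum>n\<in>torus L. (cos (phase L n (j - k)) + cos (phase L n (j - (- k)))) / 2)"
      by (rule sum.cong) (simp_all add: phase_add phase_diff cos_add cos_diff)
    also have "\<dots> = ((if j = k then ?N else 0) + (if j = - k then ?N else 0)) / 2"
      using j False gm eqv[of j k] eqv[of j "- k"]
      by (simp only: sum_divide_distrib[symmetric] sum.distrib sum_cos_torus[OF L0]) simp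
    finally show "g j * (\<Sum>n\<in>torus L. cos (phase L n j) * cos (phase L n k))
        = g j * (((if j = k then ?N else 0) + (if j = - k then ?N else 0)) / 2)" by simp
  qed
  also have "\<dots> = (\<Sum>j | g j \<noteq> 0. if j = k then g j * ?N / 2 else 0)
      + (\<Sum>j | g j \<noteq> 0. if j = - k then g j * ?N / 2 else 0)"
    unfolding halves sum.distrib ..
  also have "(\<Sum>j | g j \<noteq> 0. if j = k then g j * ?N / 2 else 0) = g k * ?N / 2"
    by (subst sum.delta[OF finite_support[OF g(1)]]) (use False in simp)
  also have "(\<Sum>j | g j \<noteq> 0. if j = - k then g j * ?N / 2 else 0) = g k * ?N / 2"
    by (subst sum.delta[OF finite_support[OF g(1)]]) (use False gm in simp)
  also have "g k * ?N / 2 + g k * ?N / 2 = ?N * g k" by simp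
  finally have e: "(\<Sum>n\<in>torus L. torus_symbol L g n * cos (phase L n k)) = ?N * g k" .
  have "?N * \<bar>g k\<bar> = \<bar>\<Sum>n\<in>torus L. torus_symbol L g n * cos (phase L n k)\<bar>"
    unfolding e using N by (simp add: abs_mult)
  also have "\<dots> \<le> (\<Sum>n\<in>torus L. \<bar>torus_symbol L g n * cos (phase L n k)\<bar>)" by (rule sum_abs)
  also have "\<dots> \<le> (\<Sum>n\<in>(torus L :: (int^'d) set). B)"
  proof (rule sum_mono)
    fix n :: "int^'d" assume n: "n \<in> torus L"
    have "\<bar>torus_symbol L g n\<bar> * \<bar>cos (phase L n k)\<bar> \<le> \<bar>torus_symbol L g n\<bar> * 1"
      by (intro mult_left_mono) auto
    then show "\<bar>torus_symbol L g n * cos (phase L n k)\<bar> \<le> B" using B[OF n] by (simp add: abs_mult)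
  qed
  also have "\<dots> = ?N * B" by (simp add: finite_card_torus)
  finally show ?thesis using N by simp
qed

section \<open>The adjoint equation of a single mode\<close>

lemma has_integral_derivative:
  fixes F :: "real \<Rightarrow> real"
  assumes "a \<le> b" and "\<And>t. t \<in> {a..b} \<Longrightarrow> (F has_real_derivative f t) (at t within {a..b})"
  shows "(f has_integral (F b - F a)) {a..b}"
  using assms by (intro fundamental_theorem_of_calculus)
    (simp_all add: has_real_derivative_iff_has_vector_derivative)

text \<open>The row vector \<open>p = e\<^sub>x exp (A t)\<close> for the mode matrix \<open>A\<close>: its components are the responses of the position
at time \<open>t\<close> to unit initial values of controller state, position and velocity.  Working with \<open>p\<close> rather than with
the full matrix exponential suffices, since only the position is observed.\<close>

definition adjoint_solution ::
  "real \<Rightarrow> real \<Rightarrow> real \<Rightarrow> real \<Rightarrow> (real \<Rightarrow> real) \<Rightarrow> (real \<Rightarrow> real) \<Rightarrow> (real \<Rightarrow> real) \<Rightarrow> bool" where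
  "adjoint_solution c \<alpha> \<phi> \<gamma> p1 p2 p3 \<longleftrightarrow>
     p1 0 = 0 \<and> p2 0 = 1 \<and> p3 0 = 0 \<and>
     (\<forall>t. (p1 has_real_derivative (p3 t - \<alpha> * p1 t)) (at t) \<and>
          (p2 has_real_derivative (- \<phi> * p3 t)) (at t) \<and>
          (p3 has_real_derivative (p2 t - c * p1 t - \<gamma> * p3 t)) (at t))"

lemma summable_exponential_series:
  fixes c :: "nat \<Rightarrow> real"
  assumes "\<And>n. \<bar>c n\<bar> \<le> K ^ n * B"
  shows "summable (\<lambda>n. c n / fact n * t ^ n)"
proof (rule summable_comparison_test')
  show "summable (\<lambda>n. B * ((K * \<bar>t\<bar>) ^ n /\<^sub>R fact n))"
    by (intro summable_mult summable_exp_generic)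
  fix n :: nat
  have "\<bar>c n\<bar> * \<bar>t\<bar> ^ n \<le> (K ^ n * B) * \<bar>t\<bar> ^ n"
    by (intro mult_right_mono assms) simp
  then have "\<bar>c n\<bar> * \<bar>t\<bar> ^ n / fact n \<le> (K ^ n * B) * \<bar>t\<bar> ^ n / fact n"
    by (rule divide_right_mono) simp
  then show "norm (c n / fact n * t ^ n) \<le> B * ((K * \<bar>t\<bar>) ^ n /\<^sub>R fact n)"
    by (simp add: abs_mult power_abs power_mult_distrib divide_inverse mult_ac)
qed

text \<open>Differentiation of an exponential generating series shifts its coefficients; hence the matrix exponential solves
its equation coefficient by coefficient.\<close>

lemma has_derivative_exponential_series:
  fixes c :: "nat \<Rightarrow> real"
  assumes "\<And>n. \<bar>c n\<bar> \<le> K ^ n * B"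
  shows "((\<lambda>t. \<Sum>n. c n / fact n * t ^ n) has_real_derivative (\<Sum>n. c (Suc n) / fact n * t ^ n)) (at t)"
proof -
  have "diffs (\<lambda>n. c n / fact n) = (\<lambda>n. c (Suc n) / fact n)"
    by (rule ext) (simp add: diffs_def del: of_nat_Suc)
  then show ?thesis
    using termdiffs_strong_converges_everywhere[where c = "\<lambda>n. c n / fact n" and x = t, OF summable_exponential_series[OF assms]]
    by simp
qed

primrec adjoint_coeffs :: "real \<Rightarrow> real \<Rightarrow> real \<Rightarrow> real \<Rightarrow> nat \<Rightarrow> real \<times> real \<times> real" where
  "adjoint_coeffs c \<alpha> \<phi> \<gamma> 0 = (0, 1, 0)"
| "adjoint_coeffs c \<alpha> \<phi> \<gamma> (Suc n) =
     (case adjoint_coeffs c \<alpha> \<phi> \<gamma> n of (u, v, w) \<Rightarrow> (w - \<alpha> * u, - \<phi> * w, v - c * u - \<gamma> * w))"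

lemma adjoint_solution_exists: "\<exists>p1 p2 p3. adjoint_solution c \<alpha> \<phi> \<gamma> p1 p2 p3"
proof -
  define u where "u n = fst (adjoint_coeffs c \<alpha> \<phi> \<gamma> n)" for n
  define v where "v n = fst (snd (adjoint_coeffs c \<alpha> \<phi> \<gamma> n))" for n
  define w where "w n = snd (snd (adjoint_coeffs c \<alpha> \<phi> \<gamma> n))" for n
  have step: "u (Suc n) = w n - \<alpha> * u n" "v (Suc n) = - \<phi> * w n"
      "w (Suc n) = v n - c * u n - \<gamma> * w n" for n
    by (simp_all add: u_def v_def w_def split: prod.splits)
  have init: "u 0 = 0" "v 0 = 1" "w 0 = 0" by (simp_all add: u_def v_def w_def)
  define K where "K = 1 + \<bar>\<alpha>\<bar> + \<bar>\<phi>\<bar> + \<bar>c\<bar> + \<bar>\<gamma>\<bar>"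
  have bound: "\<bar>u n\<bar> \<le> K ^ n \<and> \<bar>v n\<bar> \<le> K ^ n \<and> \<bar>w n\<bar> \<le> K ^ n" for n
  proof (induction n)
    case 0 then show ?case by (simp add: init)
  next
    case (Suc n)
    define k where "k = K ^ n"
    have IH: "\<bar>u n\<bar> \<le> k" "\<bar>v n\<bar> \<le> k" "\<bar>w n\<bar> \<le> k" using Suc.IH by (simp_all add: k_def)
    have k: "0 \<le> k" using IH(1) abs_ge_zero order_trans by blast
    have m: "\<bar>y * s\<bar> \<le> \<bar>y\<bar> * k" if "\<bar>s\<bar> \<le> k" for y s
      using that by (simp add: abs_mult mult_left_mono)
    have K: "K ^ Suc n = K * k" by (simp add: k_def)
    have nn: "0 \<le> \<bar>\<alpha>\<bar> * k" "0 \<le> \<bar>\<phi>\<bar> * k" "0 \<le> \<bar>c\<bar> * k" "0 \<le> \<bar>\<gamma>\<bar> * k"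
      using k by simp_all
    have le: "k + \<bar>\<alpha>\<bar> * k \<le> K * k" "\<bar>\<phi>\<bar> * k \<le> K * k" "k + \<bar>c\<bar> * k + \<bar>\<gamma>\<bar> * k \<le> K * k"
      unfolding K_def distrib_right mult_1_left
      using nn k by (simp_all only: le_add_same_cancel1 le_add_same_cancel2 add.assoc add_le_cancel_left)
    have "\<bar>w n - \<alpha> * u n\<bar> \<le> K * k"
      by (rule order_trans[OF order_trans[OF abs_triangle_ineq4 add_mono[OF IH(3) m[OF IH(1)]]] le(1)])
    moreover have "\<bar>- \<phi> * w n\<bar> \<le> K * k"
      using order_trans[OF m[OF IH(3), of "- \<phi>"]] le(2) by simp
    moreover have "\<bar>v n - c * u n - \<gamma> * w n\<bar> \<le> K * k"
      by (rule order_trans[OF order_trans[OF abs_triangle_ineq4 add_mono[OF order_trans[OF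
            abs_triangle_ineq4 add_mono[OF IH(2) m[OF IH(1)]]] m[OF IH(3)]]] le(3)])
    ultimately show ?case by (simp only: step K)
  qed
  have b: "\<bar>u n\<bar> \<le> K ^ n * 1" "\<bar>v n\<bar> \<le> K ^ n * 1" "\<bar>w n\<bar> \<le> K ^ n * 1" for n
    using bound by simp_all
  let ?F = "\<lambda>a t. \<Sum>n. a n / fact n * t ^ n"
  note sm = summable_exponential_series
  have su: "summable (\<lambda>n. u n / fact n * t ^ n)" "summable (\<lambda>n. v n / fact n * t ^ n)"
      "summable (\<lambda>n. w n / fact n * t ^ n)" for t
    using sm[of u K 1] sm[of v K 1] sm[of w K 1] b by auto
  have e1: "?F (\<lambda>n. u (Suc n)) t = ?F w t - \<alpha> * ?F u t" for t
    unfolding suminf_mult[OF su(1), symmetric]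
    by (subst suminf_diff[OF su(3) summable_mult[OF su(1)]])
       (simp add: step(1) diff_divide_distrib algebra_simps)
  have e2: "?F (\<lambda>n. v (Suc n)) t = - \<phi> * ?F w t" for t
    unfolding suminf_mult[OF su(3), symmetric] by (simp add: step(2) mult.assoc)
  have e3: "?F (\<lambda>n. w (Suc n)) t = ?F v t - c * ?F u t - \<gamma> * ?F w t" for t
    unfolding suminf_mult[OF su(1), symmetric] suminf_mult[OF su(3), symmetric]
    by (subst suminf_diff[OF su(2) summable_mult[OF su(1)]],
        subst suminf_diff[OF summable_diff[OF su(2) summable_mult[OF su(1)]] summable_mult[OF su(3)]])
       (simp add: step(3) diff_divide_distrib add_divide_distrib algebra_simps)
  have z: "?F a 0 = a 0" for a :: "nat \<Rightarrow> real"
    using powser_zero[of "\<lambda>n. a n / fact n"] by simp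
  have d: "(?F u has_real_derivative ?F (\<lambda>n. u (Suc n)) t) (at t)"
      "(?F v has_real_derivative ?F (\<lambda>n. v (Suc n)) t) (at t)"
      "(?F w has_real_derivative ?F (\<lambda>n. w (Suc n)) t) (at t)" for t
    using has_derivative_exponential_series[of u K 1] has_derivative_exponential_series[of v K 1]
      has_derivative_exponential_series[of w K 1] b by blast+
  have "adjoint_solution c \<alpha> \<phi> \<gamma> (?F u) (?F v) (?F w)"
    using d unfolding adjoint_solution_def z init e1 e2 e3 by simp
  then show ?thesis by blast
qed

text \<open>The energy \<open>E = c p1\<^sup>2 + p2\<^sup>2 / \<phi> + p3\<^sup>2\<close> satisfies \<open>E' = - 2 \<alpha> c p1\<^sup>2 - 2 \<gamma> p3\<^sup>2\<close>, which lacks dissipation in \<open>p2\<close>.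
Subtracting a small multiple of \<open>p2 p3\<close> supplies it and turns \<open>E\<close> into a strict Lyapunov function.\<close>

lemma adjoint_solution_decays:
  assumes p: "adjoint_solution c \<alpha> \<phi> \<gamma> p1 p2 p3"
    and pos: "c > 0" "\<alpha> > 0" "\<phi> > 0" "\<gamma> > 0"
  shows "(p1 \<longlongrightarrow> 0) at_top" "(p2 \<longlongrightarrow> 0) at_top" "(p3 \<longlongrightarrow> 0) at_top"
proof -
  \<comment> \<open>The first two bounds keep the cross terms below the dissipation in \<open>p1\<close> and \<open>p3\<close>, the others keep \<open>F\<close> between multiples of \<open>E\<close>.\<close>
  define \<delta> where "\<delta> = min (min (\<alpha> / (2 * c)) (\<gamma> / (2 * (\<phi> + \<gamma>\<^sup>2)))) (min (1 / 2) (1 / (2 * \<phi>)))"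
  have q0: "\<phi> + \<gamma>\<^sup>2 > 0" using pos by (simp add: add_pos_pos)
  have \<delta>: "\<delta> > 0" using pos q0 by (simp add: \<delta>_def)
  have \<delta>1: "2 * \<delta> * c \<le> \<alpha>"
  proof -
    have "\<delta> \<le> \<alpha> / (2 * c)" by (simp add: \<delta>_def)
    then show ?thesis using pos by (simp add: field_simps)
  qed
  have \<delta>2: "2 * \<delta> * (\<phi> + \<gamma>\<^sup>2) \<le> \<gamma>"
  proof -
    have "\<delta> \<le> \<gamma> / (2 * (\<phi> + \<gamma>\<^sup>2))" by (simp add: \<delta>_def)
    then show ?thesis using q0 by (simp add: pos_le_divide_eq mult_ac)
  qed
  have \<delta>3: "2 * \<delta> \<le> 1" by (simp add: \<delta>_def)
  have \<delta>4: "2 * \<delta> \<le> 1 / \<phi>"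
  proof -
    have "\<delta> \<le> 1 / (2 * \<phi>)" by (simp add: \<delta>_def)
    then show ?thesis using pos by (simp add: field_simps)
  qed
  define E where "E t = c * (p1 t)\<^sup>2 + (p2 t)\<^sup>2 / \<phi> + (p3 t)\<^sup>2" for t
  define F where "F t = E t - 2 * \<delta> * (p2 t * p3 t)" for t
  define F' where "F' t = - 2 * \<alpha> * c * (p1 t)\<^sup>2 - 2 * \<gamma> * (p3 t)\<^sup>2
      + 2 * \<delta> * (\<phi> * (p3 t)\<^sup>2 + c * p1 t * p2 t - (p2 t)\<^sup>2 + \<gamma> * p2 t * p3 t)" for t
  have dF: "(F has_real_derivative F' t) (at t)" for t
    using p pos unfolding F_def E_def F'_def adjoint_solution_def
    by (auto intro!: derivative_eq_intros simp: power2_eq_square field_simps)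
  define \<mu> where "\<mu> = min (min \<alpha> \<gamma>) (\<delta> * \<phi>)"
  have \<mu>: "\<mu> > 0" using pos \<delta> by (simp add: \<mu>_def)
  have cross: "\<bar>2 * \<delta> * (p2 t * p3 t)\<bar> \<le> E t / 2" for t
  proof -
    have "\<bar>2 * (p2 t * p3 t)\<bar> \<le> (p2 t)\<^sup>2 + (p3 t)\<^sup>2"
      using sum_squares_bound[of "p2 t" "p3 t"] sum_squares_bound[of "- p2 t" "p3 t"]
      by (simp add: abs_le_iff)
    then have "\<delta> * \<bar>2 * (p2 t * p3 t)\<bar> \<le> \<delta> * ((p2 t)\<^sup>2 + (p3 t)\<^sup>2)"
      using \<delta> by (simp add: mult_left_mono)
    moreover have "2 * \<delta> * (p2 t)\<^sup>2 \<le> (p2 t)\<^sup>2 / \<phi>"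
      using mult_right_mono[OF \<delta>4, of "(p2 t)\<^sup>2"] by simp
    moreover have "2 * \<delta> * (p3 t)\<^sup>2 \<le> (p3 t)\<^sup>2"
      using mult_right_mono[OF \<delta>3, of "(p3 t)\<^sup>2"] by simp
    moreover have "0 \<le> c * (p1 t)\<^sup>2" using pos by simp
    ultimately show ?thesis using \<delta> unfolding E_def by (simp add: abs_mult algebra_simps)
  qed
  have FE: "E t \<le> 2 * F t" "F t \<le> 3 / 2 * E t" for t
    using cross[of t] by (simp_all add: F_def abs_le_iff)
  have F'_le: "F' t \<le> - \<mu> * E t" for t
  proof -
    have a: "2 * \<delta> * (c * p1 t * p2 t) \<le> 2 * \<delta> * c\<^sup>2 * (p1 t)\<^sup>2 + \<delta> / 2 * (p2 t)\<^sup>2"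
    proof -
      have "0 \<le> \<delta> / 2 * (2 * c * p1 t - p2 t)\<^sup>2" using \<delta> by simp
      then show ?thesis by (simp add: power2_eq_square algebra_simps)
    qed
    have b: "2 * \<delta> * (\<gamma> * p2 t * p3 t) \<le> 2 * \<delta> * \<gamma>\<^sup>2 * (p3 t)\<^sup>2 + \<delta> / 2 * (p2 t)\<^sup>2"
    proof -
      have "0 \<le> \<delta> / 2 * (2 * \<gamma> * p3 t - p2 t)\<^sup>2" using \<delta> by simp
      then show ?thesis by (simp add: power2_eq_square algebra_simps)
    qed
    have c1: "2 * \<delta> * c * (c * (p1 t)\<^sup>2) \<le> \<alpha> * (c * (p1 t)\<^sup>2)"
      using \<delta>1 pos by (intro mult_right_mono) auto
    have c2: "2 * \<delta> * (\<phi> + \<gamma>\<^sup>2) * (p3 t)\<^sup>2 \<le> \<gamma> * (p3 t)\<^sup>2"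
      using \<delta>2 by (intro mult_right_mono) auto
    have m1: "\<mu> * (c * (p1 t)\<^sup>2) \<le> \<alpha> * (c * (p1 t)\<^sup>2)"
      using pos by (intro mult_right_mono) (auto simp: \<mu>_def)
    have m2: "\<mu> * ((p2 t)\<^sup>2 / \<phi>) \<le> \<delta> * (p2 t)\<^sup>2"
    proof -
      have "\<mu> * ((p2 t)\<^sup>2 / \<phi>) \<le> (\<delta> * \<phi>) * ((p2 t)\<^sup>2 / \<phi>)"
        using pos by (intro mult_right_mono) (auto simp: \<mu>_def)
      then show ?thesis using pos by simp
    qed
    have m3: "\<mu> * (p3 t)\<^sup>2 \<le> \<gamma> * (p3 t)\<^sup>2"
      by (intro mult_right_mono) (auto simp: \<mu>_def)
    have "F' t \<le> - \<alpha> * (c * (p1 t)\<^sup>2) - \<delta> * (p2 t)\<^sup>2 - \<gamma> * (p3 t)\<^sup>2"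
      using a b c1 c2 unfolding F'_def by (simp add: power2_eq_square algebra_simps)
    also have "\<dots> \<le> - \<mu> * E t" using m1 m2 m3 unfolding E_def by (simp add: algebra_simps)
    finally show ?thesis .
  qed
  define \<rho> where "\<rho> = 2 / 3 * \<mu>"
  have \<rho>: "\<rho> > 0" using \<mu> by (simp add: \<rho>_def)
  have F'_le2: "F' t + \<rho> * F t \<le> 0" for t
  proof -
    have "\<rho> * F t \<le> \<mu> * E t" using FE(2)[of t] \<mu> by (simp add: \<rho>_def mult_left_mono)
    then show ?thesis using F'_le[of t] by simp
  qed
  have Fexp: "F t \<le> F 0 * exp (- \<rho> * t)" if "t \<ge> 0" for t
  proof -
    have "F t * exp (\<rho> * t) \<le> F 0 * exp (\<rho> * 0)"
    proof (rule DERIV_nonpos_imp_nonincreasing[OF that], intro exI conjI)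
      fix s assume "0 \<le> s" "s \<le> t"
      show "((\<lambda>t. F t * exp (\<rho> * t)) has_real_derivative (F' s + \<rho> * F s) * exp (\<rho> * s)) (at s)"
        by (auto intro!: derivative_eq_intros dF simp: algebra_simps)
      show "(F' s + \<rho> * F s) * exp (\<rho> * s) \<le> 0"
        using F'_le2[of s] by (simp add: mult_nonpos_nonneg)
    qed
    then show ?thesis by (simp add: exp_minus field_simps)
  qed
  have "((\<lambda>t. exp (- \<rho> * t)) \<longlongrightarrow> 0) at_top"
    using \<rho> by real_asymp
  then have lim: "((\<lambda>t. k * (2 * (F 0 * exp (- \<rho> * t)))) \<longlongrightarrow> 0) at_top" for k
    by (auto intro!: tendsto_mult_right_zero tendsto_mult_left_zero)
  have dec: "(p \<longlongrightarrow> 0) at_top" if "\<And>t. (p t)\<^sup>2 \<le> k * E t" "k \<ge> 0" for p k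
  proof -
    have "((\<lambda>t. (p t)\<^sup>2) \<longlongrightarrow> 0) at_top"
    proof (rule tendsto_sandwich[OF _ _ tendsto_const lim[of k]])
      show "\<forall>\<^sub>F t in at_top. (p t)\<^sup>2 \<le> k * (2 * (F 0 * exp (- \<rho> * t)))"
        using eventually_ge_at_top[of "0::real"]
      proof eventually_elim
        case (elim t)
        have "E t \<le> 2 * (F 0 * exp (- \<rho> * t))" using FE(1)[of t] Fexp[OF elim] by simp
        then show ?case using that(1)[of t] mult_left_mono[OF _ that(2)] order_trans by blast
      qed
    qed simp
    then show ?thesis by (simp add: power_tendsto_0_iff)
  qed
  have nn: "0 \<le> c * (p1 t)\<^sup>2" "0 \<le> (p2 t)\<^sup>2 / \<phi>" for t using pos by auto
  show "(p1 \<longlongrightarrow> 0) at_top"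
    using nn pos by (intro dec[of _ "1 / c"]) (auto simp: E_def field_simps)
  show "(p2 \<longlongrightarrow> 0) at_top"
    using nn pos by (intro dec[of _ \<phi>]) (auto simp: E_def field_simps)
  show "(p3 \<longlongrightarrow> 0) at_top"
    using nn pos by (intro dec[of _ 1]) (auto simp: E_def)
qed

text \<open>The squared \<open>H\<^sub>2\<close> norm of the transfer function from disturbance and measurement noise to the position of a mode,
\<open>((s + \<alpha>) w - c \<epsilon> \<eta>) / (s^3 + (\<alpha> + \<gamma>) s\<^sup>2 + (\<alpha> \<gamma> + \<phi> + c) s + \<alpha> \<phi>)\<close>.  The denominator below is \<open>2 \<phi>\<close> times the
Hurwitz determinant \<open>(\<alpha> + \<gamma>) (\<alpha> \<gamma> + \<phi> + c) - \<alpha> \<phi>\<close>.\<close>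

definition mode_variance :: "real \<Rightarrow> real \<Rightarrow> real \<Rightarrow> real \<Rightarrow> real \<Rightarrow> real" where
  "mode_variance c \<epsilon> \<alpha> \<phi> \<gamma> =
     ((c * \<epsilon>)\<^sup>2 * ((\<alpha> + \<gamma>) / \<alpha>) + (\<phi> + \<alpha> * (\<alpha> + \<gamma>)))
       / (2 * \<phi> * (\<alpha> * \<gamma> * (\<alpha> + \<gamma>) + \<gamma> * \<phi> + c * (\<alpha> + \<gamma>)))"

text \<open>The integrand is minus the derivative of a quadratic form \<open>T\<close> in \<open>p\<close>, that is, \<open>T\<close> solves the Lyapunov equation.  As \<open>p\<close>
starts in \<open>(0, 1, 0)\<close> and decays, the integral is the coefficient of \<open>p2\<^sup>2\<close> in \<open>T\<close>.\<close>

lemma adjoint_solution_energy: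
  assumes p: "adjoint_solution c \<alpha> \<phi> \<gamma> p1 p2 p3"
    and pos: "c > 0" "\<alpha> > 0" "\<phi> > 0" "\<gamma> > 0"
  shows "((\<lambda>t. integral {0..t} (\<lambda>s. (c * \<epsilon> * p1 s)\<^sup>2 + (p3 s)\<^sup>2)) \<longlongrightarrow> mode_variance c \<epsilon> \<alpha> \<phi> \<gamma>) at_top"
proof -
  define e where "e = (c * \<epsilon>)\<^sup>2"
  define \<Delta> where "\<Delta> = \<alpha> * \<gamma> * (\<alpha> + \<gamma>) + \<gamma> * \<phi> + c * (\<alpha> + \<gamma>)"
  have \<Delta>: "\<Delta> > 0" using pos by (simp add: \<Delta>_def add_pos_pos)
  \<comment> \<open>The coefficients of \<open>T\<close> are determined by comparing the coefficients of the six quadratic monomials in \<open>p\<close>.\<close>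
  define m12 where "m12 = (\<gamma> * e - \<alpha> * c) / (\<alpha> * \<Delta>)"
  define m13 where "m13 = \<alpha> * m12"
  define m33 where "m33 = (m13 + 1) / (2 * \<gamma>)"
  define m22 where "m22 = (m12 + 2 * m33) / (2 * \<phi>)"
  define m11 where "m11 = (\<phi> * m12 + (\<alpha> + \<gamma>) * m13 + 2 * c * m33) / 2"
  define T where "T t = m11 * (p1 t)\<^sup>2 + m12 * (p1 t * p2 t) + m13 * (p1 t * p3 t)
      + m22 * (p2 t)\<^sup>2 + m33 * (p3 t)\<^sup>2" for t
  have r1: "m12 - 2 * \<phi> * m22 + 2 * m33 = 0" using pos by (simp add: m22_def)
  have r2: "m13 - 2 * \<gamma> * m33 = -1" using pos by (simp add: m33_def)
  have r3: "2 * m11 - \<phi> * m12 - (\<alpha> + \<gamma>) * m13 - 2 * c * m33 = 0"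
  proof -
    have "2 * m11 = \<phi> * m12 + (\<alpha> + \<gamma>) * m13 + 2 * c * m33" by (simp add: m11_def)
    then show ?thesis by simp
  qed
  have r4: "2 * \<alpha> * m11 + c * m13 = e"
  proof -
    have m12: "m12 * (\<alpha> * \<Delta>) = \<gamma> * e - \<alpha> * c" using pos \<Delta> by (simp add: m12_def)
    have "2 * \<gamma> * m33 = m13 + 1" using r2 by simp
    moreover have "2 * m11 = \<phi> * m12 + (\<alpha> + \<gamma>) * m13 + 2 * c * m33" by (simp add: m11_def)
    ultimately have "\<gamma> * (2 * \<alpha> * m11 + c * m13) = \<gamma> * e"
      using m12 m13_def \<Delta>_def by algebra
    then show ?thesis using pos by simp
  qed
  have dT: "(T has_real_derivative - ((c * \<epsilon> * p1 t)\<^sup>2 + (p3 t)\<^sup>2)) (at t)" for t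
  proof -
    have "(T has_real_derivative
        (m13 - \<alpha> * m12) * (p1 t * p2 t) + (m12 - 2 * \<phi> * m22 + 2 * m33) * (p2 t * p3 t)
        + (2 * m11 - \<phi> * m12 - (\<alpha> + \<gamma>) * m13 - 2 * c * m33) * (p1 t * p3 t)
        + (m13 - 2 * \<gamma> * m33) * (p3 t)\<^sup>2 - (2 * \<alpha> * m11 + c * m13) * (p1 t)\<^sup>2) (at t)"
      using p unfolding T_def adjoint_solution_def
      by (auto intro!: derivative_eq_intros simp: power2_eq_square algebra_simps)
    then show ?thesis
      unfolding r1 r2 r3 r4
      by (rule DERIV_cong) (simp add: m13_def e_def power_mult_distrib)
  qed
  have int: "integral {0..t} (\<lambda>s. (c * \<epsilon> * p1 s)\<^sup>2 + (p3 s)\<^sup>2) = T 0 - T t" if "t \<ge> 0" for t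
  proof (rule integral_unique)
    have "((\<lambda>s. (c * \<epsilon> * p1 s)\<^sup>2 + (p3 s)\<^sup>2) has_integral (- T t - (- T 0))) {0..t}"
      using that has_field_derivative_at_within[OF DERIV_minus[OF dT]]
      by (intro has_integral_derivative) (simp_all add: add.commute)
    then show "((\<lambda>s. (c * \<epsilon> * p1 s)\<^sup>2 + (p3 s)\<^sup>2) has_integral (T 0 - T t)) {0..t}" by simp
  qed
  have T0: "T 0 = mode_variance c \<epsilon> \<alpha> \<phi> \<gamma>"
  proof -
    have "T 0 = m22" using p by (simp add: T_def adjoint_solution_def)
    also have "m22 = ((\<alpha> + \<gamma>) * m12 + 1) / (2 * \<phi> * \<gamma>)"
      using pos by (simp add: m22_def m33_def m13_def field_simps)
    also have "\<dots> = ((\<alpha> + \<gamma>) * (\<gamma> * e - \<alpha> * c) + \<alpha> * \<Delta>) / (2 * \<phi> * \<gamma> * (\<alpha> * \<Delta>))"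
      using pos \<Delta> by (simp add: m12_def field_simps)
    also have "(\<alpha> + \<gamma>) * (\<gamma> * e - \<alpha> * c) + \<alpha> * \<Delta> = \<gamma> * ((\<alpha> + \<gamma>) * e + \<alpha> * (\<phi> + \<alpha> * (\<alpha> + \<gamma>)))"
      by (simp add: \<Delta>_def algebra_simps)
    also have "\<gamma> * ((\<alpha> + \<gamma>) * e + \<alpha> * (\<phi> + \<alpha> * (\<alpha> + \<gamma>))) / (2 * \<phi> * \<gamma> * (\<alpha> * \<Delta>))
       = (e * ((\<alpha> + \<gamma>) / \<alpha>) + (\<phi> + \<alpha> * (\<alpha> + \<gamma>))) / (2 * \<phi> * \<Delta>)"
      using pos \<Delta> by (simp add: divide_simps)
    finally show ?thesis by (simp add: mode_variance_def e_def \<Delta>_def)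
  qed
  note dec = adjoint_solution_decays[OF p pos]
  have "((\<lambda>t. T 0 - T t) \<longlongrightarrow> T 0 - (m11 * 0\<^sup>2 + m12 * (0 * 0) + m13 * (0 * 0) + m22 * 0\<^sup>2 + m33 * 0\<^sup>2)) at_top"
    unfolding T_def by (intro tendsto_intros dec)
  then have "((\<lambda>t. T 0 - T t) \<longlongrightarrow> T 0) at_top" by simp
  then show ?thesis
    unfolding T0[symmetric]
    by (rule Lim_transform_eventually) (use eventually_ge_at_top[of "0::real"] in eventually_elim, simp add: int)
qed

text \<open>The noise is only continuous, so the system is solved for the differentiable part of the state, the state minus
the noise, paired with the time-reversed adjoint solution.  Since \<open>p1\<close> and \<open>p3\<close> vanish at 0, no boundary
term with the noise itself remains.\<close>

lemma variation_of_constants: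
  assumes p: "adjoint_solution c \<alpha> \<phi> \<gamma> p1 p2 p3"
    and cont: "continuous_on {0..} Z" "continuous_on {0..} X" "continuous_on {0..} V"
    and Z: "\<And>t. t \<ge> 0 \<Longrightarrow> Z t = Z 0 + integral {0..t} (\<lambda>s. - \<alpha> * Z s - c * V s) + m t"
    and X: "\<And>t. t \<ge> 0 \<Longrightarrow> X t = X 0 + integral {0..t} V"
    and V: "\<And>t. t \<ge> 0 \<Longrightarrow> V t = V 0 + integral {0..t} (\<lambda>s. Z s - \<phi> * X s - \<gamma> * V s) + w t"
    and t: "t \<ge> 0"
  shows "X t = p1 t * Z 0 + p2 t * X 0 + p3 t * V 0
    + integral {0..t} (\<lambda>s. (p3 (t - s) - \<alpha> * p1 (t - s)) * m s
        + (p2 (t - s) - c * p1 (t - s) - \<gamma> * p3 (t - s)) * w s)"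
proof -
  have ct: "continuous_on {0..t} Z" "continuous_on {0..t} X" "continuous_on {0..t} V"
    using cont by (auto intro: continuous_on_subset)
  \<comment> \<open>The state without the noise, which is continuously differentiable.\<close>
  define R1 where "R1 s = Z 0 + integral {0..s} (\<lambda>s. - \<alpha> * Z s - c * V s)" for s
  define R2 where "R2 s = X 0 + integral {0..s} V" for s
  define R3 where "R3 s = V 0 + integral {0..s} (\<lambda>s. Z s - \<phi> * X s - \<gamma> * V s)" for s
  have d: "(R1 has_real_derivative (- \<alpha> * Z s - c * V s)) (at s within {0..t})"
     "(R2 has_real_derivative V s) (at s within {0..t})"
     "(R3 has_real_derivative (Z s - \<phi> * X s - \<gamma> * V s)) (at s within {0..t})"
    if "s \<in> {0..t}" for s
  proof -
    have i: "((\<lambda>s. k + integral {0..s} h) has_real_derivative h s) (at s within {0..t})"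
      if "continuous_on {0..t} h" for h k
      using DERIV_add[OF DERIV_const integral_has_real_derivative[OF that \<open>s \<in> {0..t}\<close>]] by simp
    show "(R1 has_real_derivative (- \<alpha> * Z s - c * V s)) (at s within {0..t})"
      unfolding R1_def[abs_def] by (rule i) (intro continuous_intros ct)
    show "(R2 has_real_derivative V s) (at s within {0..t})"
      unfolding R2_def[abs_def] by (rule i) (intro continuous_intros ct)
    show "(R3 has_real_derivative (Z s - \<phi> * X s - \<gamma> * V s)) (at s within {0..t})"
      unfolding R3_def[abs_def] by (rule i) (intro continuous_intros ct)
  qed
  have dp: "((\<lambda>s. p1 (t - s)) has_real_derivative - (p3 (t - s) - \<alpha> * p1 (t - s))) (at s within A)"
     "((\<lambda>s. p2 (t - s)) has_real_derivative - (- \<phi> * p3 (t - s))) (at s within A)"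
     "((\<lambda>s. p3 (t - s)) has_real_derivative - (p2 (t - s) - c * p1 (t - s) - \<gamma> * p3 (t - s))) (at s within A)"
    for s A
  proof -
    have sub: "((\<lambda>s. t - s) has_real_derivative - 1) (at s within A)"
      by (auto intro!: derivative_eq_intros)
    have ch: "((\<lambda>s. p (t - s)) has_real_derivative - D) (at s within A)"
      if "(p has_real_derivative D) (at (t - s))" for p D
      using DERIV_chain2[OF that sub] by simp
    show "((\<lambda>s. p1 (t - s)) has_real_derivative - (p3 (t - s) - \<alpha> * p1 (t - s))) (at s within A)"
      by (rule ch[of p1]) (use p in \<open>simp add: adjoint_solution_def\<close>)
    show "((\<lambda>s. p2 (t - s)) has_real_derivative - (- \<phi> * p3 (t - s))) (at s within A)"
      by (rule ch[of p2]) (use p in \<open>simp add: adjoint_solution_def\<close>)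
    show "((\<lambda>s. p3 (t - s)) has_real_derivative - (p2 (t - s) - c * p1 (t - s) - \<gamma> * p3 (t - s))) (at s within A)"
      by (rule ch[of p3]) (use p in \<open>simp add: adjoint_solution_def\<close>)
  qed
  define g where "g s = p1 (t - s) * R1 s + p2 (t - s) * R2 s + p3 (t - s) * R3 s" for s
  have I: "((\<lambda>s. (p3 (t - s) - \<alpha> * p1 (t - s)) * m s
        + (p2 (t - s) - c * p1 (t - s) - \<gamma> * p3 (t - s)) * w s) has_integral (g t - g 0)) {0..t}"
  proof (rule has_integral_derivative[OF t])
    fix s assume s: "s \<in> {0..t}"
    then have s0: "s \<ge> 0" by simp
    have e: "Z s = R1 s + m s" "X s = R2 s" "V s = R3 s + w s"
      using Z[OF s0] X[OF s0] V[OF s0] by (simp_all add: R1_def R2_def R3_def)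
    show "(g has_real_derivative (p3 (t - s) - \<alpha> * p1 (t - s)) * m s
        + (p2 (t - s) - c * p1 (t - s) - \<gamma> * p3 (t - s)) * w s) (at s within {0..t})"
      unfolding g_def[abs_def]
      by (rule DERIV_cong[OF DERIV_add[OF DERIV_add[OF DERIV_mult[OF dp(1) d(1)[OF s]]
            DERIV_mult[OF dp(2) d(2)[OF s]]] DERIV_mult[OF dp(3) d(3)[OF s]]]])
         (simp add: e algebra_simps)
  qed
  have gt: "g t = X t" using p X[OF t] by (simp add: g_def R2_def adjoint_solution_def)
  have g0: "g 0 = p1 t * Z 0 + p2 t * X 0 + p3 t * V 0"
    by (simp add: g_def R1_def R2_def R3_def)
  show ?thesis
    unfolding integral_unique[OF I] gt g0 by simp
qed

section \<open>Second moments of linear functionals of white noise\<close>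

text \<open>What is needed to exchange expectation and time integration.\<close>

definition second_order_process :: "'w measure \<Rightarrow> (real \<Rightarrow> 'w \<Rightarrow> real) \<Rightarrow> bool" where
  "second_order_process M Y \<longleftrightarrow>
     (\<forall>t\<ge>0. Y t \<in> borel_measurable M \<and> integrable M (\<lambda>w. (Y t w)\<^sup>2)) \<and>
     (\<forall>w\<in>space M. continuous_on {0..} (\<lambda>t. Y t w)) \<and>
     (\<forall>T. \<exists>B. \<forall>t\<in>{0..T}. (LINT w|M. (Y t w)\<^sup>2) \<le> B)"

text \<open>Continuous paths are limits of their evaluations on finer and finer time grids, which are countable families of
random variables.\<close>

lemma jointly_measurable_process:
  fixes Y :: "real \<Rightarrow> 'w \<Rightarrow> real"
  assumes meas: "\<And>t. t \<ge> 0 \<Longrightarrow> Y t \<in> borel_measurable M"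
    and cont: "\<And>w. w \<in> space M \<Longrightarrow> continuous_on {0..} (\<lambda>t. Y t w)"
  shows "(\<lambda>(s, w). Y (max 0 s) w) \<in> borel_measurable (lborel \<Otimes>\<^sub>M M)"
proof -
  define g where "g n p = real_of_int \<lfloor>real (Suc n) * fst p\<rfloor> / real (Suc n)" for n and p :: "real \<times> 'w"
  have "fst p - 1 / real (Suc n) \<le> g n p" and "g n p \<le> fst p" for n p
  proof -
    have "real (Suc n) * fst p - 1 \<le> real_of_int \<lfloor>real (Suc n) * fst p\<rfloor>" by linarith
    then have "(real (Suc n) * fst p - 1) / real (Suc n) \<le> g n p"
      unfolding g_def by (rule divide_right_mono) simp
    then show "fst p - 1 / real (Suc n) \<le> g n p"
      by (simp add: diff_divide_distrib del: of_nat_Suc)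
    have "real_of_int \<lfloor>real (Suc n) * fst p\<rfloor> \<le> real (Suc n) * fst p" by linarith
    then show "g n p \<le> fst p"
      by (simp add: g_def divide_le_eq mult.commute del: of_nat_Suc)
  qed
  note bounds = this
  have lim: "(\<lambda>n. g n p) \<longlonglongrightarrow> fst p" for p
  proof (rule tendsto_sandwich)
    show "(\<lambda>n. fst p - 1 / real (Suc n)) \<longlonglongrightarrow> fst p" by real_asymp
    show "\<forall>\<^sub>F n in sequentially. fst p - 1 / real (Suc n) \<le> g n p"
      "\<forall>\<^sub>F n in sequentially. g n p \<le> fst p"
      using bounds by (intro always_eventually allI; blast)+
  qed simp
  show ?thesis
  proof (rule borel_measurable_LIMSEQ_real[where u = "\<lambda>n p. Y (max 0 (g n p)) (snd p)"])
    fix p :: "real \<times> 'w" assume "p \<in> space (lborel \<Otimes>\<^sub>M M)"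
    then have w: "snd p \<in> space M" by (auto simp: space_pair_measure)
    have "(\<lambda>n. max 0 (g n p)) \<longlonglongrightarrow> max 0 (fst p)" by (intro tendsto_max tendsto_const lim)
    from continuous_on_tendsto_compose[OF cont[OF w] this]
    show "(\<lambda>n. Y (max 0 (g n p)) (snd p)) \<longlonglongrightarrow> (case p of (s, w) \<Rightarrow> Y (max 0 s) w)"
      by (simp add: split_beta)
  next
    fix n
    have m: "(\<lambda>p. Y (max 0 (real_of_int k / real (Suc n))) (snd p)) \<in> borel_measurable (lborel \<Otimes>\<^sub>M M)" for k
      by (rule measurable_compose[OF measurable_snd meas]) simp
    have "(\<lambda>p. \<lfloor>real (Suc n) * fst p\<rfloor>) \<in> measurable (lborel \<Otimes>\<^sub>M M) (count_space UNIV)"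
      by measurable
    then show "(\<lambda>p. Y (max 0 (g n p)) (snd p)) \<in> borel_measurable (lborel \<Otimes>\<^sub>M M)"
      unfolding g_def by (rule measurable_compose_countable[OF m])
  qed
qed

text \<open>The variance of \<open>f\<close> over the time interval is nonnegative.\<close>

lemma integral_square_le:
  fixes f :: "real \<Rightarrow> real"
  assumes f: "continuous_on {0..T} f" and T: "T \<ge> 0"
  shows "(integral {0..T} f)\<^sup>2 \<le> T * integral {0..T} (\<lambda>s. (f s)\<^sup>2)"
proof (cases "T = 0")
  case False
  with T have T0: "T > 0" by simp
  define m where "m = integral {0..T} f / T"
  have i: "(f has_integral (m * T)) {0..T}"
    using integrable_integral[OF integrable_continuous_real[OF f]] T0 by (simp add: m_def)
  have i2: "((\<lambda>s. (f s)\<^sup>2) has_integral integral {0..T} (\<lambda>s. (f s)\<^sup>2)) {0..T}"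
    by (intro integrable_integral integrable_continuous_real continuous_intros f)
  have c: "((\<lambda>s. m\<^sup>2) has_integral (T * m\<^sup>2)) {0..T}"
    using has_integral_const_real[of "m\<^sup>2" 0 T] T by simp
  have "((\<lambda>s. (f s)\<^sup>2 - 2 * m * f s + m\<^sup>2) has_integral
      (integral {0..T} (\<lambda>s. (f s)\<^sup>2) - 2 * m * (m * T) + T * m\<^sup>2)) {0..T}"
    by (intro has_integral_add has_integral_diff has_integral_mult_right i i2 c)
  then have "0 \<le> integral {0..T} (\<lambda>s. (f s)\<^sup>2) - 2 * m * (m * T) + T * m\<^sup>2"
  proof (rule has_integral_nonneg)
    fix s
    have "(f s)\<^sup>2 - 2 * m * f s + m\<^sup>2 = (f s - m)\<^sup>2" by (simp add: power2_eq_square algebra_simps)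
    then show "0 \<le> (f s)\<^sup>2 - 2 * m * f s + m\<^sup>2" by simp
  qed
  then have "T * (m\<^sup>2 * T) \<le> T * integral {0..T} (\<lambda>s. (f s)\<^sup>2)"
    using T by (intro mult_left_mono) (auto simp: power2_eq_square algebra_simps)
  moreover have "integral {0..T} f = m * T" using T0 by (simp add: m_def)
  ultimately show ?thesis by (simp add: power2_eq_square algebra_simps)
qed simp

lemma integrable_square_mult:
  fixes X Y :: "'w \<Rightarrow> real"
  assumes "X \<in> borel_measurable M" "Y \<in> borel_measurable M"
    and "integrable M (\<lambda>w. (X w)\<^sup>2)" "integrable M (\<lambda>w. (Y w)\<^sup>2)"
  shows "integrable M (\<lambda>w. X w * Y w)"
    and "(LINT w|M. \<bar>X w * Y w\<bar>) \<le> (LINT w|M. (X w)\<^sup>2) + (LINT w|M. (Y w)\<^sup>2)"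
proof -
  have le: "\<bar>X w * Y w\<bar> \<le> (X w)\<^sup>2 + (Y w)\<^sup>2" for w
    using sum_squares_bound[of "\<bar>X w\<bar>" "\<bar>Y w\<bar>"] abs_ge_zero[of "X w * Y w"]
    unfolding abs_mult power2_abs by linarith
  have i: "integrable M (\<lambda>w. (X w)\<^sup>2 + (Y w)\<^sup>2)" using assms by simp
  show a: "integrable M (\<lambda>w. X w * Y w)"
    by (rule Bochner_Integration.integrable_bound[OF i]) (use assms le in auto)
  have "(LINT w|M. \<bar>X w * Y w\<bar>) \<le> (LINT w|M. (X w)\<^sup>2 + (Y w)\<^sup>2)"
    using a i le by (intro integral_mono) auto
  then show "(LINT w|M. \<bar>X w * Y w\<bar>) \<le> (LINT w|M. (X w)\<^sup>2) + (LINT w|M. (Y w)\<^sup>2)"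
    using assms by simp
qed

lemma integrable_on_strip:
  fixes f :: "real \<times> 'w \<Rightarrow> real"
  assumes M: "prob_space M" and f: "f \<in> borel_measurable (lborel \<Otimes>\<^sub>M M)"
    and zero: "\<And>s w. s \<notin> {0..T} \<Longrightarrow> f (s, w) = 0"
    and int: "\<And>s. s \<in> {0..T} \<Longrightarrow> integrable M (\<lambda>w. f (s, w))"
    and bound: "\<And>s. s \<in> {0..T} \<Longrightarrow> (LINT w|M. \<bar>f (s, w)\<bar>) \<le> K"
  shows "integrable (lborel \<Otimes>\<^sub>M M) f"
proof -
  interpret prob_space M by (rule M)
  interpret P: pair_sigma_finite lborel M ..
  show ?thesis
  proof (rule P.Fubini_integrable[OF f])
    show "integrable lborel (\<lambda>s. LINT w|M. norm (f (s, w)))"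
    proof (rule integrableI_bounded_set[where A = "{0..T}" and B = K])
      show "(\<lambda>s. LINT w|M. norm (f (s, w))) \<in> borel_measurable lborel"
        using f by (intro borel_measurable_lebesgue_integral) (simp add: split_beta')
    qed (use zero bound in \<open>auto simp: emeasure_lborel_Icc_eq\<close>)
    show "AE s in lborel. integrable M (\<lambda>w. f (s, w))"
    proof (rule AE_I2)
      fix s show "integrable M (\<lambda>w. f (s, w))"
        using int zero by (cases "s \<in> {0..T}") auto
    qed
  qed
qed

text \<open>Fubini's theorem on time and probability space.  Square integrability follows from the Cauchy-Schwarz inequality in
time.\<close>

lemma weighted_time_integral:
  fixes Y :: "real \<Rightarrow> 'w \<Rightarrow> real"
  assumes M: "prob_space M" and Y: "second_order_process M Y"
    and \<phi>: "continuous_on UNIV \<phi>" and T: "T \<ge> 0"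
  defines "J \<equiv> \<lambda>w. integral {0..T} (\<lambda>s. \<phi> s * Y s w)"
  shows "J \<in> borel_measurable M" and "integrable M (\<lambda>w. (J w)\<^sup>2)"
    and "\<lbrakk>Z \<in> borel_measurable M; integrable M (\<lambda>w. (Z w)\<^sup>2)\<rbrakk> \<Longrightarrow>
      (LINT w|M. Z w * J w) = integral {0..T} (\<lambda>s. \<phi> s * (LINT w|M. Z w * Y s w))"
proof -
  interpret prob_space M by (rule M)
  interpret P: pair_sigma_finite lborel M ..
  have Ym: "\<And>t. t \<ge> 0 \<Longrightarrow> Y t \<in> borel_measurable M"
    and Yi: "\<And>t. t \<ge> 0 \<Longrightarrow> integrable M (\<lambda>w. (Y t w)\<^sup>2)"
    and Yc: "\<And>w. w \<in> space M \<Longrightarrow> continuous_on {0..} (\<lambda>t. Y t w)"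
    using Y by (auto simp: second_order_process_def)
  obtain B where B: "\<And>t. t \<in> {0..T} \<Longrightarrow> (LINT w|M. (Y t w)\<^sup>2) \<le> B"
    using Y unfolding second_order_process_def by blast
  have \<phi>m [measurable]: "\<phi> \<in> borel_measurable lborel"
    using borel_measurable_continuous_onI[OF \<phi>] by simp
  note Yj [measurable] = jointly_measurable_process[OF Ym Yc]
  \<comment> \<open>Past times are replaced by time 0, so that the process is defined and continuous on the whole line.\<close>
  define h where "h s w = indicator {0..T} s * (\<phi> s * Y (max 0 s) w)" for s w
  have h0: "h s w = 0" if "s \<notin> {0..T}" for s w using that by (simp add: h_def)
  have h1: "h s w = \<phi> s * Y s w" if "s \<in> {0..T}" for s w using that by (simp add: h_def)
  have Yj': "(\<lambda>p. Y (max 0 (fst p)) (snd p)) \<in> borel_measurable (lborel \<Otimes>\<^sub>M M)"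
    using Yj by (simp add: split_beta')
  have hm [measurable]: "(\<lambda>p. h (fst p) (snd p)) \<in> borel_measurable (lborel \<Otimes>\<^sub>M M)"
    unfolding h_def using Yj' by measurable
  obtain K where K: "\<And>s. s \<in> {0..T} \<Longrightarrow> \<bar>\<phi> s\<bar> \<le> K"
  proof -
    have "compact (\<phi> ` {0..T})"
      by (intro compact_continuous_image continuous_on_subset[OF \<phi>]) auto
    then have "bounded (\<phi> ` {0..T})" by (rule compact_imp_bounded)
    then show ?thesis using that unfolding bounded_iff by (metis imageI real_norm_def)
  qed
  have Jc: "continuous_on {0..T} (\<lambda>s. \<phi> s * Y s w)" if "w \<in> space M" for w
    using that by (intro continuous_intros continuous_on_subset[OF \<phi>] continuous_on_subset[OF Yc]) auto
  have lint: "(LINT s|lborel. indicator {0..T} s * u s) = integral {0..T} u" if "continuous_on {0..T} u" for u :: "real \<Rightarrow> real"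
    using set_borel_integral_eq_integral(2)[OF borel_integrable_atLeastAtMost'[OF that]]
    by (simp add: set_lebesgue_integral_def)
  have Jh: "J w = (LINT s|lborel. h s w)" if "w \<in> space M" for w
    unfolding J_def lint[OF Jc[OF that], symmetric]
    by (rule Bochner_Integration.integral_cong) (auto simp: h_def split: split_indicator)
  have hsq: "(LINT s|lborel. (h s w)\<^sup>2) = integral {0..T} (\<lambda>s. (\<phi> s * Y s w)\<^sup>2)" if "w \<in> space M" for w
    unfolding lint[OF continuous_on_power[OF Jc[OF that]], symmetric]
    by (rule Bochner_Integration.integral_cong) (auto simp: h_def split: split_indicator)
  have hi: "integrable M (\<lambda>w. (h s w)\<^sup>2)" and hb: "(LINT w|M. (h s w)\<^sup>2) \<le> K\<^sup>2 * B"
    if s: "s \<in> {0..T}" for s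
  proof -
    have s0: "s \<ge> 0" using s by simp
    have e: "(h s w)\<^sup>2 = (\<phi> s)\<^sup>2 * (Y s w)\<^sup>2" for w using s by (simp add: h1 power_mult_distrib)
    show "integrable M (\<lambda>w. (h s w)\<^sup>2)" unfolding e using Yi[OF s0] by simp
    have "(\<phi> s)\<^sup>2 \<le> K\<^sup>2" using K[OF s] by (metis abs_le_square_iff abs_of_nonneg abs_ge_zero order_trans)
    then have "(\<phi> s)\<^sup>2 * (LINT w|M. (Y s w)\<^sup>2) \<le> K\<^sup>2 * B"
      using B[OF s] by (intro mult_mono) auto
    then show "(LINT w|M. (h s w)\<^sup>2) \<le> K\<^sup>2 * B" unfolding e by simp
  qed
  have hsm: "h s \<in> borel_measurable M" if "s \<in> {0..T}" for s
    using that Ym[of s] h1[OF that] by (simp add: ext[of "h s" "\<lambda>w. \<phi> s * Y s w"])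
  have i2: "integrable (lborel \<Otimes>\<^sub>M M) (\<lambda>p. (h (fst p) (snd p))\<^sup>2)"
    by (rule integrable_on_strip[OF M, where T = T and K = "K\<^sup>2 * B"]) (use h0 hi hb in auto)
  have "(\<lambda>p. h (snd p) (fst p)) \<in> borel_measurable (M \<Otimes>\<^sub>M lborel)"
    using measurable_compose[OF measurable_pair_swap' hm] by (simp add: split_beta')
  then have "(\<lambda>w. LINT s|lborel. h s w) \<in> borel_measurable M"
    by (intro lborel.borel_measurable_lebesgue_integral) (simp add: split_beta')
  then show Jm: "J \<in> borel_measurable M"
    using Jh by (simp cong: measurable_cong)
  have i3: "integrable M (\<lambda>w. T * (LINT s|lborel. (h s w)\<^sup>2))"
    using P.integrable_snd[of "\<lambda>s w. (h s w)\<^sup>2"] i2 by (simp add: split_beta')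
  show Ji: "integrable M (\<lambda>w. (J w)\<^sup>2)"
  proof (rule Bochner_Integration.integrable_bound[OF i3])
    show "(\<lambda>w. (J w)\<^sup>2) \<in> borel_measurable M" using Jm by simp
    show "AE w in M. norm ((J w)\<^sup>2) \<le> norm (T * (LINT s|lborel. (h s w)\<^sup>2))"
    proof (rule AE_I2)
      fix w assume w: "w \<in> space M"
      have "(J w)\<^sup>2 \<le> T * (LINT s|lborel. (h s w)\<^sup>2)"
        unfolding hsq[OF w] J_def by (rule integral_square_le[OF Jc[OF w] T])
      then show "norm ((J w)\<^sup>2) \<le> norm (T * (LINT s|lborel. (h s w)\<^sup>2))" by simp
    qed
  qed
  show "(LINT w|M. Z w * J w) = integral {0..T} (\<lambda>s. \<phi> s * (LINT w|M. Z w * Y s w))"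
    if Zm: "Z \<in> borel_measurable M" and Zi: "integrable M (\<lambda>w. (Z w)\<^sup>2)"
  proof -
    have "(\<lambda>p. Z (snd p) * h (fst p) (snd p)) \<in> borel_measurable (lborel \<Otimes>\<^sub>M M)"
      using Zm by measurable
    then have i: "integrable (lborel \<Otimes>\<^sub>M M) (\<lambda>p. Z (snd p) * h (fst p) (snd p))"
    proof (rule integrable_on_strip[OF M, where T = T and K = "(LINT w|M. (Z w)\<^sup>2) + K\<^sup>2 * B"])
      fix s assume s: "s \<in> {0..T}"
      note sq = integrable_square_mult[OF Zm hsm[OF s] Zi hi[OF s]]
      show "integrable M (\<lambda>w. Z (snd (s, w)) * h (fst (s, w)) (snd (s, w)))" using sq by simp
      show "(LINT w|M. \<bar>Z (snd (s, w)) * h (fst (s, w)) (snd (s, w))\<bar>) \<le> (LINT w|M. (Z w)\<^sup>2) + K\<^sup>2 * B"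
        using sq(2) hb[OF s] by simp
    qed (simp add: h0)
    then have i': "integrable (lborel \<Otimes>\<^sub>M M) (case_prod (\<lambda>s w. Z w * h s w))"
      by (simp add: split_beta')
    have eq: "(LINT w|M. Z w * h s w) = indicator {0..T} s *\<^sub>R (\<phi> s * (LINT w|M. Z w * Y s w))" for s
    proof (cases "s \<in> {0..T}")
      case True
      have "(LINT w|M. Z w * h s w) = (LINT w|M. \<phi> s * (Z w * Y s w))"
        using True by (simp add: h1 mult_ac)
      then show ?thesis using True by simp
    qed (simp add: h0)
    have "(LINT w|M. Z w * J w) = (LINT w|M. (LINT s|lborel. Z w * h s w))"
      by (rule Bochner_Integration.integral_cong) (simp_all add: Jh)
    also have "\<dots> = (LINT s|lborel. (LINT w|M. Z w * h s w))"
      by (rule P.Fubini_integral[OF i'])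
    also have "\<dots> = (LINT s:{0..T}|lborel. \<phi> s * (LINT w|M. Z w * Y s w))"
      unfolding set_lebesgue_integral_def eq ..
    also have "\<dots> = integral {0..T} (\<lambda>s. \<phi> s * (LINT w|M. Z w * Y s w))"
    proof (rule set_borel_integral_eq_integral(2))
      show "set_integrable lborel {0..T} (\<lambda>s. \<phi> s * (LINT w|M. Z w * Y s w))"
        using P.integrable_fst[OF i'] unfolding set_integrable_def eq .
    qed
    finally show ?thesis .
  qed
qed

lemma white_noise_second_order:
  assumes W: "integrated_white_noise M I W" and i: "i \<in> I"
  shows "second_order_process M (W i)"
proof -
  have "(LINT w|M. (W i t w)\<^sup>2) = t" if "t \<ge> 0" for t
    using W i that unfolding integrated_white_noise_def power2_eq_square by simp
  then have "\<exists>B. \<forall>t\<in>{0..T}. (LINT w|M. (W i t w)\<^sup>2) \<le> B" for T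
    by (intro exI[of _ T]) auto
  then show ?thesis
    using W i unfolding second_order_process_def integrated_white_noise_def by auto
qed

text \<open>Integration by parts in both variables turns the covariance \<open>min r s\<close> into the Dirac kernel; the boundary terms
vanish because \<open>\<psi> 0 = 0\<close>.\<close>

lemma brownian_kernel_integral:
  fixes \<psi> \<psi>' :: "real \<Rightarrow> real"
  assumes d: "\<And>t. (\<psi> has_real_derivative \<psi>' t) (at t)" and \<psi>0: "\<psi> 0 = 0" and T: "T \<ge> 0"
  shows "integral {0..T} (\<lambda>r. \<psi>' (T - r) * integral {0..T} (\<lambda>s. \<psi>' (T - s) * min r s))
       = integral {0..T} (\<lambda>s. (\<psi> s)\<^sup>2)"
proof -
  have cont: "continuous_on A \<psi>" for A
    using d by (meson DERIV_continuous_on has_field_derivative_at_within)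
  have contT: "continuous_on A (\<lambda>s. \<psi> (T - s))" for A
    by (rule continuous_on_compose2[OF cont[of UNIV]]) (auto intro!: continuous_intros)
  have dT: "((\<lambda>s. \<psi> (T - s)) has_real_derivative - \<psi>' (T - s)) (at s within A)" for s A
  proof -
    have "((\<lambda>s. T - s) has_real_derivative - 1) (at s within A)"
      by (auto intro!: derivative_eq_intros)
    from DERIV_chain2[OF d this] show ?thesis by simp
  qed
  define G where "G r = integral {0..r} (\<lambda>s. \<psi> (T - s))" for r
  have dG: "(G has_real_derivative \<psi> (T - s)) (at s within {0..r})" if "s \<in> {0..r}" for s r
    unfolding G_def using that by (intro integral_has_real_derivative contT)
  have inner: "integral {0..T} (\<lambda>s. \<psi>' (T - s) * min r s) = G r" if r: "r \<in> {0..T}" for r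
  proof (rule integral_unique)
    have 1: "((\<lambda>s. \<psi>' (T - s) * min r s) has_integral
        (G r - r * \<psi> (T - r) - (G 0 - 0 * \<psi> (T - 0)))) {0..r}"
      by (rule has_integral_derivative[where F = "\<lambda>s. G s - s * \<psi> (T - s)"])
         (use r in \<open>auto intro!: derivative_eq_intros dG dT simp: min_def\<close>)
    have 2: "((\<lambda>s. \<psi>' (T - s) * min r s) has_integral
        (- r * \<psi> (T - T) - (- r * \<psi> (T - r)))) {r..T}"
      by (rule has_integral_derivative[where F = "\<lambda>s. - r * \<psi> (T - s)"])
         (use r in \<open>auto intro!: derivative_eq_intros dT simp: min_def\<close>)
    have "((\<lambda>s. \<psi>' (T - s) * min r s) has_integral
        (G r - r * \<psi> (T - r) - (G 0 - 0 * \<psi> (T - 0))) + (- r * \<psi> (T - T) - (- r * \<psi> (T - r)))) {0..T}"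
      using r by (intro has_integral_combine[OF _ _ 1 2]) auto
    then show "((\<lambda>s. \<psi>' (T - s) * min r s) has_integral G r) {0..T}"
      by (simp add: \<psi>0 G_def)
  qed
  define P where "P u = integral {0..u} (\<lambda>s. (\<psi> s)\<^sup>2)" for u
  have dP: "(P has_real_derivative (\<psi> u)\<^sup>2) (at u within {0..T})" if "u \<in> {0..T}" for u
    unfolding P_def using that by (intro integral_has_real_derivative continuous_intros cont)
  have dQ: "((\<lambda>r. - P (T - r)) has_real_derivative (\<psi> (T - r))\<^sup>2) (at r within {0..T})"
    if r: "r \<in> {0..T}" for r
  proof -
    have sub: "(\<lambda>r. T - r) ` {0..T} \<subseteq> {0..T}" by auto
    have "((\<lambda>r. T - r) has_real_derivative - 1) (at r within {0..T})"
      by (auto intro!: derivative_eq_intros)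
    from DERIV_image_chain[OF DERIV_subset[OF dP sub] this] r
    have "((\<lambda>r. P (T - r)) has_real_derivative - ((\<psi> (T - r))\<^sup>2)) (at r within {0..T})"
      by (simp add: o_def)
    from DERIV_minus[OF this] show ?thesis by simp
  qed
  have "integral {0..T} (\<lambda>r. \<psi>' (T - r) * integral {0..T} (\<lambda>s. \<psi>' (T - s) * min r s))
      = integral {0..T} (\<lambda>r. \<psi>' (T - r) * G r)"
    by (rule Henstock_Kurzweil_Integration.integral_cong) (simp add: inner)
  also have "\<dots> = (- P (T - T) - \<psi> (T - T) * G T) - (- P (T - 0) - \<psi> (T - 0) * G 0)"
  proof (rule integral_unique, rule has_integral_derivative[OF T])
    fix r assume r: "r \<in> {0..T}"
    show "((\<lambda>r. - P (T - r) - \<psi> (T - r) * G r) has_real_derivative \<psi>' (T - r) * G r) (at r within {0..T})"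
      using DERIV_diff[OF dQ[OF r] DERIV_mult[OF dT dG[OF r]]] by (simp add: power2_eq_square mult_ac)
  qed
  also have "\<dots> = integral {0..T} (\<lambda>s. (\<psi> s)\<^sup>2)" by (simp add: \<psi>0 G_def P_def)
  finally show ?thesis .
qed

lemma square_integrable_sum:
  fixes X :: "'i \<Rightarrow> 'w \<Rightarrow> real"
  assumes "\<And>i. i \<in> I \<Longrightarrow> X i \<in> borel_measurable M"
    and "\<And>i. i \<in> I \<Longrightarrow> integrable M (\<lambda>w. (X i w)\<^sup>2)"
  shows "integrable M (\<lambda>w. (\<Sum>i\<in>I. X i w)\<^sup>2)"
    and "(LINT w|M. (\<Sum>i\<in>I. X i w)\<^sup>2) = (\<Sum>i\<in>I. \<Sum>j\<in>I. LINT w|M. X i w * X j w)"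
proof -
  have e: "(\<Sum>i\<in>I. X i w)\<^sup>2 = (\<Sum>i\<in>I. \<Sum>j\<in>I. X i w * X j w)" for w
    by (simp add: power2_eq_square sum_product)
  have i: "integrable M (\<lambda>w. X i w * X j w)" if "i \<in> I" "j \<in> I" for i j
    using that assms by (intro integrable_square_mult)
  show "integrable M (\<lambda>w. (\<Sum>i\<in>I. X i w)\<^sup>2)"
    unfolding e using i by (intro Bochner_Integration.integrable_sum)
  show "(LINT w|M. (\<Sum>i\<in>I. X i w)\<^sup>2) = (\<Sum>i\<in>I. \<Sum>j\<in>I. LINT w|M. X i w * X j w)"
    unfolding e using i
    by (subst Bochner_Integration.integral_sum, fastforce)
       (auto intro!: sum.cong Bochner_Integration.integral_sum)
qed

text \<open>The Ito isometry for deterministic integrands, in the form obtained by integration by parts: with \<open>\<psi> i 0 = 0\<close> the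
integral below is the Wiener integral of \<open>\<psi> i (T - s)\<close> against \<open>W i\<close>.  Only the covariance of the noise enters.\<close>

lemma white_noise_isometry:
  fixes W :: "'i \<Rightarrow> real \<Rightarrow> 'w \<Rightarrow> real"
  assumes M: "prob_space M" and W: "integrated_white_noise M I W" and fin: "finite I"
    and d: "\<And>i t. i \<in> I \<Longrightarrow> (\<psi> i has_real_derivative \<psi>' i t) (at t)"
    and c: "\<And>i. i \<in> I \<Longrightarrow> continuous_on UNIV (\<psi>' i)"
    and z: "\<And>i. i \<in> I \<Longrightarrow> \<psi> i 0 = 0" and T: "T \<ge> 0"
  defines "U \<equiv> \<lambda>w. \<Sum>i\<in>I. integral {0..T} (\<lambda>s. \<psi>' i (T - s) * W i s w)"
  shows "U \<in> borel_measurable M" and "integrable M (\<lambda>w. (U w)\<^sup>2)"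
    and "(LINT w|M. (U w)\<^sup>2) = (\<Sum>i\<in>I. integral {0..T} (\<lambda>s. (\<psi> i s)\<^sup>2))"
proof -
  define J where "J i w = integral {0..T} (\<lambda>s. \<psi>' i (T - s) * W i s w)" for i w
  have cT: "continuous_on UNIV (\<lambda>s. \<psi>' i (T - s))" if "i \<in> I" for i
    by (rule continuous_on_compose2[OF c[OF that]]) (auto intro!: continuous_intros)
  note wi = weighted_time_integral[OF M white_noise_second_order[OF W] cT T, folded J_def]
  have Jm: "J i \<in> borel_measurable M" and Ji: "integrable M (\<lambda>w. (J i w)\<^sup>2)" if "i \<in> I" for i
    using wi(1,2)[OF that that] by (simp_all add: J_def[abs_def])
  have U: "U = (\<lambda>w. \<Sum>i\<in>I. J i w)" by (simp add: U_def J_def)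
  show "U \<in> borel_measurable M" unfolding U using Jm by simp
  show "integrable M (\<lambda>w. (U w)\<^sup>2)" unfolding U by (rule square_integrable_sum(1)[OF Jm Ji])
  have WJ: "(LINT w|M. W j r w * J i w)
      = (if i = j then integral {0..T} (\<lambda>s. \<psi>' i (T - s) * min r s) else 0)"
    if i: "i \<in> I" and j: "j \<in> I" and r: "r \<ge> 0" for i j r
  proof -
    have "W j r \<in> borel_measurable M" "integrable M (\<lambda>w. (W j r w)\<^sup>2)"
      using W j r by (auto simp: integrated_white_noise_def)
    then have "(LINT w|M. W j r w * J i w)
        = integral {0..T} (\<lambda>s. \<psi>' i (T - s) * (LINT w|M. W j r w * W i s w))"
      using wi(3)[OF i i] by (simp add: J_def[abs_def])
    also have "\<dots> = integral {0..T} (\<lambda>s. \<psi>' i (T - s) * (if i = j then min r s else 0))"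
      using W i j r by (intro Henstock_Kurzweil_Integration.integral_cong)
        (auto simp: integrated_white_noise_def)
    finally show ?thesis by auto
  qed
  have JJ: "(LINT w|M. J i w * J j w) = (if i = j then integral {0..T} (\<lambda>s. (\<psi> i s)\<^sup>2) else 0)"
    if i: "i \<in> I" and j: "j \<in> I" for i j
  proof -
    have "(LINT w|M. J i w * J j w)
        = integral {0..T} (\<lambda>r. \<psi>' j (T - r) * (LINT w|M. J i w * W j r w))"
      using wi(3)[OF j j Jm[OF i] Ji[OF i]] by (simp add: J_def[abs_def])
    also have "\<dots> = integral {0..T} (\<lambda>r. \<psi>' j (T - r) *
        (if i = j then integral {0..T} (\<lambda>s. \<psi>' i (T - s) * min r s) else 0))"
      by (rule Henstock_Kurzweil_Integration.integral_cong) (simp add: WJ[OF i j, symmetric] mult.commute)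
    also have "\<dots> = (if i = j then integral {0..T} (\<lambda>s. (\<psi> i s)\<^sup>2) else 0)"
      using brownian_kernel_integral[OF d[OF i] z[OF i] T] by auto
    finally show ?thesis .
  qed
  have "(LINT w|M. (U w)\<^sup>2) = (\<Sum>i\<in>I. \<Sum>j\<in>I. LINT w|M. J i w * J j w)"
    unfolding U by (rule square_integrable_sum(2)[OF Jm Ji])
  also have "\<dots> = (\<Sum>i\<in>I. \<Sum>j\<in>I. if i = j then integral {0..T} (\<lambda>s. (\<psi> i s)\<^sup>2) else 0)"
    by (intro sum.cong refl JJ)
  also have "\<dots> = (\<Sum>i\<in>I. integral {0..T} (\<lambda>s. (\<psi> i s)\<^sup>2))" using fin by simp
  finally show "(LINT w|M. (U w)\<^sup>2) = (\<Sum>i\<in>I. integral {0..T} (\<lambda>s. (\<psi> i s)\<^sup>2))" .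
qed

text \<open>The initial state need not be independent of the noise, so its correlation with \<open>U\<close> is arbitrary.  It stays
bounded, however, and is multiplied by decaying coefficients.\<close>

lemma second_moment_limit:
  fixes Q :: "'j \<Rightarrow> 'w \<Rightarrow> real" and r :: "'j \<Rightarrow> real \<Rightarrow> real"
  assumes Qm: "\<And>j. j \<in> J \<Longrightarrow> Q j \<in> borel_measurable M"
    and Qi: "\<And>j. j \<in> J \<Longrightarrow> integrable M (\<lambda>w. (Q j w)\<^sup>2)"
    and r: "\<And>j. j \<in> J \<Longrightarrow> (r j \<longlongrightarrow> 0) at_top"
    and Um: "\<And>t. t \<ge> 0 \<Longrightarrow> U t \<in> borel_measurable M"
    and Ui: "\<And>t. t \<ge> 0 \<Longrightarrow> integrable M (\<lambda>w. (U t w)\<^sup>2)"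
    and V: "((\<lambda>t. LINT w|M. (U t w)\<^sup>2) \<longlongrightarrow> V) at_top"
    and Y: "\<And>t w. t \<ge> 0 \<Longrightarrow> w \<in> space M \<Longrightarrow> Y t w = (\<Sum>j\<in>J. r j t * Q j w) + U t w"
  shows "t \<ge> 0 \<Longrightarrow> integrable M (\<lambda>w. (Y t w)\<^sup>2)"
    and "((\<lambda>t. LINT w|M. (Y t w)\<^sup>2) \<longlongrightarrow> V) at_top"
proof -
  define q where "q i j = (LINT w|M. Q i w * Q j w)" for i j
  define u where "u j t = (LINT w|M. Q j w * U t w)" for j t
  define H where "H t w = (\<Sum>j\<in>J. r j t * Q j w)" for t w
  have QU: "integrable M (\<lambda>w. Q j w * U t w)" if "j \<in> J" "t \<ge> 0" for j t
    using that by (intro integrable_square_mult Qm Qi Um Ui)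
  have rQ: "(\<lambda>w. r j t * Q j w) \<in> borel_measurable M" "integrable M (\<lambda>w. (r j t * Q j w)\<^sup>2)"
    if "j \<in> J" for j t
    using Qm[OF that] Qi[OF that] by (simp_all add: power_mult_distrib)
  have H2i: "integrable M (\<lambda>w. (H t w)\<^sup>2)" for t
    unfolding H_def by (rule square_integrable_sum(1)[OF rQ])
  have H2: "(LINT w|M. (H t w)\<^sup>2) = (\<Sum>i\<in>J. \<Sum>j\<in>J. r i t * r j t * q i j)" for t
  proof -
    have "(LINT w|M. (H t w)\<^sup>2) = (\<Sum>i\<in>J. \<Sum>j\<in>J. LINT w|M. r i t * Q i w * (r j t * Q j w))"
      unfolding H_def by (rule square_integrable_sum(2)[OF rQ])
    also have "\<dots> = (\<Sum>i\<in>J. \<Sum>j\<in>J. LINT w|M. (r i t * r j t) * (Q i w * Q j w))"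
      by (simp add: mult_ac)
    finally show ?thesis by (simp add: q_def)
  qed
  have HUe: "H t w * U t w = (\<Sum>j\<in>J. r j t * (Q j w * U t w))" for t w
    by (simp add: H_def sum_distrib_right mult.assoc)
  have HUi: "integrable M (\<lambda>w. H t w * U t w)" if "t \<ge> 0" for t
    unfolding HUe using QU[OF _ that] by (intro Bochner_Integration.integrable_sum) auto
  have HU: "(LINT w|M. H t w * U t w) = (\<Sum>j\<in>J. r j t * u j t)" if "t \<ge> 0" for t
    unfolding HUe u_def using QU[OF _ that] by (subst Bochner_Integration.integral_sum) auto
  have Y2: "(Y t w)\<^sup>2 = (H t w)\<^sup>2 + 2 * (H t w * U t w) + (U t w)\<^sup>2" if "t \<ge> 0" "w \<in> space M" for t w
    using Y[OF that] by (simp add: H_def power2_eq_square algebra_simps)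
  have sumi: "integrable M (\<lambda>w. (H t w)\<^sup>2 + 2 * (H t w * U t w) + (U t w)\<^sup>2)" if "t \<ge> 0" for t
    using H2i HUi[OF that] Ui[OF that] by simp
  show "integrable M (\<lambda>w. (Y t w)\<^sup>2)" if "t \<ge> 0" for t
    using sumi[OF that] by (rule Bochner_Integration.integrable_cong[THEN iffD1, OF refl, rotated])
      (simp add: Y2[OF that])
  have EY: "(LINT w|M. (Y t w)\<^sup>2) = (\<Sum>i\<in>J. \<Sum>j\<in>J. r i t * r j t * q i j)
      + 2 * (\<Sum>j\<in>J. r j t * u j t) + (LINT w|M. (U t w)\<^sup>2)" if "t \<ge> 0" for t
  proof -
    have "(LINT w|M. (Y t w)\<^sup>2) = (LINT w|M. (H t w)\<^sup>2 + 2 * (H t w * U t w) + (U t w)\<^sup>2)"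
      by (rule Bochner_Integration.integral_cong) (simp_all add: Y2[OF that])
    also have "\<dots> = (LINT w|M. (H t w)\<^sup>2) + 2 * (LINT w|M. H t w * U t w) + (LINT w|M. (U t w)\<^sup>2)"
      using H2i HUi[OF that] Ui[OF that] by simp
    finally show ?thesis by (simp add: H2 HU[OF that])
  qed
  have cross: "((\<lambda>t. r j t * u j t) \<longlongrightarrow> 0) at_top" if j: "j \<in> J" for j
  proof (rule Lim_null_comparison)
    have "((\<lambda>t. \<bar>r j t\<bar> * ((LINT w|M. (Q j w)\<^sup>2) + (LINT w|M. (U t w)\<^sup>2)))
        \<longlongrightarrow> \<bar>0\<bar> * ((LINT w|M. (Q j w)\<^sup>2) + V)) at_top"
      by (intro tendsto_intros r j V)
    then show "((\<lambda>t. \<bar>r j t\<bar> * ((LINT w|M. (Q j w)\<^sup>2) + (LINT w|M. (U t w)\<^sup>2))) \<longlongrightarrow> 0) at_top" by simp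
    show "\<forall>\<^sub>F t in at_top. norm (r j t * u j t)
        \<le> \<bar>r j t\<bar> * ((LINT w|M. (Q j w)\<^sup>2) + (LINT w|M. (U t w)\<^sup>2))"
      using eventually_ge_at_top[of "0::real"]
    proof eventually_elim
      case (elim t)
      have "\<bar>LINT w|M. Q j w * U t w\<bar> \<le> (LINT w|M. \<bar>Q j w * U t w\<bar>)"
        using integral_norm_bound[of M "\<lambda>w. Q j w * U t w"] by simp
      also have "\<dots> \<le> (LINT w|M. (Q j w)\<^sup>2) + (LINT w|M. (U t w)\<^sup>2)"
        by (rule integrable_square_mult(2)[OF Qm[OF j] Um[OF elim] Qi[OF j] Ui[OF elim]])
      finally show ?case by (simp add: u_def abs_mult mult_left_mono)
    qed
  qed
  have "((\<lambda>t. (\<Sum>i\<in>J. \<Sum>j\<in>J. r i t * r j t * q i j) + 2 * (\<Sum>j\<in>J. r j t * u j t) + (LINT w|M. (U t w)\<^sup>2))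
     \<longlongrightarrow> (\<Sum>i\<in>J. \<Sum>j\<in>J. 0 * 0 * q i j) + 2 * (\<Sum>j\<in>J. 0) + V) at_top"
    by (intro tendsto_intros r V cross)
  then have "((\<lambda>t. LINT w|M. (Y t w)\<^sup>2)
     \<longlongrightarrow> (\<Sum>i\<in>J. \<Sum>j\<in>J. 0 * 0 * q i j) + 2 * (\<Sum>j\<in>J. 0) + V) at_top"
    by (rule Lim_transform_eventually)
       (use eventually_ge_at_top[of "0::real"] in eventually_elim, simp add: EY)
  then show "((\<lambda>t. LINT w|M. (Y t w)\<^sup>2) \<longlongrightarrow> V) at_top" by simp
qed

section \<open>Per-site variance as a sum over modes\<close>

lemma cas_parseval:
  fixes b :: "int^'d::finite \<Rightarrow> real"
  assumes L: "L > 0" and A: "A \<subseteq> torus L"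
  shows "(\<Sum>l\<in>torus L. (\<Sum>n\<in>A. b n * cas L n l)\<^sup>2) = real (L ^ CARD('d)) * (\<Sum>n\<in>A. (b n)\<^sup>2)"
proof -
  have fin: "finite A" using A finite_card_torus(1) by (rule finite_subset)
  have "(\<Sum>l\<in>torus L. (\<Sum>n\<in>A. b n * cas L n l)\<^sup>2)
      = (\<Sum>l\<in>torus L. \<Sum>n\<in>A. \<Sum>m\<in>A. b n * b m * (cas L l n * cas L l m))"
    by (simp add: power2_eq_square sum_product cas_commute[of L _ l for l] mult_ac)
  also have "\<dots> = (\<Sum>n\<in>A. \<Sum>l\<in>torus L. \<Sum>m\<in>A. b n * b m * (cas L l n * cas L l m))"
    by (rule sum.swap)
  also have "\<dots> = (\<Sum>n\<in>A. \<Sum>m\<in>A. \<Sum>l\<in>torus L. b n * b m * (cas L l n * cas L l m))"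
    by (intro sum.cong refl sum.swap)
  also have "\<dots> = (\<Sum>n\<in>A. \<Sum>m\<in>A. if n = m then b n * b m * real (L ^ CARD('d)) else 0)"
  proof (intro sum.cong refl)
    fix n m assume "n \<in> A" "m \<in> A"
    then have "n \<in> torus L" "m \<in> torus L" using A by auto
    then show "(\<Sum>l\<in>torus L. b n * b m * (cas L l n * cas L l m))
        = (if n = m then b n * b m * real (L ^ CARD('d)) else 0)"
      by (simp add: cas_orthogonal[OF L] flip: sum_distrib_left)
  qed
  also have "\<dots> = real (L ^ CARD('d)) * (\<Sum>n\<in>A. (b n)\<^sup>2)"
    using fin by (simp add: sum_distrib_left power2_eq_square mult_ac)
  finally show ?thesis .
qed

lemma integrated_white_noise_subset:
  "integrated_white_noise M I W \<Longrightarrow> J \<subseteq> I \<Longrightarrow> integrated_white_noise M J W"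
  unfolding integrated_white_noise_def by blast

lemma UNIV_channel: "(UNIV :: channel set) = {Disturbance, Measurement}"
  using channel.exhaust by auto

lemma sum_integral:
  fixes h :: "'k \<Rightarrow> real \<Rightarrow> real"
  assumes "\<And>k. k \<in> K \<Longrightarrow> continuous_on {0..t} (h k)"
  shows "(\<Sum>k\<in>K. b k * integral {0..t} (h k)) = integral {0..t} (\<lambda>s. \<Sum>k\<in>K. b k * h k s)"
proof (cases "finite K")
  case True
  have "integral {0..t} (\<lambda>s. \<Sum>k\<in>K. b k * h k s) = (\<Sum>k\<in>K. integral {0..t} (\<lambda>s. b k * h k s))"
    using True assms
    by (intro integral_sum integrable_continuous_real continuous_intros) auto
  then show ?thesis by simp
qed simp

definition hartley ::
  "nat \<Rightarrow> ('d::finite, 'w) process \<Rightarrow> int^'d \<Rightarrow> 'd \<Rightarrow> real \<Rightarrow> 'w \<Rightarrow> real" where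
  "hartley L u n i t w = (\<Sum>k\<in>torus L. cas L n k * u k t w $ i)"

text \<open>The symbol of the inner product of the local error with itself.\<close>

definition laplace_symbol :: "nat \<Rightarrow> int^'d::finite \<Rightarrow> real" where
  "laplace_symbol L n = (\<Sum>i\<in>UNIV. 2 * (1 - cos (phase L n (axis i 1))))"

text \<open>Negativity of the three symbols away from frequency 0 makes every mode other than the network average asymptotically
stable.\<close>

locale controlled_network =
  fixes M :: "'w measure" and L q :: nat and c \<epsilon> :: real and f g a :: "'d::finite array"
    and W :: "channel \<times> (int^'d) \<times> 'd \<Rightarrow> real \<Rightarrow> 'w \<Rightarrow> real" and z x v :: "('d, 'w) process"
  assumes system: "noisy_integral_control M L c \<epsilon> f g a W z x v"
    and local: "local_array q f" "local_array q g" "local_array q a"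
    and symmetric: "reflection_symmetric f" "reflection_symmetric g" "reflection_symmetric a"
    and L: "2 * q < L" and c: "c > 0"
    and negative: "\<And>n. n \<in> torus L \<Longrightarrow> n \<noteq> 0 \<Longrightarrow> torus_symbol L f n < 0"
      "\<And>n. n \<in> torus L \<Longrightarrow> n \<noteq> 0 \<Longrightarrow> torus_symbol L g n < 0"
      "\<And>n. n \<in> torus L \<Longrightarrow> n \<noteq> 0 \<Longrightarrow> torus_symbol L a n < 0"
begin

abbreviation "\<alpha> n \<equiv> - torus_symbol L a n"
abbreviation "\<phi> n \<equiv> - torus_symbol L f n"
abbreviation "\<gamma> n \<equiv> - torus_symbol L g n"

definition noise_mode :: "channel \<Rightarrow> int^'d \<Rightarrow> 'd \<Rightarrow> real \<Rightarrow> 'w \<Rightarrow> real" where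
  "noise_mode ch n i t w = (\<Sum>k\<in>torus L. cas L n k * W (ch, k, i) t w)"

definition steady_variance :: "int^'d \<Rightarrow> real" where
  "steady_variance n = mode_variance c \<epsilon> (\<alpha> n) (\<phi> n) (\<gamma> n)"

lemma L_pos: "L > 0" using L by simp

lemma white: "integrated_white_noise M (UNIV \<times> torus L \<times> UNIV) W"
  and M: "prob_space M"
  using system by (auto simp: noisy_integral_control_def)

lemma continuous_states:
  assumes "w \<in> space M" "k \<in> torus L"
  shows "continuous_on {0..} (\<lambda>t. z k t w)" "continuous_on {0..} (\<lambda>t. x k t w)"
    "continuous_on {0..} (\<lambda>t. v k t w)"
  using system assms by (auto simp: noisy_integral_control_def continuous_process_def)

lemma continuous_hartley:
  assumes "w \<in> space M"
  shows "continuous_on {0..} (\<lambda>t. hartley L z n i t w)" "continuous_on {0..} (\<lambda>t. hartley L x n i t w)"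
    "continuous_on {0..} (\<lambda>t. hartley L v n i t w)"
  unfolding hartley_def
  by (intro continuous_intros continuous_on_component continuous_states assms; assumption)+

lemma conv_component: "conv L h u k $ i = (\<Sum>l\<in>torus L. h (centred L (k - l)) * u l $ i)"
  by (simp add: conv_def)

lemma hartley_conv:
  assumes "local_array q h" "reflection_symmetric h"
  shows "(\<Sum>k\<in>torus L. cas L n k * conv L h (\<lambda>l. u l s w) k $ i) = torus_symbol L h n * hartley L u n i s w"
  unfolding conv_component hartley_def by (rule cas_eigenfunction[OF assms L])

text \<open>Deterministic linear operations on the nodes commute with time integration.\<close>

lemma hartley_integral_equation:
  assumes u: "\<And>k. k \<in> torus L \<Longrightarrow> u k t w = u k 0 w + integral {0..t} (h k) + (\<chi> i. e k i)"
    and h: "\<And>k. k \<in> torus L \<Longrightarrow> continuous_on {0..t} (h k)"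
  shows "hartley L u n i t w = hartley L u n i 0 w
    + integral {0..t} (\<lambda>s. \<Sum>k\<in>torus L. cas L n k * h k s $ i) + (\<Sum>k\<in>torus L. cas L n k * e k i)"
proof -
  have "u k t w $ i = u k 0 w $ i + integral {0..t} (\<lambda>s. h k s $ i) + e k i" if "k \<in> torus L" for k
    using u[OF that] integral_component_eq_cart[OF integrable_continuous_real[OF h[OF that]]] by simp
  then have "hartley L u n i t w = (\<Sum>k\<in>torus L.
      cas L n k * (u k 0 w $ i + integral {0..t} (\<lambda>s. h k s $ i) + e k i))"
    unfolding hartley_def by (intro sum.cong) simp_all
  also have "\<dots> = hartley L u n i 0 w + (\<Sum>k\<in>torus L. cas L n k * integral {0..t} (\<lambda>s. h k s $ i))
      + (\<Sum>k\<in>torus L. cas L n k * e k i)"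
    by (simp add: hartley_def distrib_left sum.distrib)
  finally show ?thesis by (simp add: sum_integral continuous_on_component h)
qed

lemma mode_equations:
  assumes w: "w \<in> space M" and t: "t \<ge> 0"
  shows "hartley L z n i t w = hartley L z n i 0 w
      + integral {0..t} (\<lambda>s. - \<alpha> n * hartley L z n i s w - c * hartley L v n i s w)
      + (- (c * \<epsilon>) * noise_mode Measurement n i t w)" (is ?z)
    and "hartley L x n i t w = hartley L x n i 0 w + integral {0..t} (\<lambda>s. hartley L v n i s w)" (is ?x)
    and "hartley L v n i t w = hartley L v n i 0 w
      + integral {0..t} (\<lambda>s. hartley L z n i s w - \<phi> n * hartley L x n i s w - \<gamma> n * hartley L v n i s w)
      + noise_mode Disturbance n i t w" (is ?v)
proof -
  have ct: "continuous_on {0..t} (\<lambda>s. z k s w)" "continuous_on {0..t} (\<lambda>s. x k s w)"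
    "continuous_on {0..t} (\<lambda>s. v k s w)" if "k \<in> torus L" for k
    using continuous_states[OF w that] by (auto intro: continuous_on_subset)
  have cc: "continuous_on {0..t} (\<lambda>s. conv L h (\<lambda>l. u l s w) k)"
    if "\<And>l. l \<in> torus L \<Longrightarrow> continuous_on {0..t} (\<lambda>s. u l s w)" for h k and u :: "('d, 'w) process"
    unfolding conv_def using that by (intro continuous_intros) auto
  define hz where "hz k s = conv L a (\<lambda>l. z l s w) k - c *\<^sub>R v k s w" for k s
  define hv where "hv k s = z k s w + conv L f (\<lambda>l. x l s w) k + conv L g (\<lambda>l. v l s w) k" for k s
  have chz: "continuous_on {0..t} (hz k)" and chv: "continuous_on {0..t} (hv k)" if "k \<in> torus L" for k
    unfolding hz_def[abs_def] hv_def[abs_def] using that by (intro continuous_intros cc ct; simp)+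
  have "z k t w = z k 0 w + integral {0..t} (hz k) + (\<chi> i. - (c * \<epsilon>) * W (Measurement, k, i) t w)" (is ?zk)
    and "x k t w = x k 0 w + integral {0..t} (\<lambda>s. v k s w) + (\<chi> i. 0)" (is ?xk)
    and "v k t w = v k 0 w + integral {0..t} (hv k) + (\<chi> i. W (Disturbance, k, i) t w)" (is ?vk)
    if k: "k \<in> torus L" for k
  proof -
    have "z k t w = z k 0 w + integral {0..t} (hz k) - (c * \<epsilon>) *\<^sub>R (\<chi> i. W (Measurement, k, i) t w)
        \<and> x k t w = x k 0 w + integral {0..t} (\<lambda>s. v k s w) \<and> ?vk"
      using system k t w unfolding noisy_integral_control_def hz_def[abs_def] hv_def[abs_def] by blast
    then show ?zk ?xk ?vk by (simp_all add: vec_eq_iff)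
  qed
  note eqs = hartley_integral_equation[of z t w hz "\<lambda>k i. - (c * \<epsilon>) * W (Measurement, k, i) t w", OF this(1) chz]
    hartley_integral_equation[of x t w "\<lambda>k s. v k s w" "\<lambda>k i. 0", OF this(2) ct(3)]
    hartley_integral_equation[of v t w hv "\<lambda>k i. W (Disturbance, k, i) t w", OF this(3) chv]
  have hz: "(\<Sum>k\<in>torus L. cas L n k * hz k s $ i) = - \<alpha> n * hartley L z n i s w - c * hartley L v n i s w" for s
    unfolding hz_def
    by (simp add: right_diff_distrib sum_subtractf hartley_conv[OF local(3) symmetric(3)],
      simp add: hartley_def sum_distrib_left mult_ac)
  have hv: "(\<Sum>k\<in>torus L. cas L n k * hv k s $ i)
      = hartley L z n i s w - \<phi> n * hartley L x n i s w - \<gamma> n * hartley L v n i s w" for s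
    unfolding hv_def
    by (simp add: distrib_left sum.distrib hartley_conv[OF local(1) symmetric(1)]
      hartley_conv[OF local(2) symmetric(2)], simp add: hartley_def)
  show ?z
    using eqs(1)[of n i] by (simp add: hz noise_mode_def sum_distrib_left sum_negf mult_ac)
  show ?x
    using eqs(2)[of n i] by (simp add: hartley_def)
  show ?v
    using eqs(3)[of n i] by (simp add: hv noise_mode_def)
qed

lemma mode_solution:
  assumes p: "adjoint_solution c (\<alpha> n) (\<phi> n) (\<gamma> n) p1 p2 p3" and w: "w \<in> space M" and t: "t \<ge> 0"
  shows "hartley L x n i t w
    = p1 t * hartley L z n i 0 w + p2 t * hartley L x n i 0 w + p3 t * hartley L v n i 0 w
      + integral {0..t} (\<lambda>s. (p3 (t - s) - \<alpha> n * p1 (t - s)) * (- (c * \<epsilon>) * noise_mode Measurement n i s w)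
        + (p2 (t - s) - c * p1 (t - s) - \<gamma> n * p3 (t - s)) * noise_mode Disturbance n i s w)"
  by (rule variation_of_constants[OF p continuous_hartley[OF w] mode_equations[OF w] t])

lemma square_integrable_hartley:
  assumes u: "continuous_process M L u"
  shows "hartley L u n i 0 \<in> borel_measurable M" "integrable M (\<lambda>w. (hartley L u n i 0 w)\<^sup>2)"
proof -
  have m: "(\<lambda>w. cas L n k * u k 0 w $ i) \<in> borel_measurable M" if "k \<in> torus L" for k
  proof -
    have "u k 0 \<in> borel_measurable M" using u that by (simp add: continuous_process_def)
    then have "(\<lambda>w. u k 0 w \<bullet> axis i 1) \<in> borel_measurable M" by measurable
    then show ?thesis by (simp add: inner_axis)
  qed
  have int: "integrable M (\<lambda>w. (cas L n k * u k 0 w $ i)\<^sup>2)" if "k \<in> torus L" for k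
  proof (rule Bochner_Integration.integrable_bound)
    show "integrable M (\<lambda>w. (cas L n k)\<^sup>2 * (norm (u k 0 w))\<^sup>2)"
      using u that by (simp add: continuous_process_def)
    show "(\<lambda>w. (cas L n k * u k 0 w $ i)\<^sup>2) \<in> borel_measurable M" using m[OF that] by simp
    have "(u k 0 w $ i)\<^sup>2 \<le> (norm (u k 0 w))\<^sup>2" for w
      using component_le_norm_cart[of "u k 0 w" i] by (metis abs_le_square_iff abs_norm_cancel)
    then show "AE w in M. norm ((cas L n k * u k 0 w $ i)\<^sup>2) \<le> norm ((cas L n k)\<^sup>2 * (norm (u k 0 w))\<^sup>2)"
      by (simp add: power_mult_distrib mult_left_mono)
  qed
  show "hartley L u n i 0 \<in> borel_measurable M"
    unfolding hartley_def[abs_def] by (rule borel_measurable_sum) (rule m)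
  show "integrable M (\<lambda>w. (hartley L u n i 0 w)\<^sup>2)"
    unfolding hartley_def by (rule square_integrable_sum(1)[OF m int])
qed

lemma continuous_processes:
  "continuous_process M L z" "continuous_process M L x" "continuous_process M L v"
  using system by (auto simp: noisy_integral_control_def)

lemmas initial_square_integrable = continuous_processes[THEN square_integrable_hartley(1)]
  continuous_processes[THEN square_integrable_hartley(2)]

text \<open>Outputs that do not see the network average.  The modes are driven by uncorrelated noises, so their contributions
to the stationary variance add up.  Here this appears as Parseval's identity for the kernels \<open>\<psi>\<close> with
which the output responds to the noise at the individual nodes.\<close>

lemma mode_output_limit:
  fixes b :: "int^'d \<Rightarrow> real"
  assumes Y: "\<And>t w. t \<ge> 0 \<Longrightarrow> w \<in> space M \<Longrightarrow> Y t w = (\<Sum>n\<in>torus L - {0}. b n * hartley L x n i t w)"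
  shows "t \<ge> 0 \<Longrightarrow> integrable M (\<lambda>w. (Y t w)\<^sup>2)"
    and "((\<lambda>t. LINT w|M. (Y t w)\<^sup>2) \<longlongrightarrow>
      real (L ^ CARD('d)) * (\<Sum>n\<in>torus L - {0}. (b n)\<^sup>2 * steady_variance n)) at_top"
proof -
  let ?A = "torus L - {0 :: int^'d}"
  let ?N = "real (L ^ CARD('d))"
  have fin: "finite ?A" by (simp add: finite_card_torus)
  have pos: "\<alpha> n > 0" "\<phi> n > 0" "\<gamma> n > 0" if "n \<in> ?A" for n using that negative by auto
  have "\<forall>n. \<exists>p. adjoint_solution c (\<alpha> n) (\<phi> n) (\<gamma> n) (fst p) (fst (snd p)) (snd (snd p))"
  proof
    fix n
    obtain p1 p2 p3 where "adjoint_solution c (\<alpha> n) (\<phi> n) (\<gamma> n) p1 p2 p3"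
      using adjoint_solution_exists by blast
    then show "\<exists>p. adjoint_solution c (\<alpha> n) (\<phi> n) (\<gamma> n) (fst p) (fst (snd p)) (snd (snd p))"
      by (intro exI[of _ "(p1, p2, p3)"]) simp
  qed
  from choice[OF this] obtain P where
    P: "\<forall>n. adjoint_solution c (\<alpha> n) (\<phi> n) (\<gamma> n) (fst (P n)) (fst (snd (P n))) (snd (snd (P n)))"
    by blast
  define p1 p2 p3 where "p1 n = fst (P n)" and "p2 n = fst (snd (P n))" and "p3 n = snd (snd (P n))" for n
  have p: "adjoint_solution c (\<alpha> n) (\<phi> n) (\<gamma> n) (p1 n) (p2 n) (p3 n)" for n
    using P by (simp add: p1_def p2_def p3_def)
  define p1' where "p1' n t = p3 n t - \<alpha> n * p1 n t" for n t
  define p3' where "p3' n t = p2 n t - c * p1 n t - \<gamma> n * p3 n t" for n t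
  have dp: "(p1 n has_real_derivative p1' n t) (at t)" "(p3 n has_real_derivative p3' n t) (at t)"
    "(p2 n has_real_derivative (- \<phi> n * p3 n t)) (at t)" for n t
    using p[of n] by (auto simp: adjoint_solution_def p1'_def p3'_def)
  have cp: "continuous_on A (p1 n)" "continuous_on A (p2 n)" "continuous_on A (p3 n)" for A n
    using dp by (meson DERIV_continuous_on has_field_derivative_at_within)+
  have cp': "continuous_on A (p1' n)" "continuous_on A (p3' n)" for A n
    unfolding p1'_def[abs_def] p3'_def[abs_def] by (intro continuous_intros cp)+
  define I where "I = (UNIV :: channel set) \<times> (torus L :: (int^'d) set) \<times> {i}"
  have finI: "finite I" by (simp add: I_def UNIV_channel finite_card_torus)
  have WI: "integrated_white_noise M I W"
    by (rule integrated_white_noise_subset[OF white]) (auto simp: I_def)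
  define \<psi> where "\<psi> j t = (case j of (ch, l, _) \<Rightarrow> \<Sum>n\<in>?A. b n * cas L n l *
      (case ch of Disturbance \<Rightarrow> p3 n t | Measurement \<Rightarrow> - (c * \<epsilon>) * p1 n t))" for j :: "channel \<times> (int^'d) \<times> 'd" and t
  define \<psi>' where "\<psi>' j t = (case j of (ch, l, _) \<Rightarrow> \<Sum>n\<in>?A. b n * cas L n l *
      (case ch of Disturbance \<Rightarrow> p3' n t | Measurement \<Rightarrow> - (c * \<epsilon>) * p1' n t))" for j :: "channel \<times> (int^'d) \<times> 'd" and t
  have d\<psi>: "(\<psi> j has_real_derivative \<psi>' j t) (at t)" for j t
  proof -
    obtain ch l k where j: "j = (ch, l, k)" by (cases j)
    have ch: "((\<lambda>t. case ch of Disturbance \<Rightarrow> p3 n t | Measurement \<Rightarrow> - (c * \<epsilon>) * p1 n t) has_real_derivative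
        (case ch of Disturbance \<Rightarrow> p3' n t | Measurement \<Rightarrow> - (c * \<epsilon>) * p1' n t)) (at t)" for n
      by (cases ch) (simp_all only: channel.case DERIV_cmult dp)
    show ?thesis unfolding \<psi>_def[abs_def] \<psi>'_def j prod.case by (intro DERIV_sum DERIV_cmult ch)
  qed
  have c\<psi>': "continuous_on UNIV (\<psi>' j)" for j
  proof -
    obtain ch l k where j: "j = (ch, l, k)" by (cases j)
    have ch: "continuous_on UNIV (\<lambda>t. case ch of Disturbance \<Rightarrow> p3' n t | Measurement \<Rightarrow> - (c * \<epsilon>) * p1' n t)" for n
      by (cases ch) (simp_all only: channel.case continuous_on_mult_left cp')
    show ?thesis unfolding \<psi>'_def[abs_def] j prod.case
      by (intro continuous_on_sum continuous_on_mult_left ch)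
  qed
  have z\<psi>: "\<psi> j 0 = 0" for j
  proof -
    obtain ch l k where j: "j = (ch, l, k)" by (cases j)
    have "p1 n 0 = 0" "p3 n 0 = 0" for n using p[of n] by (simp_all add: adjoint_solution_def)
    then show ?thesis unfolding \<psi>_def j by (cases ch) simp_all
  qed
  define U where "U t w = (\<Sum>j\<in>I. integral {0..t} (\<lambda>s. \<psi>' j (t - s) * W j s w))" for t w
  note iso = white_noise_isometry[where \<psi> = \<psi> and \<psi>' = \<psi>', OF M WI finI d\<psi> c\<psi>' z\<psi>, folded U_def]
  have split_I: "(\<Sum>j\<in>I. h j) = (\<Sum>l\<in>torus L. h (Disturbance, l, i) + h (Measurement, l, i))" for h :: "_ \<Rightarrow> real"
  proof -
    have "(\<Sum>j\<in>I. h j) = (\<Sum>ch\<in>UNIV. \<Sum>l\<in>torus L. h (ch, l, i))"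
      by (simp add: I_def sum.cartesian_product')
    then show ?thesis by (simp add: UNIV_channel sum.distrib)
  qed
  have EU: "(LINT w|M. (U t w)\<^sup>2)
      = ?N * (\<Sum>n\<in>?A. (b n)\<^sup>2 * integral {0..t} (\<lambda>s. (c * \<epsilon> * p1 n s)\<^sup>2 + (p3 n s)\<^sup>2))" if t: "t \<ge> 0" for t
  proof -
    have c\<psi>: "continuous_on A (\<psi> j)" for A j
      using d\<psi> by (meson DERIV_continuous_on has_field_derivative_at_within)
    have par: "(\<Sum>l\<in>torus L. (\<psi> (Disturbance, l, i) s)\<^sup>2 + (\<psi> (Measurement, l, i) s)\<^sup>2)
        = (\<Sum>n\<in>?A. (?N * (b n)\<^sup>2) * ((c * \<epsilon> * p1 n s)\<^sup>2 + (p3 n s)\<^sup>2))" for s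
    proof -
      have "(\<Sum>l\<in>torus L. (\<psi> (Disturbance, l, i) s)\<^sup>2) = ?N * (\<Sum>n\<in>?A. (b n * p3 n s)\<^sup>2)"
        using cas_parseval[OF L_pos, of ?A "\<lambda>n. b n * p3 n s"] by (simp add: \<psi>_def mult_ac)
      moreover have "(\<Sum>l\<in>torus L. (\<psi> (Measurement, l, i) s)\<^sup>2) = ?N * (\<Sum>n\<in>?A. (b n * (- (c * \<epsilon>) * p1 n s))\<^sup>2)"
        using cas_parseval[OF L_pos, of ?A "\<lambda>n. b n * (- (c * \<epsilon>) * p1 n s)"] by (simp add: \<psi>_def mult_ac)
      ultimately show ?thesis
        by (simp add: sum.distrib sum_distrib_left power_mult_distrib algebra_simps)
    qed
    have "(LINT w|M. (U t w)\<^sup>2) = (\<Sum>j\<in>I. 1 * integral {0..t} (\<lambda>s. (\<psi> j s)\<^sup>2))"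
      using iso(3)[OF t] by simp
    also have "\<dots> = integral {0..t} (\<lambda>s. \<Sum>j\<in>I. 1 * (\<psi> j s)\<^sup>2)"
      by (rule sum_integral) (intro continuous_intros c\<psi>)
    also have "\<dots> = integral {0..t} (\<lambda>s. \<Sum>n\<in>?A. (?N * (b n)\<^sup>2) * ((c * \<epsilon> * p1 n s)\<^sup>2 + (p3 n s)\<^sup>2))"
      by (simp only: mult_1_left split_I par)
    also have "\<dots> = (\<Sum>n\<in>?A. (?N * (b n)\<^sup>2) * integral {0..t} (\<lambda>s. (c * \<epsilon> * p1 n s)\<^sup>2 + (p3 n s)\<^sup>2))"
      by (rule sum_integral[symmetric]) (intro continuous_intros cp)
    finally show ?thesis by (simp add: sum_distrib_left mult.assoc)
  qed
  have "((\<lambda>t. ?N * (\<Sum>n\<in>?A. (b n)\<^sup>2 * integral {0..t} (\<lambda>s. (c * \<epsilon> * p1 n s)\<^sup>2 + (p3 n s)\<^sup>2)))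
      \<longlongrightarrow> ?N * (\<Sum>n\<in>?A. (b n)\<^sup>2 * steady_variance n)) at_top"
    unfolding steady_variance_def
    by (intro tendsto_intros adjoint_solution_energy[OF p c] pos)
  then have lim: "((\<lambda>t. LINT w|M. (U t w)\<^sup>2) \<longlongrightarrow> ?N * (\<Sum>n\<in>?A. (b n)\<^sup>2 * steady_variance n)) at_top"
    by (rule Lim_transform_eventually) (use eventually_ge_at_top[of "0::real"] in eventually_elim, simp add: EU)
  \<comment> \<open>Initial amplitudes and their responses, indexed by mode and by state component 0, 1, 2.\<close>
  define Q where "Q j w = (case j of (n, m) \<Rightarrow> b n *
      (if m = 0 then hartley L z n i 0 w else if m = 1 then hartley L x n i 0 w else hartley L v n i 0 w))"
    for j :: "(int^'d) \<times> nat" and w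
  define r where "r j = (case j of (n, m) \<Rightarrow> if m = 0 then p1 n else if m = 1 then p2 n else p3 n)"
    for j :: "(int^'d) \<times> nat"
  have Qm: "Q j \<in> borel_measurable M" for j
    unfolding Q_def[abs_def] using initial_square_integrable by (cases j) auto
  have Qi: "integrable M (\<lambda>w. (Q j w)\<^sup>2)" for j
  proof -
    obtain n m where j: "j = (n, m)" by (cases j)
    show ?thesis
      unfolding Q_def j
      by (cases "m = 0"; cases "m = 1") (simp_all add: power_mult_distrib initial_square_integrable)
  qed
  have r0: "(r j \<longlongrightarrow> 0) at_top" if "j \<in> ?A \<times> {0, 1, 2}" for j
  proof -
    obtain n m where j: "j = (n, m)" by (cases j)
    then have n: "n \<in> ?A" using that by simp
    show ?thesis using adjoint_solution_decays[OF p c pos[OF n]] by (simp add: r_def j)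
  qed
  have rep: "Y t w = (\<Sum>j\<in>?A \<times> {0, 1, 2}. r j t * Q j w) + U t w" if t: "t \<ge> 0" and w: "w \<in> space M" for t w
  proof -
    have cW: "continuous_on {0..t} (\<lambda>s. W (ch, k, i) s w)" if "k \<in> torus L" for ch k
    proof -
      have "continuous_on {0..} (\<lambda>s. W (ch, k, i) s w)"
        using white that w by (auto simp: integrated_white_noise_def)
      then show ?thesis by (rule continuous_on_subset) auto
    qed
    have cs: "continuous_on A (\<lambda>s. h (t - s))" if "continuous_on UNIV h" for A and h :: "real \<Rightarrow> real"
      by (rule continuous_on_compose2[OF that]) (auto intro!: continuous_intros)
    define G where "G n s = p1' n (t - s) * (- (c * \<epsilon>) * noise_mode Measurement n i s w)
        + p3' n (t - s) * noise_mode Disturbance n i s w" for n s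
    have cG: "continuous_on {0..t} (G n)" for n
      unfolding G_def[abs_def] noise_mode_def
      by (intro continuous_intros cs cp' cW)
    have sol: "hartley L x n i t w = p1 n t * hartley L z n i 0 w + p2 n t * hartley L x n i 0 w
        + p3 n t * hartley L v n i 0 w + integral {0..t} (G n)" for n
      using mode_solution[OF p[of n] w t, of i] unfolding G_def[abs_def] p1'_def p3'_def .
    have "(\<Sum>n\<in>?A. b n * integral {0..t} (G n)) = integral {0..t} (\<lambda>s. \<Sum>n\<in>?A. b n * G n s)"
      by (rule sum_integral) (rule cG)
    also have "(\<lambda>s. \<Sum>n\<in>?A. b n * G n s) = (\<lambda>s. \<Sum>j\<in>I. 1 * (\<psi>' j (t - s) * W j s w))"
    proof
      fix s
      have "(\<Sum>n\<in>?A. b n * G n s) = (\<Sum>n\<in>?A. \<Sum>l\<in>torus L.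
          b n * cas L n l * p3' n (t - s) * W (Disturbance, l, i) s w
          + b n * cas L n l * (- (c * \<epsilon>) * p1' n (t - s)) * W (Measurement, l, i) s w)"
        unfolding G_def noise_mode_def
        by (intro sum.cong refl)
          (simp add: sum.distrib sum_distrib_left sum_subtractf sum_negf algebra_simps)
      also have "\<dots> = (\<Sum>l\<in>torus L. \<Sum>n\<in>?A.
          b n * cas L n l * p3' n (t - s) * W (Disturbance, l, i) s w
          + b n * cas L n l * (- (c * \<epsilon>) * p1' n (t - s)) * W (Measurement, l, i) s w)"
        by (rule sum.swap)
      also have "\<dots> = (\<Sum>j\<in>I. 1 * (\<psi>' j (t - s) * W j s w))"
        unfolding split_I \<psi>'_def by (simp add: sum.distrib sum_distrib_right sum_subtractf sum_negf)
      finally show "(\<Sum>n\<in>?A. b n * G n s) = (\<Sum>j\<in>I. 1 * (\<psi>' j (t - s) * W j s w))" .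
    qed
    also have "integral {0..t} (\<lambda>s. \<Sum>j\<in>I. 1 * (\<psi>' j (t - s) * W j s w))
        = (\<Sum>j\<in>I. 1 * integral {0..t} (\<lambda>s. \<psi>' j (t - s) * W j s w))"
      by (rule sum_integral[symmetric])
         (auto simp: I_def intro!: continuous_intros cs c\<psi>' cW)
    finally have Ueq: "(\<Sum>n\<in>?A. b n * integral {0..t} (G n)) = U t w" by (simp add: U_def)
    have "(\<Sum>j\<in>?A \<times> {0, 1, 2}. r j t * Q j w) = (\<Sum>n\<in>?A. \<Sum>m\<in>{0, 1, 2}. r (n, m) t * Q (n, m) w)"
      by (rule sum.cartesian_product')
    also have "\<dots> = (\<Sum>n\<in>?A. b n * (p1 n t * hartley L z n i 0 w + p2 n t * hartley L x n i 0 w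
        + p3 n t * hartley L v n i 0 w))"
      by (rule sum.cong) (simp_all add: r_def Q_def algebra_simps)
    finally have Heq: "(\<Sum>j\<in>?A \<times> {0, 1, 2}. r j t * Q j w) = (\<Sum>n\<in>?A. b n * (p1 n t * hartley L z n i 0 w
        + p2 n t * hartley L x n i 0 w + p3 n t * hartley L v n i 0 w))" .
    show ?thesis
      unfolding Y[OF t w] Heq Ueq[symmetric] by (simp add: sol distrib_left sum.distrib)
  qed
  have Um: "U t \<in> borel_measurable M" and Ui: "integrable M (\<lambda>w. (U t w)\<^sup>2)" if "t \<ge> 0" for t
    using iso(1,2)[OF that] by simp_all
  show "integrable M (\<lambda>w. (Y t w)\<^sup>2)" if "t \<ge> 0" for t
    by (rule second_moment_limit(1)[where J = "?A \<times> {0, 1, 2}" and Q = Q and r = r and U = U])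
       (assumption | rule Qm Qi r0 Um Ui lim rep that)+
  show "((\<lambda>t. LINT w|M. (Y t w)\<^sup>2) \<longlongrightarrow> ?N * (\<Sum>n\<in>?A. (b n)\<^sup>2 * steady_variance n)) at_top"
    by (rule second_moment_limit(2)[where J = "?A \<times> {0, 1, 2}" and Q = Q and r = r and U = U])
       (assumption | rule Qm Qi r0 Um Ui lim rep)+
qed

text \<open>Mode 0, the network average, is only marginally stable and has to be split off.\<close>

lemma position_deviation:
  assumes k: "k \<in> torus L"
  shows "x k t w $ i = (\<Sum>l\<in>torus L. x l t w $ i) / real (L ^ CARD('d))
    + (\<Sum>n\<in>torus L - {0}. cas L n k / real (L ^ CARD('d)) * hartley L x n i t w)"
proof -
  have z: "(0 :: int^'d) \<in> torus L" using L_pos by (simp add: torus_def)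
  have "x k t w $ i = (\<Sum>n\<in>torus L. cas L n k * hartley L x n i t w) / real (L ^ CARD('d))"
    unfolding hartley_def by (rule cas_inversion[OF L_pos k, of "\<lambda>k. x k t w $ i"])
  also have "(\<Sum>n\<in>torus L. cas L n k * hartley L x n i t w) = (\<Sum>l\<in>torus L. x l t w $ i)
      + (\<Sum>n\<in>torus L - {0}. cas L n k * hartley L x n i t w)"
    by (subst sum.remove[OF finite_card_torus(1) z]) (simp add: cas_def hartley_def)
  finally show ?thesis by (simp add: add_divide_distrib sum_divide_distrib)
qed

lemma steady_sum_odd:
  "(\<Sum>n\<in>torus L - {0}. steady_variance n * sin (phase L n m)) = 0"
proof -
  have z: "(0 :: int^'d) \<in> torus L" using L_pos by (simp add: torus_def)
  have "(\<Sum>n\<in>torus L. steady_variance n * sin (phase L n m)) = 0"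
    by (rule sum_odd_torus[OF L_pos])
       (simp_all add: steady_variance_def torus_symbol_tmod[OF L_pos] torus_symbol_minus)
  then show ?thesis by (subst (asm) sum.remove[OF finite_card_torus(1) z]) simp
qed

text \<open>The initial state is forgotten, hence only the stationary mode variances enter.  The second hypothesis is
where independence of the site has to be shown.\<close>

lemma per_site_variance_from_modes:
  fixes b :: "int^'d \<Rightarrow> 'j \<Rightarrow> int^'d \<Rightarrow> real" and co :: "'j \<Rightarrow> 'd"
  assumes y: "\<And>k t w. k \<in> torus L \<Longrightarrow>
      y k t w \<bullet> y k t w = (\<Sum>j\<in>J. (\<Sum>n\<in>torus L - {0}. b k j n * hartley L x n (co j) t w)\<^sup>2)"
    and V: "\<And>k. k \<in> torus L \<Longrightarrow>
      (\<Sum>j\<in>J. real (L ^ CARD('d)) * (\<Sum>n\<in>torus L - {0}. (b k j n)\<^sup>2 * steady_variance n)) = V"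
  shows "has_per_site_variance M L y V"
  unfolding has_per_site_variance_def
proof (intro ballI conjI allI impI)
  fix k :: "int^'d" assume k: "k \<in> torus L"
  note lim = mode_output_limit[of "\<lambda>t w. \<Sum>n\<in>torus L - {0}. b k j n * hartley L x n (co j) t w" "b k j" "co j" for j,
      OF refl]
  show "integrable M (\<lambda>w. y k t w \<bullet> y k t w)" if "t \<ge> 0" for t
    unfolding y[OF k] using lim(1)[OF that] by (intro Bochner_Integration.integrable_sum)
  have "((\<lambda>t. \<Sum>j\<in>J. LINT w|M. (\<Sum>n\<in>torus L - {0}. b k j n * hartley L x n (co j) t w)\<^sup>2) \<longlongrightarrow> V) at_top"
    unfolding V[OF k, symmetric] by (intro tendsto_sum lim(2))
  then show "((\<lambda>t. LINT w|M. y k t w \<bullet> y k t w) \<longlongrightarrow> V) at_top"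
    by (rule Lim_transform_eventually)
       (use eventually_ge_at_top[of "0::real"] in eventually_elim,
        simp add: y[OF k] lim(1) Bochner_Integration.integral_sum)
qed

lemma global_variance:
  "has_per_site_variance M L (global_error L x)
    (real CARD('d) / real (L ^ CARD('d)) * (\<Sum>n\<in>torus L - {0}. steady_variance n))"
proof (rule per_site_variance_from_modes[where J = "UNIV :: 'd set" and co = "\<lambda>i. i"
      and b = "\<lambda>k i n. cas L n k / real (L ^ CARD('d))"])
  let ?N = "real (L ^ CARD('d))"
  fix k :: "int^'d" assume k: "k \<in> torus L"
  have "global_error L x k t w $ i = (\<Sum>n\<in>torus L - {0}. cas L n k / ?N * hartley L x n i t w)" for i t w
    unfolding global_error_def using position_deviation[OF k, of t w i] by simp
  then show "global_error L x k t w \<bullet> global_error L x k t w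
      = (\<Sum>i\<in>UNIV. (\<Sum>n\<in>torus L - {0}. cas L n k / ?N * hartley L x n i t w)\<^sup>2)" for t w
    by (simp add: inner_vec_def power2_eq_square)
  have "?N * (\<Sum>n\<in>torus L - {0}. (cas L n k / ?N)\<^sup>2 * steady_variance n)
      = ?N * (\<Sum>n\<in>torus L - {0}. (steady_variance n + steady_variance n * sin (phase L n (k + k))) / ?N\<^sup>2)"
    unfolding power_divide power2_eq_square[of "cas L n k" for n] cas_mult
    by (simp add: algebra_simps)
  also have "\<dots> = (\<Sum>n\<in>torus L - {0}. steady_variance n) / ?N"
    unfolding sum_divide_distrib[symmetric] sum.distrib steady_sum_odd using L_pos
    by (simp add: power2_eq_square)
  finally show "(\<Sum>i\<in>(UNIV :: 'd set). ?N * (\<Sum>n\<in>torus L - {0}. (cas L n k / ?N)\<^sup>2 * steady_variance n))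
      = real CARD('d) / ?N * (\<Sum>n\<in>torus L - {0}. steady_variance n)"
    by simp
qed

lemma local_variance:
  "has_per_site_variance M L (local_error L x)
    (real CARD('d) / real (L ^ CARD('d)) * (\<Sum>n\<in>torus L - {0}. steady_variance n * laplace_symbol L n))"
proof (rule per_site_variance_from_modes[where J = "UNIV :: ('d \<times> 'd) set" and co = snd
      and b = "\<lambda>k j n. (cas L n k - cas L n (k - axis (fst j) 1)) / real (L ^ CARD('d))"])
  let ?N = "real (L ^ CARD('d))"
  let ?s = "steady_variance"
  let ?V = "\<lambda>m. \<Sum>n\<in>torus L - {0}. ?s n * (2 * (1 - cos (phase L n (axis m 1))))"
  fix k :: "int^'d" assume k: "k \<in> torus L"
  define l where "l m = k - axis m (1 :: int)" for m :: 'd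
  have pair: "(\<Sum>j\<in>(UNIV :: ('d \<times> 'd) set). h j) = (\<Sum>m\<in>UNIV. \<Sum>i\<in>UNIV. h (m, i))" for h :: "_ \<Rightarrow> real"
    unfolding UNIV_Times_UNIV[symmetric] by (rule sum.cartesian_product')
  have "local_error L x k t w $ m $ i
      = (\<Sum>n\<in>torus L - {0}. (cas L n k - cas L n (l m)) / ?N * hartley L x n i t w)" for m i t w
  proof -
    have "local_error L x k t w $ m $ i = x k t w $ i - x (tmod L (l m)) t w $ i"
      by (simp add: local_error_def l_def)
    also have "\<dots> = (\<Sum>n\<in>torus L - {0}. cas L n k / ?N * hartley L x n i t w)
        - (\<Sum>n\<in>torus L - {0}. cas L n (tmod L (l m)) / ?N * hartley L x n i t w)"
      using position_deviation[OF k, of t w i]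
        position_deviation[OF tmod_in_torus[OF L_pos], of "l m" t w i] by linarith
    finally show ?thesis
      by (simp add: cos_sin_phase_tmod[OF L_pos] sum_subtractf[symmetric] diff_divide_distrib left_diff_distrib)
  qed
  then show "local_error L x k t w \<bullet> local_error L x k t w = (\<Sum>j\<in>UNIV. (\<Sum>n\<in>torus L - {0}.
      (cas L n k - cas L n (k - axis (fst j) 1)) / ?N * hartley L x n (snd j) t w)\<^sup>2)" for t w
    by (simp add: inner_vec_def power2_eq_square pair l_def)
  have s: "?N * (\<Sum>n\<in>torus L - {0}. ((cas L n k - cas L n (l m)) / ?N)\<^sup>2 * ?s n) = ?V m / ?N" for m
  proof -
    have sq: "(cas L n k - cas L n (l m))\<^sup>2 = 2 * (1 - cos (phase L n (axis m 1)))
        + sin (phase L n (k + k)) + sin (phase L n (l m + l m)) - 2 * sin (phase L n (k + l m))" for n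
    proof -
      have "(cas L n k - cas L n (l m))\<^sup>2
          = cas L n k * cas L n k + cas L n (l m) * cas L n (l m) - 2 * (cas L n k * cas L n (l m))"
        by (simp add: power2_eq_square algebra_simps)
      then show ?thesis unfolding cas_mult by (simp add: l_def)
    qed
    have "?N * (\<Sum>n\<in>torus L - {0}. ((cas L n k - cas L n (l m)) / ?N)\<^sup>2 * ?s n)
        = ?N * (\<Sum>n\<in>torus L - {0}. (?s n * (2 * (1 - cos (phase L n (axis m 1))))
          + ?s n * sin (phase L n (k + k)) + ?s n * sin (phase L n (l m + l m))
          - 2 * (?s n * sin (phase L n (k + l m)))) / ?N\<^sup>2)"
      unfolding power_divide sq by (simp add: algebra_simps)
    also have "\<dots> = ?V m / ?N"
      unfolding sum_divide_distrib[symmetric] sum_subtractf sum.distrib sum_distrib_left[symmetric]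
        steady_sum_odd using L_pos by (simp add: power2_eq_square)
    finally show ?thesis .
  qed
  have const: "(\<Sum>m\<in>(UNIV :: 'd set). \<Sum>i\<in>(UNIV :: 'd set). V m / ?N) = real CARD('d) / ?N * (\<Sum>m\<in>UNIV. V m)"
    for V :: "'d \<Rightarrow> real"
    by (simp add: sum_distrib_left)
  have "(\<Sum>m\<in>UNIV. ?V m) = (\<Sum>n\<in>torus L - {0}. ?s n * laplace_symbol L n)"
    unfolding laplace_symbol_def sum_distrib_left by (rule sum.swap)
  then show "(\<Sum>j\<in>(UNIV :: ('d \<times> 'd) set). ?N * (\<Sum>n\<in>torus L - {0}.
      ((cas L n k - cas L n (k - axis (fst j) 1)) / ?N)\<^sup>2 * ?s n))
      = real CARD('d) / ?N * (\<Sum>n\<in>torus L - {0}. ?s n * laplace_symbol L n)"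
    unfolding pair fst_conv l_def[symmetric] s const by simp
qed

end

section \<open>Scaling bounds\<close>

abbreviation freq_sq :: "nat \<Rightarrow> int^'d::finite \<Rightarrow> real" where
  "freq_sq L n \<equiv> (norm (freq L n))\<^sup>2"

text \<open>The Hurwitz determinant \<open>\<Delta>\<close> is of the order of \<open>S = \<alpha> + \<gamma>\<close>, because \<open>c S\<close> is one of its terms and the gains are bounded.
Hence the measurement noise contributes \<open>\<epsilon>\<^sup>2 / (\<alpha> \<phi>)\<close>, of order \<open>\<epsilon>\<^sup>2 / (\<beta> r\<^sup>2)\<close>, and the disturbance contributes \<open>1 / S + \<alpha> / \<phi>\<close>.  The
second of these two terms is always of order \<open>1 / \<beta>\<close>; the first is at most \<open>1 / \<gamma>\<close>, hence of no larger order.\<close>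

lemma mode_variance_bounds:
  fixes \<epsilon> :: real
  assumes c: "c > 0" and \<beta>: "0 < \<beta>" "\<beta> \<le> b" and r: "0 < r" "r \<le> R"
    and A: "A1 > 0" "A1 * r \<le> \<alpha>" "\<alpha> \<le> A2 * r"
    and F: "F1 > 0" "F1 * (\<beta> * r) \<le> \<phi>" "\<phi> \<le> F2 * (\<beta> * r)"
    and G: "G1 > 0" "G1 * \<beta> \<le> \<gamma>" "\<gamma> \<le> G2 * \<beta>"
  defines "D \<equiv> (A2 * R) * (G2 * b) + F2 * (b * R) + c"
  shows "A1 / (2 * D * F2) * (1 / \<beta>) + c\<^sup>2 / (2 * D * A2 * F2) * (\<epsilon>\<^sup>2 / \<beta> * (1 / r ^ 2))
      \<le> mode_variance c \<epsilon> \<alpha> \<phi> \<gamma>" (is ?low)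
    and "mode_variance c \<epsilon> \<alpha> \<phi> \<gamma>
      \<le> (1 / (2 * c * G1) + A2 / (2 * c * F1)) * (1 / \<beta>) + c / (2 * A1 * F1) * (\<epsilon>\<^sup>2 / \<beta> * (1 / r ^ 2))" (is ?up)
proof -
  have \<beta>r: "0 < \<beta> * r" using \<beta> r by simp
  have \<alpha>: "0 < \<alpha>" using mult_pos_pos[OF A(1) r(1)] A(2) by linarith
  have \<phi>: "0 < \<phi>" using mult_pos_pos[OF F(1) \<beta>r] F(2) by linarith
  have \<gamma>: "0 < \<gamma>" using mult_pos_pos[OF G(1) \<beta>(1)] G(2) by linarith
  have A2: "0 < A2" using \<alpha> A(3) r(1) by (metis less_le_trans zero_less_mult_pos2)
  have F2: "0 < F2" using \<phi> F(3) \<beta>r by (metis less_le_trans zero_less_mult_pos2)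
  have G2: "0 < G2" using \<gamma> G(3) \<beta>(1) by (metis less_le_trans zero_less_mult_pos2)
  have bR: "0 < b" "0 < R" using \<beta> r by linarith+
  define S where "S = \<alpha> + \<gamma>"
  define \<Delta> where "\<Delta> = \<alpha> * \<gamma> * S + \<gamma> * \<phi> + c * S"
  have S: "S > 0" "\<gamma> \<le> S" using \<alpha> \<gamma> by (simp_all add: S_def)
  have D: "D > 0" unfolding D_def using A2 F2 G2 bR c by (simp add: add_pos_pos)
  have \<Delta>1: "c * S \<le> \<Delta>" unfolding \<Delta>_def using \<alpha> \<gamma> \<phi> S by simp
  have \<Delta>2: "\<Delta> \<le> D * S"
  proof -
    have a: "\<alpha> \<le> A2 * R" using A(3) r A2 by (meson mult_left_mono order_trans less_imp_le)
    have g: "\<gamma> \<le> G2 * b" using G(3) \<beta> G2 by (meson mult_left_mono order_trans less_imp_le)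
    have "\<beta> * r \<le> b * R" using \<beta> r bR by (intro mult_mono) auto
    then have f: "\<phi> \<le> F2 * (b * R)" using F(3) F2 by (meson mult_left_mono order_trans less_imp_le)
    have "\<alpha> * \<gamma> \<le> (A2 * R) * (G2 * b)" using a g \<alpha> \<gamma> by (intro mult_mono) auto
    then have "\<alpha> * \<gamma> * S \<le> (A2 * R) * (G2 * b) * S" using S by (intro mult_right_mono) auto
    moreover have "\<gamma> * \<phi> \<le> S * (F2 * (b * R))" using S f \<phi> \<gamma> by (intro mult_mono) auto
    ultimately show ?thesis unfolding \<Delta>_def D_def by (simp add: algebra_simps)
  qed
  have \<Delta>: "\<Delta> > 0" using \<Delta>1 mult_pos_pos[OF c S(1)] by linarith
  have ratio: "1 / D \<le> S / \<Delta>" "S / \<Delta> \<le> 1 / c"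
    using \<Delta>1 \<Delta>2 \<Delta> D c by (simp_all add: field_simps)
  have eq: "mode_variance c \<epsilon> \<alpha> \<phi> \<gamma>
      = (c * \<epsilon>)\<^sup>2 / 2 * (1 / (\<alpha> * \<phi>) * (S / \<Delta>)) + (1 / (2 * \<Delta>) + \<alpha> / \<phi> / 2 * (S / \<Delta>))"
    unfolding mode_variance_def S_def[symmetric] \<Delta>_def[symmetric]
    using \<alpha> \<phi> \<Delta> by (simp add: field_simps)
  have prod1: "A1 * F1 * (\<beta> * r\<^sup>2) \<le> \<alpha> * \<phi>"
  proof -
    have "(A1 * r) * (F1 * (\<beta> * r)) \<le> \<alpha> * \<phi>"
      using A F \<alpha> \<beta>r r by (intro mult_mono) auto
    then show ?thesis by (simp add: power2_eq_square mult_ac)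
  qed
  have prod2: "\<alpha> * \<phi> \<le> A2 * F2 * (\<beta> * r\<^sup>2)"
  proof -
    have "\<alpha> * \<phi> \<le> (A2 * r) * (F2 * (\<beta> * r))"
      using A F \<alpha> \<phi> A2 r by (intro mult_mono) auto
    then show ?thesis by (simp add: power2_eq_square mult_ac)
  qed
  have \<beta>r2: "0 < \<beta> * r\<^sup>2" using \<beta> r by simp
  have inv1: "1 / (A2 * F2 * (\<beta> * r\<^sup>2)) \<le> 1 / (\<alpha> * \<phi>)"
    by (rule frac_le) (use prod2 \<alpha> \<phi> in auto)
  have inv2: "1 / (\<alpha> * \<phi>) \<le> 1 / (A1 * F1 * (\<beta> * r\<^sup>2))"
    by (rule frac_le[OF _ _ mult_pos_pos[OF mult_pos_pos[OF A(1) F(1)] \<beta>r2] prod1]) auto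
  have q1: "A1 / (F2 * \<beta>) \<le> \<alpha> / \<phi>"
  proof -
    have "A1 / (F2 * \<beta>) = (A1 * r) / (F2 * (\<beta> * r))" using r by simp
    also have "\<dots> \<le> \<alpha> / \<phi>" using A F \<alpha> \<phi> r by (intro frac_le) auto
    finally show ?thesis .
  qed
  have q2: "\<alpha> / \<phi> \<le> A2 / (F1 * \<beta>)"
  proof -
    have "\<alpha> / \<phi> \<le> (A2 * r) / (F1 * (\<beta> * r))" using A F A2 \<alpha> r \<beta>r by (intro frac_le) auto
    also have "\<dots> = A2 / (F1 * \<beta>)" using r by simp
    finally show ?thesis .
  qed
  have inv3: "1 / (2 * \<Delta>) \<le> 1 / (2 * c * G1 * \<beta>)"
  proof (intro divide_left_mono)
    have "c * (G1 * \<beta>) \<le> c * S" using G(2) S(2) c by (intro mult_left_mono) auto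
    then show "2 * c * G1 * \<beta> \<le> 2 * \<Delta>" using \<Delta>1 by (simp add: mult.assoc)
  qed (use c G \<beta> \<Delta> in auto)
  show ?low
  proof -
    have "1 / (A2 * F2 * (\<beta> * r\<^sup>2)) * (1 / D) \<le> 1 / (\<alpha> * \<phi>) * (S / \<Delta>)"
      using inv1 ratio D \<alpha> \<phi> by (intro mult_mono) auto
    then have "(c * \<epsilon>)\<^sup>2 / 2 * (1 / (A2 * F2 * (\<beta> * r\<^sup>2)) * (1 / D)) \<le> (c * \<epsilon>)\<^sup>2 / 2 * (1 / (\<alpha> * \<phi>) * (S / \<Delta>))"
      by (intro mult_left_mono) auto
    moreover have "A1 / (F2 * \<beta>) / 2 * (1 / D) \<le> \<alpha> / \<phi> / 2 * (S / \<Delta>)"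
      using q1 ratio D \<alpha> \<phi> by (intro mult_mono divide_right_mono) auto
    moreover have "0 \<le> 1 / (2 * \<Delta>)" using \<Delta> by simp
    ultimately have "A1 / (F2 * \<beta>) / 2 * (1 / D) + (c * \<epsilon>)\<^sup>2 / 2 * (1 / (A2 * F2 * (\<beta> * r\<^sup>2)) * (1 / D))
        \<le> mode_variance c \<epsilon> \<alpha> \<phi> \<gamma>"
      unfolding eq by linarith
    moreover have "A1 / (F2 * \<beta>) / 2 * (1 / D) = A1 / (2 * D * F2) * (1 / \<beta>)"
      by (simp add: mult_ac)
    moreover have "(c * \<epsilon>)\<^sup>2 / 2 * (1 / (A2 * F2 * (\<beta> * r\<^sup>2)) * (1 / D))
        = c\<^sup>2 / (2 * D * A2 * F2) * (\<epsilon>\<^sup>2 / \<beta> * (1 / r ^ 2))"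
      by (simp add: power_mult_distrib mult_ac)
    ultimately show ?thesis by (simp only:)
  qed
  show ?up
  proof -
    have "1 / (\<alpha> * \<phi>) * (S / \<Delta>) \<le> 1 / (A1 * F1 * (\<beta> * r\<^sup>2)) * (1 / c)"
      using inv2 ratio A F \<beta>r2 S \<Delta> by (intro mult_mono) auto
    then have "(c * \<epsilon>)\<^sup>2 / 2 * (1 / (\<alpha> * \<phi>) * (S / \<Delta>)) \<le> (c * \<epsilon>)\<^sup>2 / 2 * (1 / (A1 * F1 * (\<beta> * r\<^sup>2)) * (1 / c))"
      by (intro mult_left_mono) auto
    moreover have "\<alpha> / \<phi> / 2 * (S / \<Delta>) \<le> A2 / (F1 * \<beta>) / 2 * (1 / c)"
      using q2 ratio A2 F \<beta> S \<Delta> by (intro mult_mono divide_right_mono) auto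
    ultimately have "mode_variance c \<epsilon> \<alpha> \<phi> \<gamma>
        \<le> (c * \<epsilon>)\<^sup>2 / 2 * (1 / (A1 * F1 * (\<beta> * r\<^sup>2)) * (1 / c)) + (1 / (2 * c * G1 * \<beta>) + A2 / (F1 * \<beta>) / 2 * (1 / c))"
      unfolding eq using inv3 by linarith
    moreover have "(c * \<epsilon>)\<^sup>2 / 2 * (1 / (A1 * F1 * (\<beta> * r\<^sup>2)) * (1 / c)) = c / (2 * A1 * F1) * (\<epsilon>\<^sup>2 / \<beta> * (1 / r ^ 2))"
      using c by (simp add: power2_eq_square mult_ac)
    moreover have "1 / (2 * c * G1 * \<beta>) + A2 / (F1 * \<beta>) / 2 * (1 / c) = (1 / (2 * c * G1) + A2 / (2 * c * F1)) * (1 / \<beta>)"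
      by (simp add: add_divide_distrib mult_ac)
    ultimately show ?thesis by (simp only: add.commute)
  qed
qed

lemma abs_le_supnorm:
  assumes "local_array q f"
  shows "\<bar>f k\<bar> \<le> supnorm f"
proof -
  have "finite (range (\<lambda>k. \<bar>f k\<bar>))"
  proof (rule finite_subset)
    show "range (\<lambda>k. \<bar>f k\<bar>) \<subseteq> insert 0 ((\<lambda>k. \<bar>f k\<bar>) ` {k. f k \<noteq> 0})" by auto
    show "finite (insert 0 ((\<lambda>k. \<bar>f k\<bar>) ` {k. f k \<noteq> 0}))" using finite_support[OF assms] by simp
  qed
  then show ?thesis unfolding supnorm_def by (intro cSUP_upper bdd_above_finite) auto
qed

lemma supnorm_le:
  assumes "\<And>k. \<bar>f k\<bar> \<le> B"
  shows "supnorm f \<le> B"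
  unfolding supnorm_def using assms by (intro cSUP_least) auto

lemma symbol_eq_0_if_supnorm_le_0:
  assumes "local_array q f" "supnorm f \<le> 0"
  shows "symbol f \<theta> = 0"
proof -
  have "f k = 0" for k using abs_le_supnorm[OF assms(1), of k] assms(2) by linarith
  then show ?thesis by (simp add: symbol_def)
qed

text \<open>Without \<open>F\<close> or without \<open>A\<close> the mode matrix is singular: a constant displacement, balanced by the controller state in
the second case, is an equilibrium.\<close>

lemma hurwitz_imp_supnorm_pos:
  fixes f g a :: "'d::finite array"
  assumes h: "closed_loop_hurwitz c f g a" and local: "local_array q f" "local_array q a"
  shows "supnorm f > 0" "supnorm a > 0"
proof -
  define \<theta> :: "real^'d" where "\<theta> = (\<chi> i. 1)"
  have "\<theta> \<in> freq_box" using pi_gt3 by (simp add: freq_box_def \<theta>_def)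
  moreover have "\<theta> \<noteq> 0" by (simp add: \<theta>_def vec_eq_iff)
  ultimately have hw: "hurwitz (symbol_matrix c f g a \<theta>)" using h by (simp add: closed_loop_hurwitz_def)
  have no: "u = 0" if "symbol_matrix c f g a \<theta> *v u = 0" for u
  proof (rule ccontr)
    assume "u \<noteq> 0"
    moreover have "symbol_matrix c f g a \<theta> *v u = 0 *s u" using that by simp
    ultimately have "Re 0 < 0" using hw unfolding hurwitz_def by blast
    then show False by simp
  qed
  show "supnorm f > 0"
  proof (rule ccontr)
    assume "\<not> supnorm f > 0"
    then have "symbol f \<theta> = 0" by (intro symbol_eq_0_if_supnorm_le_0[OF local(1)]) simp
    then have "symbol_matrix c f g a \<theta> *v vector [0, 1, 0] = 0"
      by (simp add: symbol_matrix_def matrix_vector_mult_def vec_eq_iff forall_3 sum_3)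
    from no[OF this] have "(vector [0, 1, 0] :: complex^3) $ 2 = 0" by (simp only: zero_index)
    then show False by simp
  qed
  show "supnorm a > 0"
  proof (rule ccontr)
    assume "\<not> supnorm a > 0"
    then have "symbol a \<theta> = 0" by (intro symbol_eq_0_if_supnorm_le_0[OF local(2)]) simp
    then have "symbol_matrix c f g a \<theta> *v vector [- symbol f \<theta>, 1, 0] = 0"
      by (simp add: symbol_matrix_def matrix_vector_mult_def vec_eq_iff forall_3 sum_3)
    from no[OF this] have "(vector [- symbol f \<theta>, 1, 0] :: complex^3) $ 2 = 0" by (simp only: zero_index)
    then show False by simp
  qed
qed

lemma absolute_gain_le:
  fixes g :: "'d::finite array"
  assumes "local_array q g"
  shows "absolute_gain g \<le> real ((2 * q + 1) ^ CARD('d)) * supnorm g"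
proof -
  have sub: "{k. g k \<noteq> 0} \<subseteq> cube q"
    using local_array_bound[OF assms] by (auto simp: cube_def)
  have nn: "0 \<le> supnorm g" using abs_le_supnorm[OF assms, of 0] by linarith
  have "absolute_gain g \<le> \<bar>array_sum g\<bar>" by (simp add: absolute_gain_def)
  also have "\<dots> \<le> (\<Sum>k | g k \<noteq> 0. \<bar>g k\<bar>)" unfolding array_sum_def by (rule sum_abs)
  also have "\<dots> \<le> (\<Sum>k | g k \<noteq> 0. supnorm g)" by (intro sum_mono abs_le_supnorm[OF assms])
  also have "\<dots> = real (card {k. g k \<noteq> 0}) * supnorm g" by simp
  also have "\<dots> \<le> real ((2 * q + 1) ^ CARD('d)) * supnorm g"
    using card_mono[OF finite_card_cube(1) sub] nn
    by (intro mult_right_mono) (simp_all only: finite_card_cube(2) of_nat_le_iff)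
  finally show ?thesis .
qed

text \<open>The lower bound is the Taylor bound for \<open>|x| \<le> 1\<close> and monotonicity of the cosine beyond; the constant is not sharp.\<close>

lemma one_minus_cos_bounds:
  fixes x :: real
  assumes "\<bar>x\<bar> \<le> pi"
  shows "x\<^sup>2 / 20 \<le> 2 * (1 - cos x)" "2 * (1 - cos x) \<le> x\<^sup>2"
proof -
  have half: "1 - cos x = 2 * (sin (x / 2))\<^sup>2" for x :: real
    using cos_double_sin[of "x / 2"] by simp
  have "\<bar>sin (x / 2)\<bar> \<le> \<bar>x / 2\<bar>" by (rule abs_sin_x_le_abs_x)
  then have "(sin (x / 2))\<^sup>2 \<le> (x / 2)\<^sup>2" by (rule abs_le_square_iff[THEN iffD1])
  then show "2 * (1 - cos x) \<le> x\<^sup>2" unfolding half by (simp add: power_divide)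
  have small: "y\<^sup>2 * (11 / 12) \<le> 2 * (1 - cos y)" if y: "\<bar>y\<bar> \<le> 1" for y :: real
  proof -
    obtain t where t: "cos y = (\<Sum>m<4. cos_coeff m * y ^ m) + cos (t + 1 / 2 * real 4 * pi) / fact 4 * y ^ 4"
      using Maclaurin_cos_expansion[of y 4] by blast
    have "{..<4 :: nat} = {0, 1, 2, 3}" by auto
    then have "(\<Sum>m<4. cos_coeff m * y ^ m) = 1 - y\<^sup>2 / 2"
      by (simp add: cos_coeff_def)
    moreover have "cos (t + 1 / 2 * real 4 * pi) / fact 4 * y ^ 4 \<le> 1 / 24 * y ^ 4"
      by (intro mult_right_mono) (auto simp: fact_numeral)
    ultimately have "cos y \<le> 1 - y\<^sup>2 / 2 + y ^ 4 / 24" using t by simp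
    moreover have "y ^ 4 \<le> y\<^sup>2"
    proof -
      have "y\<^sup>2 \<le> 1" using y by (simp add: abs_square_le_1)
      then have "y\<^sup>2 * y\<^sup>2 \<le> y\<^sup>2 * 1" by (intro mult_left_mono) auto
      then show ?thesis by (simp flip: power_add)
    qed
    ultimately show ?thesis by simp
  qed
  show "x\<^sup>2 / 20 \<le> 2 * (1 - cos x)"
  proof (cases "\<bar>x\<bar> \<le> 1")
    case True
    then show ?thesis using small[OF True] zero_le_power2[of x] by linarith
  next
    case False
    have "cos \<bar>x\<bar> \<le> cos 1" using False assms by (intro cos_monotone_0_pi_le) auto
    then have "11 / 12 \<le> 2 * (1 - cos x)" using small[of 1] by simp
    moreover have "x\<^sup>2 \<le> 4\<^sup>2"
      using assms pi_less_4 abs_le_square_iff[of x 4] by simp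
    ultimately show ?thesis by simp
  qed
qed

lemma norm_freq_sq: "freq_sq L n = (2 * pi / real L)\<^sup>2 * sqnorm (centred L n)"
  by (simp add: freq_def norm_vec_def L2_set_def sqnorm_def sum_nonneg sum_distrib_left
      sum_divide_distrib power_mult_distrib power_divide mult_ac)

lemma norm_freq_sq_le:
  fixes n :: "int^'d::finite"
  assumes "L > 0"
  shows "freq_sq L n \<le> real CARD('d) * pi\<^sup>2"
proof -
  have "(freq L n $ i)\<^sup>2 \<le> pi\<^sup>2" for i
    using abs_le_square_iff[of "freq L n $ i" pi] abs_freq_le[OF assms, of n i] by simp
  then have "(\<Sum>i\<in>UNIV. (freq L n $ i)\<^sup>2) \<le> (\<Sum>i\<in>(UNIV :: 'd set). pi\<^sup>2)" by (intro sum_mono)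
  then show ?thesis by (simp add: norm_vec_def L2_set_def sum_nonneg)
qed

lemma frequency_sum_bounds:
  fixes j :: nat
  assumes "L \<ge> 4"
  defines "d \<equiv> CARD('d::finite)"
  defines "S \<equiv> (\<Sum>n\<in>torus L - {0 :: int^'d}. 1 / freq_sq L n ^ j) / real (L ^ d)"
  shows "1 / ((2 * pi) ^ (2 * j) * (2 * real d * 4 ^ d * real d ^ j)) * lattice_scaling d j L \<le> S" (is ?low)
    and "S \<le> 4 * real d * 3 ^ (d - 1) / (2 * pi) ^ (2 * j) * lattice_scaling d j L" (is ?up)
proof -
  have L: "L > 0" using assms by simp
  define C :: "(int^'d) set" where "C = centred L ` torus L"
  have inj: "inj_on (centred L) (torus L :: (int^'d) set)"
    by (rule inj_on_inverseI[where g = "tmod L"]) (simp add: tmod_torus)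
  have c0: "centred L 0 = (0 :: int^'d)"
    by (rule centred_id) (use L in auto)
  have z: "(0 :: int^'d) \<in> torus L" using L by (simp add: torus_def)
  have C1: "cube ((L - 1) div 2) \<subseteq> C"
  proof
    fix m :: "int^'d" assume m: "m \<in> cube ((L - 1) div 2)"
    have "centred L m = m"
    proof (rule centred_id)
      fix i
      have "\<bar>m $ i\<bar> \<le> int ((L - 1) div 2)" using m by (simp add: cube_def)
      then show "- int (L div 2) \<le> m $ i" "m $ i < int L - int (L div 2)" using L by linarith+
    qed
    then have "m = centred L (tmod L m)" by simp
    then show "m \<in> C" unfolding C_def using tmod_in_torus[OF L] by blast
  qed
  have C2: "C \<subseteq> cube (L div 2)"
  proof
    fix m assume "m \<in> C"
    then obtain n where n: "m = centred L n" by (auto simp: C_def)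
    have "\<bar>m $ i\<bar> \<le> int (L div 2)" for i
      using centred_bounds[OF L, of n i] unfolding n by linarith
    then show "m \<in> cube (L div 2)" by (simp add: cube_def)
  qed
  have img: "centred L ` (torus L - {0 :: int^'d}) = C - {0}"
    unfolding C_def using inj_on_image_set_diff[OF inj, of "torus L" "{0}"] z c0 by simp
  have e: "(\<Sum>n\<in>torus L - {0 :: int^'d}. 1 / sqnorm (centred L n) ^ j) = (\<Sum>m\<in>C - {0}. 1 / sqnorm m ^ j)"
    unfolding img[symmetric] by (rule sum.reindex_cong[symmetric, OF inj_on_subset[OF inj]]) auto
  define P where "P = (2 * pi) ^ (2 * j)"
  have P: "P > 0" by (simp add: P_def)
  have t: "1 / ((2 * pi / real L)\<^sup>2 * s) ^ j = real L ^ (2 * j) / P * (1 / s ^ j)" for s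
    by (simp add: P_def power_mult power_mult_distrib power_divide)
  define T where "T = real L ^ (2 * j) / real L ^ d * (\<Sum>m\<in>C - {0}. 1 / sqnorm m ^ j)"
  define K where "K = 2 * real d * 4 ^ d * real d ^ j"
  define K' where "K' = 4 * real d * 3 ^ (d - 1)"
  have S: "S = T / P"
    unfolding S_def T_def norm_freq_sq t sum_distrib_left[symmetric] e by simp
  have T: "lattice_scaling d j L / K \<le> T" "T \<le> K' * lattice_scaling d j L"
    using lattice_sum_bounds[OF assms(1) C1 C2, of j, folded d_def] by (simp_all add: T_def K_def K'_def)
  show ?low
    unfolding P_def[symmetric] K_def[symmetric] S
    using divide_right_mono[OF T(1), of P] P by (simp add: mult.commute)
  show ?up
    unfolding P_def[symmetric] K'_def[symmetric] S
    using divide_right_mono[OF T(2), of P] P by simp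
qed

text \<open>The uniform constants: in the gain class all bounds on the three symbols depend on \<open>\<kappa>\<close>, \<open>q\<close>, the dimension and \<open>a\<close> only, apart from
the explicit factor \<open>\<beta>\<close>.\<close>

lemma gain_bounds:
  fixes f g a :: "'d::finite array"
  assumes adm: "admissible_feedback q \<kappa> f g a" and hw: "closed_loop_hurwitz c f g a"
    and gc: "gain_class \<kappa> b f g" and \<kappa>: "\<kappa> \<ge> 1" and L: "2 * q < L"
  defines "\<beta> \<equiv> algorithm_gain f g"
  defines "r \<equiv> \<lambda>n. freq_sq L n"
  shows "0 < \<beta>" "\<beta> \<le> b"
    and "supnorm a / \<kappa> * r n \<le> - torus_symbol L a n" (is ?a1) "- torus_symbol L a n \<le> \<kappa> * supnorm a * r n" (is ?a2)
    and "1 / \<kappa>\<^sup>2 * (\<beta> * r n) \<le> - torus_symbol L f n" (is ?f1) "- torus_symbol L f n \<le> \<kappa> * (\<beta> * r n)" (is ?f2)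
    and "1 / \<kappa> ^ 3 * \<beta> \<le> - torus_symbol L g n" (is ?g1)
    and "- torus_symbol L g n \<le> \<kappa> * real ((2 * q + 1) ^ CARD('d)) * \<beta>" (is ?g2)
proof -
  have L0: "L > 0" using L by simp
  have \<kappa>0: "\<kappa> > 0" using \<kappa> by simp
  have loc: "local_array q f" "local_array q g" "local_array q a" "reflection_symmetric g"
    using adm by (auto simp: admissible_feedback_def)
  have so: "same_order \<kappa> (- torus_symbol L f n) (supnorm f * r n)"
      "same_order \<kappa> (- torus_symbol L a n) (supnorm a * r n)"
      "same_order \<kappa> (- torus_symbol L g n) (absolute_gain g)" for n
    using adm freq_in_box[OF L0, of n] torus_symbol_eq[OF L0, of _ n]
    unfolding admissible_feedback_def r_def by metis+
  have g0: "absolute_gain g > 0" using adm by (simp add: admissible_feedback_def)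
  have f: "supnorm f \<le> \<beta>" "\<beta> / \<kappa> \<le> supnorm f"
    and g: "supnorm g \<le> \<beta>" "\<beta> / \<kappa> \<le> supnorm g" and b: "\<beta> \<le> b"
    using gc \<kappa>0 by (auto simp: gain_class_def \<beta>_def algorithm_gain_def divide_le_eq mult.commute)
  show \<beta>0: "0 < \<beta>" using f hurwitz_imp_supnorm_pos(1)[OF hw loc(1,3)] by linarith
  show "\<beta> \<le> b" by (rule b)
  have r0: "0 \<le> r n" by (simp add: r_def)
  show ?a1 ?a2
    using so(2)[of n] by (simp_all add: same_order_def mult_ac)
  have "\<beta> / \<kappa> * r n / \<kappa> \<le> supnorm f * r n / \<kappa>"
    using f(2) r0 \<kappa>0 by (intro divide_right_mono mult_right_mono) auto
  also have "\<dots> \<le> - torus_symbol L f n" using so(1)[of n] by (simp add: same_order_def)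
  finally show ?f1 by (simp add: power2_eq_square)
  have "- torus_symbol L f n \<le> \<kappa> * (supnorm f * r n)" using so(1)[of n] by (simp add: same_order_def)
  also have "\<dots> \<le> \<kappa> * (\<beta> * r n)" using f(1) r0 \<kappa>0 by (intro mult_left_mono mult_right_mono) auto
  finally show ?f2 .
  have "\<bar>torus_symbol L g m\<bar> \<le> \<kappa> * absolute_gain g" for m
  proof -
    have "0 < absolute_gain g / \<kappa>" using g0 \<kappa>0 by simp
    then show ?thesis using so(3)[of m] unfolding same_order_def by linarith
  qed
  then have "supnorm g \<le> \<kappa> * absolute_gain g"
    by (intro supnorm_le array_bound_from_symbol[OF loc(2,4) L])
  then have "\<beta> / \<kappa> \<le> \<kappa> * absolute_gain g" using g(2) by linarith
  then have "\<beta> / \<kappa> / \<kappa> / \<kappa> \<le> absolute_gain g / \<kappa>"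
    using \<kappa>0 by (intro divide_right_mono) (auto simp: divide_le_eq mult_ac)
  also have "\<dots> \<le> - torus_symbol L g n" using so(3)[of n] by (simp add: same_order_def)
  finally show ?g1 by (simp add: power3_eq_cube)
  have "absolute_gain g \<le> real ((2 * q + 1) ^ CARD('d)) * supnorm g" by (rule absolute_gain_le[OF loc(2)])
  also have "\<dots> \<le> real ((2 * q + 1) ^ CARD('d)) * \<beta>" by (rule mult_left_mono[OF g(1)]) simp
  finally have "\<kappa> * absolute_gain g \<le> \<kappa> * (real ((2 * q + 1) ^ CARD('d)) * \<beta>)"
    using \<kappa>0 by (intro mult_left_mono) auto
  then show ?g2
    using so(3)[of n] unfolding same_order_def mult.assoc by linarith
qed

lemma laplace_symbol_bounds:
  assumes L: "L > 0"
  shows "freq_sq L n / 20 \<le> laplace_symbol L n" "laplace_symbol L n \<le> freq_sq L n"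
proof -
  have "cos (phase L n (axis i 1)) = cos (freq L n $ i)" for i
  proof -
    have "cos (phase L n (axis i 1)) = cos (phase L (tmod L (centred L n)) (axis i 1))"
      by (simp add: cos_sin_phase_tmod(3)[OF L])
    also have "\<dots> = cos (freq L n $ i)"
      unfolding cos_sin_phase_tmod(3)[OF L] by (simp add: phase_axis freq_def)
    finally show ?thesis .
  qed
  then have l: "laplace_symbol L n = (\<Sum>i\<in>UNIV. 2 * (1 - cos (freq L n $ i)))"
    by (simp add: laplace_symbol_def)
  have nrm: "freq_sq L n = (\<Sum>i\<in>UNIV. (freq L n $ i)\<^sup>2)"
    by (simp add: norm_vec_def L2_set_def sum_nonneg)
  show "freq_sq L n / 20 \<le> laplace_symbol L n" "laplace_symbol L n \<le> freq_sq L n"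
    unfolding l nrm sum_divide_distrib using one_minus_cos_bounds[OF abs_freq_le[OF L, of n]] by (auto intro: sum_mono)
qed

text \<open>Its mean over all frequencies is twice the dimension, so a contribution of order \<open>1 / \<beta>\<close> from every mode gives one of
order \<open>1 / \<beta>\<close> to the variance of the local error.\<close>

lemma laplace_symbol_sum:
  assumes L: "L \<ge> 2"
  shows "(\<Sum>n\<in>torus L - {0 :: int^'d::finite}. laplace_symbol L n) = 2 * real CARD('d) * real (L ^ CARD('d))"
proof -
  have L0: "L > 0" using L by simp
  have z: "(0 :: int^'d) \<in> torus L" using L0 by (simp add: torus_def)
  have "tmod L (axis i 1 :: int^'d) $ i = 1" for i
    using L by (simp add: tmod_def axis_def)
  then have ne: "tmod L (axis i 1 :: int^'d) \<noteq> 0" for i by (metis zero_index zero_neq_one)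
  have "(\<Sum>n\<in>(torus L :: (int^'d) set). laplace_symbol L n)
      = (\<Sum>i\<in>(UNIV :: 'd set). \<Sum>n\<in>torus L. 2 * (1 - cos (phase L n (axis i 1))))"
    unfolding laplace_symbol_def by (rule sum.swap)
  also have "\<dots> = (\<Sum>i\<in>(UNIV :: 'd set). 2 * real (L ^ CARD('d)))"
    by (simp add: sum_subtractf sum_cos_torus[OF L0] ne finite_card_torus flip: sum_distrib_left)
  also have "\<dots> = 2 * real CARD('d) * real (L ^ CARD('d))" by simp
  finally show ?thesis
    using sum.remove[OF finite_card_torus(1) z, of "laplace_symbol L"]
    by (simp add: laplace_symbol_def)
qed

text \<open>The factor 1/2 in the lower bound accounts for the omitted frequency 0.\<close>

lemma global_mean_bounds:
  fixes s :: "int^'d::finite \<Rightarrow> real"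
  assumes L: "L \<ge> 2" and nn: "0 \<le> X" "0 \<le> l1"
    and low: "\<And>n. n \<in> torus L - {0} \<Longrightarrow> l1 * X + l2 * (Y * (1 / freq_sq L n ^ 2)) \<le> s n"
    and up: "\<And>n. n \<in> torus L - {0} \<Longrightarrow> s n \<le> u1 * X + u2 * (Y * (1 / freq_sq L n ^ 2))"
    and u1: "0 \<le> u1"
  defines "N \<equiv> real (L ^ CARD('d))"
  defines "S \<equiv> (\<Sum>n\<in>torus L - {0 :: int^'d}. 1 / freq_sq L n ^ 2) / N"
  shows "l1 / 2 * X + l2 * (Y * S) \<le> (\<Sum>n\<in>torus L - {0}. s n) / N" (is ?low)
    and "(\<Sum>n\<in>torus L - {0}. s n) / N \<le> u1 * X + u2 * (Y * S)" (is ?up)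
proof -
  let ?A = "torus L - {0 :: int^'d}"
  have z: "(0 :: int^'d) \<in> torus L" using L by (simp add: torus_def)
  have N2: "N \<ge> 2"
  proof -
    have "2 ^ 1 \<le> L ^ CARD('d)" using L by (intro order_trans[OF power_mono power_increasing]) auto
    then have "real 2 \<le> real (L ^ CARD('d))" by (simp only: of_nat_le_iff power_one_right)
    then show ?thesis by (simp add: N_def)
  qed
  have card: "real (card ?A) = N - 1"
  proof -
    have "card ?A = L ^ CARD('d) - 1" using z by (simp add: finite_card_torus)
    moreover have "1 \<le> L ^ CARD('d)" using L by simp
    ultimately have "real (card ?A) = real (L ^ CARD('d)) - real 1" by (simp only: of_nat_diff)
    then show ?thesis by (simp add: N_def)
  qed
  have eq: "(\<Sum>n\<in>?A. p * X + w * (Y * (1 / freq_sq L n ^ 2))) / N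
      = p * ((N - 1) / N) * X + w * (Y * S)" for p w
    unfolding S_def sum.distrib sum_distrib_left[symmetric] sum_constant card using N2
    by (simp add: add_divide_distrib)
  have "p / 2 * X \<le> p * ((N - 1) / N) * X" "p * ((N - 1) / N) * X \<le> p * X" if p: "0 \<le> p" for p
  proof -
    have "1 / 2 \<le> (N - 1) / N" "(N - 1) / N \<le> 1" using N2 by (simp_all add: field_simps)
    then have "p * (1 / 2) \<le> p * ((N - 1) / N)" and "p * ((N - 1) / N) \<le> p * 1"
      using mult_left_mono[OF _ p] by blast+
    from this[THEN mult_right_mono, OF nn(1)]
    show "p / 2 * X \<le> p * ((N - 1) / N) * X" "p * ((N - 1) / N) * X \<le> p * X" by simp_all
  qed
  note cnt = this(1)[OF nn(2)] this(2)[OF u1]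
  have "(\<Sum>n\<in>?A. l1 * X + l2 * (Y * (1 / freq_sq L n ^ 2))) / N \<le> (\<Sum>n\<in>?A. s n) / N"
    using N2 low by (intro divide_right_mono sum_mono) auto
  then show ?low unfolding eq using cnt by linarith
  have "(\<Sum>n\<in>?A. s n) / N \<le> (\<Sum>n\<in>?A. u1 * X + u2 * (Y * (1 / freq_sq L n ^ 2))) / N"
    using N2 up by (intro divide_right_mono sum_mono) auto
  then show ?up unfolding eq using cnt by linarith
qed

text \<open>The symbol of the local error, of the order of \<open>|\<theta>|\<^sup>2\<close>, cancels one factor \<open>|\<theta>|\<^sup>2\<close> of the singularity.\<close>

lemma local_mean_bounds:
  fixes s :: "int^'d::finite \<Rightarrow> real"
  assumes L: "L \<ge> 2" and nn: "0 \<le> X" "0 \<le> Y" "0 \<le> l1" "0 \<le> l2" "0 \<le> u2"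
    and low: "\<And>n. n \<in> torus L - {0} \<Longrightarrow> l1 * X + l2 * (Y * (1 / freq_sq L n ^ 2)) \<le> s n"
    and up: "\<And>n. n \<in> torus L - {0} \<Longrightarrow> s n \<le> u1 * X + u2 * (Y * (1 / freq_sq L n ^ 2))"
  defines "N \<equiv> real (L ^ CARD('d))"
  defines "S \<equiv> (\<Sum>n\<in>torus L - {0 :: int^'d}. 1 / freq_sq L n ^ 1) / N"
  shows "2 * real CARD('d) * l1 * X + l2 / 20 * (Y * S) \<le> (\<Sum>n\<in>torus L - {0}. s n * laplace_symbol L n) / N" (is ?low)
    and "(\<Sum>n\<in>torus L - {0}. s n * laplace_symbol L n) / N \<le> 2 * real CARD('d) * u1 * X + u2 * (Y * S)" (is ?up)
proof -
  let ?A = "torus L - {0 :: int^'d}"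
  let ?r = "\<lambda>n :: int^'d. freq_sq L n"
  have L0: "L > 0" using L by simp
  have N: "N > 0" using L0 by (simp add: N_def)
  have r: "0 < ?r n" if "n \<in> ?A" for n using that freq_eq_0_iff[OF L0, of n] by simp
  have cancel: "w * (Y * (1 / t ^ 2)) * (t / 20) = w / 20 * (Y * (1 / t ^ 1))"
      "w * (Y * (1 / t ^ 2)) * t = w * (Y * (1 / t ^ 1))" if "0 < t" for w t :: real
    using that by (simp_all add: power2_eq_square)
  have eq: "(\<Sum>n\<in>?A. p * X * laplace_symbol L n + w * (Y * (1 / ?r n ^ 1))) / N
      = 2 * real CARD('d) * p * X + w * (Y * S)" for p w
    unfolding S_def sum.distrib sum_distrib_left[symmetric] laplace_symbol_sum[OF L] N_def[symmetric]
    using N by (simp add: add_divide_distrib)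
  have "l1 * X * laplace_symbol L n + l2 / 20 * (Y * (1 / ?r n ^ 1)) \<le> s n * laplace_symbol L n" if n: "n \<in> ?A" for n
  proof -
    note l = laplace_symbol_bounds[OF L0, of n]
    have "l2 * (Y * (1 / ?r n ^ 2)) * (?r n / 20) \<le> l2 * (Y * (1 / ?r n ^ 2)) * laplace_symbol L n"
      using l nn by (intro mult_left_mono) auto
    moreover have "l2 * (Y * (1 / ?r n ^ 2)) * (?r n / 20) = l2 / 20 * (Y * (1 / ?r n ^ 1))"
      by (rule cancel(1)[OF r[OF n]])
    moreover have "(l1 * X + l2 * (Y * (1 / ?r n ^ 2))) * laplace_symbol L n \<le> s n * laplace_symbol L n"
      using low[OF n] l r[OF n] by (intro mult_right_mono) auto
    ultimately show ?thesis by (simp only: distrib_right)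
  qed
  then have "(\<Sum>n\<in>?A. l1 * X * laplace_symbol L n + l2 / 20 * (Y * (1 / ?r n ^ 1))) / N
      \<le> (\<Sum>n\<in>?A. s n * laplace_symbol L n) / N"
    using N by (intro divide_right_mono sum_mono) auto
  then show ?low
    unfolding eq .
  have "s n * laplace_symbol L n \<le> u1 * X * laplace_symbol L n + u2 * (Y * (1 / ?r n ^ 1))" if n: "n \<in> ?A" for n
  proof -
    note l = laplace_symbol_bounds[OF L0, of n]
    have "u2 * (Y * (1 / ?r n ^ 2)) * laplace_symbol L n \<le> u2 * (Y * (1 / ?r n ^ 2)) * ?r n"
      using l nn by (intro mult_left_mono) auto
    moreover have "u2 * (Y * (1 / ?r n ^ 2)) * ?r n = u2 * (Y * (1 / ?r n ^ 1))"
      by (rule cancel(2)[OF r[OF n]])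
    moreover have "s n * laplace_symbol L n \<le> (u1 * X + u2 * (Y * (1 / ?r n ^ 2))) * laplace_symbol L n"
      using up[OF n] l r[OF n] by (intro mult_right_mono) auto
    ultimately show ?thesis by (simp only: distrib_right)
  qed
  then have "(\<Sum>n\<in>?A. s n * laplace_symbol L n) / N
      \<le> (\<Sum>n\<in>?A. u1 * X * laplace_symbol L n + u2 * (Y * (1 / ?r n ^ 1))) / N"
    using N by (intro divide_right_mono sum_mono) auto
  then show ?up
    unfolding eq .
qed

lemma scaled_bounds:
  fixes X Y S \<sigma> V :: real
  assumes nn: "0 \<le> X" "0 \<le> Y" "0 \<le> \<sigma>" "0 \<le> p1" "0 \<le> p2" "0 \<le> w1" "0 \<le> w2"
    and d: "0 \<le> d" and S: "k * \<sigma> \<le> S" "S \<le> K * \<sigma>"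
    and V: "p1 * X + p2 * (Y * S) \<le> V" "V \<le> w1 * X + w2 * (Y * S)"
    and m: "m \<le> d * p1" "m \<le> d * (p2 * k)" "d * w1 \<le> m'" "d * (w2 * K) \<le> m'"
  shows "m * (X + Y * \<sigma>) \<le> d * V" "d * V \<le> m' * (X + Y * \<sigma>)"
proof -
  have Y\<sigma>: "0 \<le> Y * \<sigma>" using nn by simp
  have YS: "k * (Y * \<sigma>) \<le> Y * S" "Y * S \<le> K * (Y * \<sigma>)"
    using mult_left_mono[OF S(1) nn(2)] mult_left_mono[OF S(2) nn(2)] by (simp_all add: mult_ac)
  have "m * (X + Y * \<sigma>) \<le> (d * p1) * X + (d * (p2 * k)) * (Y * \<sigma>)"
    unfolding distrib_left using m nn Y\<sigma> by (intro add_mono mult_right_mono) auto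
  also have "\<dots> = d * (p1 * X + p2 * (k * (Y * \<sigma>)))" by (simp add: algebra_simps)
  also have "\<dots> \<le> d * (p1 * X + p2 * (Y * S))"
    using YS nn d by (intro mult_left_mono add_left_mono) auto
  also have "\<dots> \<le> d * V" using V d by (intro mult_left_mono) auto
  finally show "m * (X + Y * \<sigma>) \<le> d * V" .
  have "d * V \<le> d * (w1 * X + w2 * (Y * S))" using V d by (intro mult_left_mono) auto
  also have "\<dots> \<le> d * (w1 * X + w2 * (K * (Y * \<sigma>)))"
    using YS nn d by (intro mult_left_mono add_left_mono) auto
  also have "\<dots> = (d * w1) * X + (d * (w2 * K)) * (Y * \<sigma>)" by (simp add: algebra_simps)
  also have "\<dots> \<le> m' * (X + Y * \<sigma>)"
    unfolding distrib_left using m nn Y\<sigma> by (intro add_mono mult_right_mono) auto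
  finally show "d * V \<le> m' * (X + Y * \<sigma>)" .
qed

theorem mainTheorem1:
  fixes a :: "int^'d::finite \<Rightarrow> real" and c\<^sub>o \<kappa> b :: real and q :: nat
  assumes "c\<^sub>o > 0" and "\<kappa> \<ge> 1"
  shows "\<exists>c>0. \<exists>C>0. \<exists>N\<^sub>0::nat. \<forall>(f::int^'d \<Rightarrow> real) (g::int^'d \<Rightarrow> real) (\<beta>::real) (\<epsilon>::real) (L::nat) (N::nat).
    admissible_feedback q \<kappa> f g a \<and> closed_loop_hurwitz c\<^sub>o f g a \<and>
    gain_class \<kappa> b f g \<and> \<beta> = algorithm_gain f g \<and>
    \<epsilon> \<ge> 0 \<and> N = L ^ CARD('d) \<and> N \<ge> N\<^sub>0 \<longrightarrow>
    (\<forall>(M::'w measure) W z x v. noisy_integral_control M L c\<^sub>o \<epsilon> f g a W z x v \<longrightarrow>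
      (\<exists>V. has_per_site_variance M L (local_error L x) V \<and>
           c * (1 / \<beta> + \<epsilon>\<^sup>2 / \<beta> * local_scaling CARD('d) N) \<le> V \<and>
           V \<le> C * (1 / \<beta> + \<epsilon>\<^sup>2 / \<beta> * local_scaling CARD('d) N)) \<and>
      (\<exists>V. has_per_site_variance M L (global_error L x) V \<and>
           c * (1 / \<beta> + \<epsilon>\<^sup>2 / \<beta> * global_scaling CARD('d) N) \<le> V \<and>
           V \<le> C * (1 / \<beta> + \<epsilon>\<^sup>2 / \<beta> * global_scaling CARD('d) N)))"
proof (cases "supnorm a > 0")
  case False
  have "\<not> (admissible_feedback q \<kappa> f g a \<and> closed_loop_hurwitz c\<^sub>o f g a)" for f g
    using False hurwitz_imp_supnorm_pos(2)[of c\<^sub>o f g a q] by (auto simp: admissible_feedback_def)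
  then show ?thesis by (intro exI[of _ "1 :: real"] conjI exI[of _ "0 :: nat"]) auto
next
  case True
  let ?d = "CARD('d)"
  define A where "A = supnorm a"
  \<comment> \<open>For \<open>b \<le> 0\<close> no stabilising operators lie in the gain class; the maximum keeps the constants positive.\<close>
  define B where "B = max b 1"
  define R where "R = real ?d * pi\<^sup>2"
  define Q where "Q = real ((2 * q + 1) ^ ?d)"
  define D where "D = (\<kappa> * A * R) * (\<kappa> * Q * B) + \<kappa> * (B * R) + c\<^sub>o"
  define l1 where "l1 = (A / \<kappa>) / (2 * D * \<kappa>)"
  define l2 where "l2 = c\<^sub>o\<^sup>2 / (2 * D * (\<kappa> * A) * \<kappa>)"
  define u1 where "u1 = 1 / (2 * c\<^sub>o * (1 / \<kappa> ^ 3)) + \<kappa> * A / (2 * c\<^sub>o * (1 / \<kappa>\<^sup>2))"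
  define u2 where "u2 = c\<^sub>o / (2 * (A / \<kappa>) * (1 / \<kappa>\<^sup>2))"
  define k where "k j = 1 / ((2 * pi) ^ (2 * j) * (2 * real ?d * 4 ^ ?d * real ?d ^ j))" for j :: nat
  define K where "K j = 4 * real ?d * 3 ^ (?d - 1) / (2 * pi) ^ (2 * j)" for j :: nat
  have A: "A > 0" using True by (simp add: A_def)
  have \<kappa>: "\<kappa> > 0" using assms by simp
  have R: "R > 0" by (simp add: R_def)
  have B: "B > 0" "b \<le> B" by (simp_all add: B_def)
  have Q: "Q > 0" by (simp add: Q_def)
  have D: "D > 0" unfolding D_def using A \<kappa> R B Q assms by (intro add_pos_pos mult_pos_pos) auto
  have lu: "l1 > 0" "l2 > 0" "u1 > 0" "u2 > 0"
    unfolding l1_def l2_def u1_def u2_def using A \<kappa> D assms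
    by (auto intro!: add_pos_pos divide_pos_pos mult_pos_pos zero_less_power)
  have kK: "k j > 0" "K j > 0" for j by (simp_all add: k_def K_def)
  have d0: "0 < ?d" by simp
  define m where "m = min (min (real ?d * (2 * real ?d * l1)) (real ?d * (l2 / 20 * (k 1 / 2))))
     (min (real ?d * (l1 / 2)) (real ?d * (l2 * (k 2 / 4))))"
  define m' where "m' = max (max (real ?d * (2 * real ?d * u1)) (real ?d * (u2 * K 1)))
     (max (real ?d * u1) (real ?d * (u2 * K 2)))"
  have m: "m > 0" using lu kK by (simp add: m_def)
  have m': "m' > 0" using lu kK by (simp add: m'_def less_max_iff_disj)
  have lm: "m \<le> real ?d * (2 * real ?d * l1)" "m \<le> real ?d * (l2 / 20 * (k 1 / 2))"
      "real ?d * (2 * real ?d * u1) \<le> m'" "real ?d * (u2 * K 1) \<le> m'"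
    and gm: "m \<le> real ?d * (l1 / 2)" "m \<le> real ?d * (l2 * (k 2 / 4))"
      "real ?d * u1 \<le> m'" "real ?d * (u2 * K 2) \<le> m'"
    unfolding m_def m'_def by (simp_all only: min_le_iff_disj le_max_iff_disj order_refl simp_thms)
  show ?thesis
  proof (rule exI[of _ m], rule conjI[OF m], rule exI[of _ m'], rule conjI[OF m'],
      rule exI[of _ "(2 * q + 4) ^ ?d"], intro allI impI conjI)
    fix f g :: "int^'d \<Rightarrow> real" and \<beta> \<epsilon> :: real and L N :: nat
      and M :: "'w measure" and W z x v
    assume H: "admissible_feedback q \<kappa> f g a \<and> closed_loop_hurwitz c\<^sub>o f g a \<and>
      gain_class \<kappa> b f g \<and> \<beta> = algorithm_gain f g \<and> \<epsilon> \<ge> 0 \<and> N = L ^ ?d \<and> N \<ge> (2 * q + 4) ^ ?d"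
      and sys: "noisy_integral_control M L c\<^sub>o \<epsilon> f g a W z x v"
    then have adm: "admissible_feedback q \<kappa> f g a" and hw: "closed_loop_hurwitz c\<^sub>o f g a"
      and gc: "gain_class \<kappa> b f g" and \<beta>: "\<beta> = algorithm_gain f g" and N: "N = L ^ ?d"
      by auto
    \<comment> \<open>The side length exceeds the diameter of the arrays, and it is at least 4, as the lattice sums require.\<close>
    have "\<not> L < 2 * q + 4" using H power_strict_mono[of L "2 * q + 4" ?d] by auto
    then have Lb: "2 * q < L" "L \<ge> 4" "L \<ge> 2" "L > 0" by auto
    note gb = gain_bounds[OF adm hw gc assms(2) Lb(1), folded \<beta> A_def Q_def]
    have r: "0 < freq_sq L n" if "n \<in> torus L - {0 :: int^'d}" for n
      using that freq_eq_0_iff[OF Lb(4), of n] by simp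
    interpret controlled_network M L q c\<^sub>o \<epsilon> f g a W z x v
    proof
      show "noisy_integral_control M L c\<^sub>o \<epsilon> f g a W z x v" by (rule sys)
      show "local_array q f" "local_array q g" "local_array q a"
        "reflection_symmetric f" "reflection_symmetric g" "reflection_symmetric a"
        using adm by (auto simp: admissible_feedback_def)
      show "2 * q < L" "c\<^sub>o > 0" using Lb assms by auto
      fix n :: "int^'d" assume n: "n \<in> torus L" "n \<noteq> 0"
      then have rn: "0 < freq_sq L n" using r by simp
      have "0 < 1 / \<kappa>\<^sup>2 * (\<beta> * freq_sq L n)" using gb(1) rn \<kappa> by (intro mult_pos_pos) auto
      then show "torus_symbol L f n < 0" using gb(5)[of n] by linarith
      have "0 < 1 / \<kappa> ^ 3 * \<beta>" using gb(1) \<kappa> by (intro mult_pos_pos) auto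
      then show "torus_symbol L g n < 0" using gb(7)[of n] by linarith
      have "0 < A / \<kappa> * freq_sq L n" using A rn \<kappa> by (intro mult_pos_pos) auto
      then show "torus_symbol L a n < 0" using gb(3)[of n] by linarith
    qed
    define X where "X = 1 / \<beta>"
    define Y where "Y = \<epsilon>\<^sup>2 / \<beta>"
    have XY: "0 \<le> X" "0 \<le> Y" using gb(1) by (simp_all add: X_def Y_def)
    have bnd: "l1 * X + l2 * (Y * (1 / freq_sq L n ^ 2)) \<le> steady_variance n"
      "steady_variance n \<le> u1 * X + u2 * (Y * (1 / freq_sq L n ^ 2))"
      if n: "n \<in> torus L - {0}" for n
    proof -
      have \<beta>B: "\<beta> \<le> B" using gb(2) B by simp
      have rR: "freq_sq L n \<le> R" unfolding R_def by (rule norm_freq_sq_le[OF Lb(4)])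
      have pos: "0 < A / \<kappa>" "0 < 1 / \<kappa>\<^sup>2" "0 < 1 / \<kappa> ^ 3" using A \<kappa> by simp_all
      note mvb = mode_variance_bounds[OF assms(1) gb(1) \<beta>B r[OF n] rR pos(1) gb(3)[of n] gb(4)[of n] pos(2)
          gb(5)[of n] gb(6)[of n] pos(3) gb(7)[of n] gb(8)[of n], of \<epsilon>, folded D_def l1_def l2_def u1_def u2_def X_def Y_def steady_variance_def]
      show "l1 * X + l2 * (Y * (1 / freq_sq L n ^ 2)) \<le> steady_variance n"
        "steady_variance n \<le> u1 * X + u2 * (Y * (1 / freq_sq L n ^ 2))"
        using mvb by blast+
    qed
    define S1 where "S1 = (\<Sum>n\<in>torus L - {0 :: int^'d}. 1 / freq_sq L n ^ 1) / real (L ^ ?d)"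
    define S2 where "S2 = (\<Sum>n\<in>torus L - {0 :: int^'d}. 1 / freq_sq L n ^ 2) / real (L ^ ?d)"
    have S1: "k 1 / 2 * local_scaling ?d N \<le> S1" "S1 \<le> K 1 * local_scaling ?d N"
    proof -
      note fs = frequency_sum_bounds[OF Lb(2), of 1, where 'd = 'd, folded k_def K_def S1_def]
      have "k 1 * (local_scaling ?d N / 2) \<le> k 1 * lattice_scaling ?d 1 L"
        unfolding N using kK[of 1] by (intro mult_left_mono lattice_scaling_local d0 Lb(2)) auto
      then show "k 1 / 2 * local_scaling ?d N \<le> S1" using fs(1) by simp
      have "K 1 * lattice_scaling ?d 1 L \<le> K 1 * local_scaling ?d N"
        unfolding N using kK[of 1] by (intro mult_left_mono lattice_scaling_local d0 Lb(2)) auto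
      then show "S1 \<le> K 1 * local_scaling ?d N" using fs(2) by simp
    qed
    have S2: "k 2 / 4 * global_scaling ?d N \<le> S2" "S2 \<le> K 2 * global_scaling ?d N"
    proof -
      note fs = frequency_sum_bounds[OF Lb(2), of 2, where 'd = 'd, folded k_def K_def S2_def]
      have "k 2 * (global_scaling ?d N / 4) \<le> k 2 * lattice_scaling ?d 2 L"
        unfolding N using kK[of 2] by (intro mult_left_mono lattice_scaling_global d0 Lb(2)) auto
      then show "k 2 / 4 * global_scaling ?d N \<le> S2" using fs(1) by simp
      have "K 2 * lattice_scaling ?d 2 L \<le> K 2 * global_scaling ?d N"
        unfolding N using kK[of 2] by (intro mult_left_mono lattice_scaling_global d0 Lb(2)) auto
      then show "S2 \<le> K 2 * global_scaling ?d N" using fs(2) by simp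
    qed
    have "N \<ge> 1" using N Lb by simp
    then have \<sigma>: "0 \<le> local_scaling ?d N" "0 \<le> global_scaling ?d N"
      by (simp_all add: local_scaling_def global_scaling_def)
    have nn: "0 \<le> l1" "0 \<le> l2" "0 \<le> u1" "0 \<le> u2" "0 \<le> real ?d" using lu by simp_all
    let ?VL = "real ?d * ((\<Sum>n\<in>torus L - {0}. steady_variance n * laplace_symbol L n) / real (L ^ ?d))"
    let ?VG = "real ?d * ((\<Sum>n\<in>torus L - {0}. steady_variance n) / real (L ^ ?d))"
    have loc: "m * (X + Y * local_scaling ?d N) \<le> ?VL" "?VL \<le> m' * (X + Y * local_scaling ?d N)"
    proof -
      note mb = local_mean_bounds[OF Lb(3) XY nn(1,2,4) bnd, folded S1_def]
      have "0 \<le> 2 * real ?d * l1" "0 \<le> l2 / 20" "0 \<le> 2 * real ?d * u1" using nn by simp_all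
      note sb = scaled_bounds[OF XY \<sigma>(1) this nn(4,5) S1 mb lm]
      show "m * (X + Y * local_scaling ?d N) \<le> ?VL" by (rule sb(1))
      show "?VL \<le> m' * (X + Y * local_scaling ?d N)" by (rule sb(2))
    qed
    have glob: "m * (X + Y * global_scaling ?d N) \<le> ?VG" "?VG \<le> m' * (X + Y * global_scaling ?d N)"
    proof -
      note mb = global_mean_bounds[OF Lb(3) XY(1) nn(1) bnd nn(3), folded S2_def]
      have "0 \<le> l1 / 2" using nn by simp
      note sb = scaled_bounds[OF XY \<sigma>(2) this nn(2,3,4,5) S2 mb gm]
      show "m * (X + Y * global_scaling ?d N) \<le> ?VG" by (rule sb(1))
      show "?VG \<le> m' * (X + Y * global_scaling ?d N)" by (rule sb(2))
    qed
    show "\<exists>V. has_per_site_variance M L (local_error L x) V \<and>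
           m * (1 / \<beta> + \<epsilon>\<^sup>2 / \<beta> * local_scaling ?d N) \<le> V \<and>
           V \<le> m' * (1 / \<beta> + \<epsilon>\<^sup>2 / \<beta> * local_scaling ?d N)"
      using local_variance loc by (intro exI conjI) (auto simp: X_def Y_def)
    show "\<exists>V. has_per_site_variance M L (global_error L x) V \<and>
           m * (1 / \<beta> + \<epsilon>\<^sup>2 / \<beta> * global_scaling ?d N) \<le> V \<and>
           V \<le> m' * (1 / \<beta> + \<epsilon>\<^sup>2 / \<beta> * global_scaling ?d N)"
      using global_variance glob by (intro exI conjI) (auto simp: X_def Y_def)
  qed
qed

end
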